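(* Let $(G,S)$ be a recursively presented marked group such that $\rho(G,S)$ is upper semi-computable. Let $W\subseteq S^*$ be a set of words such that for each $w\in W$, either $\bar w=e_G$ or the normal closure $\langle\!\langle\bar w\rangle\!\rangle_G$ is non-amenable. Then there exists an algorithm which, given $w\in W$, decides whether $\bar w=e_G$. In particular, if $W=S^*$ then $G$ has decidable Word Problem.
   Context: A marked group $(G,S)$: $G$ finitely generated, $S$ finite symmetric generating set; $S^*$ is the set of words over $S$ and $\bar w$ the element represented by $w$. $\rho(G,S)=\limsup_n\sqrt[n]{p(n)}$ with $p(n)=|S|^{-n}\#\{w\in S^n:\bar w=e\}$. Recursively presented: $G=\langle S\mid R\rangle$ with $R$ recursively enumerable. A real is upper semi-computable if an algorithm enumerates a decreasing sequence of real algebraic numbers converging to it. *)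

theory Defs
  imports "HOL-Algebra.Generated_Groups" "HOL-Algebra.Coset"
    "HOL-Computational_Algebra.Polynomial"
    "HOL-Library.Nat_Bijection" "HOL-Library.Liminf_Limsup" "HOL-Library.Extended_Real"
begin

datatype recf = Zero | Succ | Proj nat | Comp recf "recf list" | Prim recf recf | Mn recf

inductive eval :: "recf \<Rightarrow> nat list \<Rightarrow> nat \<Rightarrow> bool" where
  zero: "eval Zero xs 0"
| succ: "eval Succ (x # xs) (Suc x)"
| proj: "i < length xs \<Longrightarrow> eval (Proj i) xs (xs ! i)"
| comp: "length ys = length gs \<Longrightarrow> (\<forall>j < length gs. eval (gs ! j) xs (ys ! j))
          \<Longrightarrow> eval f ys z \<Longrightarrow> eval (Comp f gs) xs z"
| prim0: "eval f xs y \<Longrightarrow> eval (Prim f g) (0 # xs) y"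
| primS: "eval (Prim f g) (n # xs) y \<Longrightarrow> eval g (n # y # xs) z
          \<Longrightarrow> eval (Prim f g) (Suc n # xs) z"
| mn: "eval f (n # xs) 0 \<Longrightarrow> (\<forall>m < n. \<exists>v. v > 0 \<and> eval f (m # xs) v)
          \<Longrightarrow> eval (Mn f) xs n"

definition rec_enum :: "nat set \<Rightarrow> bool" where
  "rec_enum A \<longleftrightarrow> (\<exists>p. \<forall>n. n \<in> A \<longleftrightarrow> (\<exists>v. eval p [n] v))"

text \<open>A code c decodes to a pair (l, k): l codes the list of integer coefficients
  (lowest degree first) of a polynomial P, and the code denotes the k-th smallest
  real root of P (counting from 0).\<close>
definition alg_poly :: "nat \<Rightarrow> real poly" where
  "alg_poly c = Poly (map (\<lambda>m. real_of_int (int_decode m)) (list_decode (fst (prod_decode c))))"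

definition alg_valid :: "nat \<Rightarrow> bool" where
  "alg_valid c \<longleftrightarrow> alg_poly c \<noteq> 0 \<and> snd (prod_decode c) < card {x. poly (alg_poly c) x = 0}"

definition alg_val :: "nat \<Rightarrow> real" where
  "alg_val c = sorted_list_of_set {x. poly (alg_poly c) x = 0} ! snd (prod_decode c)"

definition upper_semicomputable :: "real \<Rightarrow> bool" where
  "upper_semicomputable x \<longleftrightarrow>
     (\<exists>p a. (\<forall>n. eval p [n] (a n)) \<and> (\<forall>n. alg_valid (a n)) \<and>
            decseq (\<lambda>n. alg_val (a n)) \<and> (\<lambda>n. alg_val (a n)) \<longlonglongrightarrow> x)"

text \<open>A marked group: a group G with generating set S = sigma ` {..<k}, where sigma
  is injective on {..<k} (so |S| = k and letters are coded by 0..k-1), and S is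
  symmetric. Words over S are lists of letters in {..<k}.\<close>
definition marked_group :: "('g, 'b) monoid_scheme \<Rightarrow> nat \<Rightarrow> (nat \<Rightarrow> 'g) \<Rightarrow> bool" where
  "marked_group G k \<sigma> \<longleftrightarrow> group G \<and> \<sigma> ` {..<k} \<subseteq> carrier G \<and> inj_on \<sigma> {..<k} \<and>
     (\<forall>i<k. inv\<^bsub>G\<^esub> (\<sigma> i) \<in> \<sigma> ` {..<k}) \<and>
     generate G (\<sigma> ` {..<k}) = carrier G"

fun word_val :: "('g, 'b) monoid_scheme \<Rightarrow> (nat \<Rightarrow> 'g) \<Rightarrow> nat list \<Rightarrow> 'g" where
  "word_val G \<sigma> [] = \<one>\<^bsub>G\<^esub>"
| "word_val G \<sigma> (i # w) = \<sigma> i \<otimes>\<^bsub>G\<^esub> word_val G \<sigma> w"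

definition word_code :: "nat list \<Rightarrow> nat" where
  "word_code w = list_encode w"

definition return_prob :: "('g, 'b) monoid_scheme \<Rightarrow> nat \<Rightarrow> (nat \<Rightarrow> 'g) \<Rightarrow> nat \<Rightarrow> real" where
  "return_prob G k \<sigma> n =
     real (card {w \<in> lists {..<k}. length w = n \<and> word_val G \<sigma> w = \<one>\<^bsub>G\<^esub>}) / real k ^ n"

definition spectral_radius :: "('g, 'b) monoid_scheme \<Rightarrow> nat \<Rightarrow> (nat \<Rightarrow> 'g) \<Rightarrow> real" where
  "spectral_radius G k \<sigma> = real_of_ereal (limsup (\<lambda>n. ereal (root n (return_prob G k \<sigma> n))))"

text \<open>The congruence on words generated by free reductions (deleting a letter followed
  by a letter for its inverse) and by deleting relators from R; a word w satisfies
  pres_rel ... w [] iff it lies in the normal closure of R in the free group on S.\<close>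
inductive pres_rel :: "('g, 'b) monoid_scheme \<Rightarrow> nat \<Rightarrow> (nat \<Rightarrow> 'g) \<Rightarrow> nat list set
                       \<Rightarrow> nat list \<Rightarrow> nat list \<Rightarrow> bool"
  for G k \<sigma> R where
  refl: "pres_rel G k \<sigma> R w w"
| sym: "pres_rel G k \<sigma> R u v \<Longrightarrow> pres_rel G k \<sigma> R v u"
| trans: "pres_rel G k \<sigma> R u v \<Longrightarrow> pres_rel G k \<sigma> R v w \<Longrightarrow> pres_rel G k \<sigma> R u w"
| free: "i < k \<Longrightarrow> j < k \<Longrightarrow> \<sigma> j = inv\<^bsub>G\<^esub> (\<sigma> i) \<Longrightarrow>
         pres_rel G k \<sigma> R (u @ [i, j] @ v) (u @ v)"
| rel: "r \<in> R \<Longrightarrow> pres_rel G k \<sigma> R (u @ r @ v) (u @ v)"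

definition recursively_presented :: "('g, 'b) monoid_scheme \<Rightarrow> nat \<Rightarrow> (nat \<Rightarrow> 'g) \<Rightarrow> bool" where
  "recursively_presented G k \<sigma> \<longleftrightarrow>
     (\<exists>R. R \<subseteq> lists {..<k} \<and> rec_enum (word_code ` R) \<and>
          (\<forall>w \<in> lists {..<k}. word_val G \<sigma> w = \<one>\<^bsub>G\<^esub> \<longleftrightarrow> pres_rel G k \<sigma> R w []))"

definition normal_closure :: "('g, 'b) monoid_scheme \<Rightarrow> 'g \<Rightarrow> 'g set" where
  "normal_closure G x = generate G {g \<otimes>\<^bsub>G\<^esub> x \<otimes>\<^bsub>G\<^esub> inv\<^bsub>G\<^esub> g | g. g \<in> carrier G}"

definition amenable :: "('g, 'b) monoid_scheme \<Rightarrow> bool" where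
  "amenable H \<longleftrightarrow> (\<exists>\<mu> :: 'g set \<Rightarrow> real.
     (\<forall>A \<subseteq> carrier H. 0 \<le> \<mu> A) \<and> \<mu> (carrier H) = 1 \<and>
     (\<forall>A B. A \<subseteq> carrier H \<longrightarrow> B \<subseteq> carrier H \<longrightarrow> A \<inter> B = {} \<longrightarrow> \<mu> (A \<union> B) = \<mu> A + \<mu> B) \<and>
     (\<forall>g \<in> carrier H. \<forall>A \<subseteq> carrier H. \<mu> (g <#\<^bsub>H\<^esub> A) = \<mu> A))"

end

theory Submission
  imports Defs "HOL-Computational_Algebra.Polynomial_Factorial"
    "HOL-Computational_Algebra.Field_as_Ring" "HOL-Analysis.Function_Topology" "HOL-Analysis.Convex"
begin

text \<open>
  Triviality of \<open>w\<close> is semidecided by the presentation. Nontriviality is semidecided by enumerating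
  words that become trivial in the quotient by the normal closure \<open>N\<close> of \<open>w\<close>, until their number shows
  that some return probability of the quotient exceeds the corresponding power of an upper bound for
  the spectral radius \<open>\<rho>\<close> of \<open>G\<close>. This never happens if \<open>w\<close> is trivial, and it does happen if \<open>N\<close> is not
  amenable, by Kesten's theorem: suppose that the quotient has return probabilities at most \<open>\<rho>\<^sup>n\<close>, and
  let \<open>f\<close> be a finitely supported nonnegative function on \<open>G\<close> that almost attains the norm \<open>\<rho>\<close> of
  the averaging operator. Replacing \<open>f\<close> by the function of its \<open>\<ell>\<^sup>2\<close>-norms on the cosets of \<open>N\<close>
  increases every coefficient \<open>\<langle>g f, f\<rangle>\<close>, but the total increase is small. For \<open>g\<close> in \<open>N\<close> the
  coefficient increases to \<open>\<langle>f, f\<rangle>\<close>, hence \<open>f\<close> is almost invariant under \<open>N\<close>.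
\<close>

section \<open>Computable functions\<close>

text \<open>Each datum is used in the direction in which it can be approximated: the presentation
  bounds the return probabilities of a quotient from below, and the algebraic numbers bound \<rho>
  from above. So a proof of nontriviality is a single strict inequality at a single length, with a
  rational number in between. It is conclusive because return probabilities are supermultiplicative:
  those of G satisfy p(n) \<le> \<rho>^n for every n, not only in the limit. The analysis stays with
  finitely supported functions and elementary inequalities. Log-convexity of the norms of iterates
  controls the operator norm, and polarization links it to the numerical radius. The walks on G and
  on the quotient use the same letters, so both are averages over the same words. A word w with
  value in N has weight k^(-|w|) among the words of its length. As no coefficient decreases, k^|w|
  times the averaged increase bounds the increase at w; hence f must be the closer to optimal, the
  longer the words for the chosen elements of N are.\<close>

definition crec :: "nat \<Rightarrow> (nat list \<Rightarrow> nat) \<Rightarrow> bool" where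
  "crec n f \<longleftrightarrow> (\<exists>p. \<forall>xs. length xs = n \<longrightarrow> eval p xs (f xs))"

lemma crec_proj: "i < n \<Longrightarrow> crec n (\<lambda>xs. xs ! i)"
  unfolding crec_def by (rule exI[of _ "Proj i"]) (auto intro: eval.proj)

lemma crec_zero: "crec n (\<lambda>_. 0)"
  unfolding crec_def by (rule exI[of _ Zero]) (auto intro: eval.zero)

lemma crec_comp:
  assumes f: "crec (length gs) f" and gs: "\<And>g. g \<in> set gs \<Longrightarrow> crec n g"
  shows "crec n (\<lambda>xs. f (map (\<lambda>g. g xs) gs))"
proof -
  obtain p where p: "\<And>xs. length xs = length gs \<Longrightarrow> eval p xs (f xs)"
    using f unfolding crec_def by blast
  have "\<forall>g\<in>set gs. \<exists>q. \<forall>xs. length xs = n \<longrightarrow> eval q xs (g xs)"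
    using gs unfolding crec_def by blast
  then obtain q where q: "\<And>g xs. g \<in> set gs \<Longrightarrow> length xs = n \<Longrightarrow> eval (q g) xs (g xs)"
    by metis
  show ?thesis unfolding crec_def
    by (rule exI[of _ "Comp p (map q gs)"]) (auto intro!: eval.comp p q)
qed

lemma crec_comp1:
  assumes "crec 1 (\<lambda>xs. f (xs ! 0))" "crec n g"
  shows "crec n (\<lambda>xs. f (g xs))"
  using crec_comp[of "[g]" "\<lambda>xs. f (xs ! 0)" n] assms by simp

lemma crec_comp2:
  assumes "crec 2 (\<lambda>xs. f (xs ! 0) (xs ! 1))" "crec n g" "crec n h"
  shows "crec n (\<lambda>xs. f (g xs) (h xs))"
  using crec_comp[of "[g, h]" "\<lambda>xs. f (xs ! 0) (xs ! 1)" n] assms by (auto simp: numeral_2_eq_2)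

lemma length_1_conv: "length xs = 1 \<longleftrightarrow> (\<exists>x. xs = [x])"
  by (auto simp: length_Suc_conv)

lemma length_2_conv: "length xs = 2 \<longleftrightarrow> (\<exists>x y. xs = [x, y])"
  by (auto simp: length_Suc_conv numeral_2_eq_2)

lemma crec_Suc: "crec n g \<Longrightarrow> crec n (\<lambda>xs. Suc (g xs))"
proof (rule crec_comp1[of Suc])
  show "crec 1 (\<lambda>xs. Suc (xs ! 0))"
    unfolding crec_def length_1_conv by (rule exI[of _ Succ]) (auto intro: eval.succ)
qed

lemma crec_const: "crec n (\<lambda>_. c)"
  by (induction c) (auto intro: crec_zero crec_Suc)

text \<open>The recursion argument is the first entry, as in \<open>Prim\<close>. A single parameter
  is enough because several can be packed into one number by \<open>prod_encode\<close>.\<close>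

lemma crec_prim:
  assumes b: "crec 1 (\<lambda>xs. b (xs ! 0))" and h: "crec 3 (\<lambda>xs. h (xs ! 0) (xs ! 1) (xs ! 2))"
  shows "crec 2 (\<lambda>xs. rec_nat (b (xs ! 1)) (\<lambda>i y. h i y (xs ! 1)) (xs ! 0))"
proof -
  obtain p where "\<And>xs. length xs = 1 \<Longrightarrow> eval p xs (b (xs ! 0))"
    using b unfolding crec_def by blast
  from this[of "[_]"] have p: "eval p [x] (b x)" for x by simp
  obtain q where "\<And>xs. length xs = 3 \<Longrightarrow> eval q xs (h (xs ! 0) (xs ! 1) (xs ! 2))"
    using h unfolding crec_def by blast
  from this[of "[_, _, _]"] have q: "eval q [i, y, x] (h i y x)" for i y x
    by (simp add: numeral_2_eq_2)
  have "eval (Prim p q) [n, x] (rec_nat (b x) (\<lambda>i y. h i y x) n)" for n x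
    by (induction n) (auto intro: eval.prim0 eval.primS p q)
  then show ?thesis unfolding crec_def length_2_conv by (intro exI[of _ "Prim p q"]) auto
qed

text \<open>\<open>Mn\<close> asks for a defined positive value at every smaller argument. Totality
  of \<open>f\<close> supplies these values, and \<open>ex\<close> makes the search stop.\<close>

lemma crec_Least:
  assumes f: "crec 2 (\<lambda>xs. f (xs ! 0) (xs ! 1))" and ex: "\<And>x. \<exists>n. f n x = 0"
  shows "crec 1 (\<lambda>xs. LEAST n. f n (xs ! 0) = 0)"
proof -
  obtain p where "\<And>xs. length xs = 2 \<Longrightarrow> eval p xs (f (xs ! 0) (xs ! 1))"
    using f unfolding crec_def by blast
  from this[of "[_, _]"] have p: "eval p [n, x] (f n x)" for n x by simp
  have "eval (Mn p) [x] (LEAST n. f n x = 0)" for x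
  proof (rule eval.mn)
    have "f (LEAST n. f n x = 0) x = 0" using ex[of x] by (rule LeastI_ex)
    with p[of "LEAST n. f n x = 0" x] show "eval p [LEAST n. f n x = 0, x] 0" by simp
    show "\<forall>m<LEAST n. f n x = 0. \<exists>v. v > 0 \<and> eval p [m, x] v"
      using p not_less_Least by blast
  qed
  then show ?thesis unfolding crec_def length_1_conv by (intro exI[of _ "Mn p"]) auto
qed

lemma crec_add:
  assumes "crec n f" "crec n g" shows "crec n (\<lambda>xs. f xs + g xs)"
proof (rule crec_comp2[OF _ assms, of "(+)"])
  have "rec_nat x (\<lambda>i y. Suc y) n = n + x" for n x by (induction n) auto
  then show "crec 2 (\<lambda>xs. xs ! 0 + xs ! 1)"
    using crec_prim[of "\<lambda>x. x" "\<lambda>i y x. Suc y"] by (simp add: crec_proj crec_Suc)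
qed

lemma crec_mult:
  assumes "crec n f" "crec n g" shows "crec n (\<lambda>xs. f xs * g xs)"
proof (rule crec_comp2[OF _ assms, of "(*)"])
  have "rec_nat 0 (\<lambda>i y. y + x) n = n * x" for n x :: nat by (induction n) auto
  then show "crec 2 (\<lambda>xs. xs ! 0 * xs ! 1)"
    using crec_prim[of "\<lambda>x. 0" "\<lambda>i y x. y + x"] by (simp add: crec_proj crec_zero crec_add)
qed

lemma crec_pred:
  assumes "crec n f" shows "crec n (\<lambda>xs. f xs - 1)"
proof (rule crec_comp1[OF _ assms, of "\<lambda>x. x - 1"])
  have "rec_nat 0 (\<lambda>i y. i) n = n - 1" for n by (induction n) auto
  then have "crec 2 (\<lambda>xs. xs ! 0 - 1)"
    using crec_prim[of "\<lambda>x. 0" "\<lambda>i y x. i"] by (simp add: crec_proj crec_zero)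
  from crec_comp2[of "\<lambda>x y. x - 1", OF this, of 1 "\<lambda>xs. xs ! 0" "\<lambda>xs. xs ! 0"]
  show "crec 1 (\<lambda>xs. xs ! 0 - 1)" by (simp add: crec_proj)
qed

lemma crec_diff:
  assumes "crec n f" "crec n g" shows "crec n (\<lambda>xs. f xs - g xs)"
proof (rule crec_comp2[OF _ assms(2,1), of "\<lambda>y x. x - y"])
  have "rec_nat x (\<lambda>i y. y - 1) n = x - n" for n x :: nat by (induction n) auto
  then show "crec 2 (\<lambda>xs. xs ! 1 - xs ! 0)"
    using crec_prim[of "\<lambda>x. x" "\<lambda>i y x. y - 1"] crec_pred[OF crec_proj, of 1 3]
    by (simp add: crec_proj)
qed

section \<open>The pairing function and its inverse\<close>

lemma crec_triangle:
  assumes "crec n f" shows "crec n (\<lambda>xs. triangle (f xs))"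
proof (rule crec_comp1[OF _ assms, of triangle])
  have "rec_nat 0 (\<lambda>i y. y + Suc i) n = triangle n" for n by (induction n) auto
  then have "crec 2 (\<lambda>xs. triangle (xs ! 0))"
    using crec_prim[of "\<lambda>x. 0" "\<lambda>i y x. y + Suc i"]
      crec_add[OF crec_proj[of 1 3] crec_Suc[OF crec_proj[of 0 3]]]
    by (simp add: crec_proj crec_zero)
  from crec_comp2[of "\<lambda>x y. triangle x", OF this, of 1 "\<lambda>xs. xs ! 0" "\<lambda>xs. xs ! 0"]
  show "crec 1 (\<lambda>xs. triangle (xs ! 0))" by (simp add: crec_proj)
qed

lemma crec_prod_encode:
  assumes "crec n f" "crec n g" shows "crec n (\<lambda>xs. prod_encode (f xs, g xs))"
  unfolding prod_encode_def by (simp add: crec_add crec_triangle assms)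

lemma triangle_mono: "a \<le> b \<Longrightarrow> triangle a \<le> triangle b"
  by (induction b) (auto simp: le_Suc_eq)

text \<open>\<open>prod_encode (m, n)\<close> is \<open>triangle (m + n) + m\<close>, so m + n is
  the first s for which the code is less than \<open>triangle (Suc s)\<close>. The inequality
  appears as a vanishing truncated difference to fit \<open>crec_Least\<close>.\<close>

lemma Least_triangle:
  "(LEAST s. Suc (prod_encode (m, n)) - triangle (Suc s) = 0) = m + n"
proof (rule Least_equality)
  show "Suc (prod_encode (m, n)) - triangle (Suc (m + n)) = 0"
    by (simp add: prod_encode_def)
next
  fix s assume "Suc (prod_encode (m, n)) - triangle (Suc s) = 0"
  then have "triangle (m + n) < triangle (Suc s)" by (simp add: prod_encode_def)
  then have "\<not> Suc s \<le> m + n" using triangle_mono[of "Suc s" "m + n"] by linarith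
  then show "m + n \<le> s" by simp
qed

lemma crec_diagonal:
  "crec 1 (\<lambda>xs. LEAST s. Suc (xs ! 0) - triangle (Suc s) = 0)"
proof (rule crec_Least[of "\<lambda>s z. Suc z - triangle (Suc s)"])
  show "crec 2 (\<lambda>xs. Suc (xs ! 1) - triangle (Suc (xs ! 0)))"
    by (intro crec_diff crec_Suc crec_triangle crec_proj) auto
  show "\<exists>s. Suc z - triangle (Suc s) = 0" for z
    by (rule exI[of _ z]) simp
qed

lemma crec_fst_decode:
  assumes "crec n f" shows "crec n (\<lambda>xs. fst (prod_decode (f xs)))"
proof (rule crec_comp1[OF _ assms, of "\<lambda>z. fst (prod_decode z)"])
  have "fst (prod_decode z) = z - triangle (LEAST s. Suc z - triangle (Suc s) = 0)" for z
  proof -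
    obtain m n where "z = prod_encode (m, n)" by (metis prod_decode_inverse surj_pair)
    then show ?thesis by (simp only: Least_triangle) (simp, simp add: prod_encode_def)
  qed
  then show "crec 1 (\<lambda>xs. fst (prod_decode (xs ! 0)))"
    using crec_diff[OF crec_proj[of 0 1] crec_triangle[OF crec_diagonal]] by simp
qed

lemma crec_snd_decode:
  assumes "crec n f" shows "crec n (\<lambda>xs. snd (prod_decode (f xs)))"
proof (rule crec_comp1[OF _ assms, of "\<lambda>z. snd (prod_decode z)"])
  have "snd (prod_decode z) = (LEAST s. Suc z - triangle (Suc s) = 0) - fst (prod_decode z)" for z
  proof -
    obtain m n where "z = prod_encode (m, n)" by (metis prod_decode_inverse surj_pair)
    then show ?thesis by (simp only: Least_triangle) simp
  qed
  then show "crec 1 (\<lambda>xs. snd (prod_decode (xs ! 0)))"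
    using crec_diff[OF crec_diagonal crec_fst_decode[OF crec_proj[of 0 1]]] by simp
qed

text \<open>Codings are bijections with the natural numbers: every number is a valid code, so a
  program never has to check its input. This excludes finite types such as \<open>bool\<close>, and
  predicates are therefore handled through functions with values 0 and 1.\<close>

class coded =
  fixes enc :: "'a \<Rightarrow> nat" and dec :: "nat \<Rightarrow> 'a"
  assumes dec_enc [simp]: "dec (enc x) = x" and enc_dec [simp]: "enc (dec n) = n"

lemma enc_eq_iff [simp]: "enc x = enc y \<longleftrightarrow> x = y"
  by (metis dec_enc)

instantiation nat :: coded
begin
definition enc_nat :: "nat \<Rightarrow> nat" where [simp]: "enc_nat n = n"
definition dec_nat :: "nat \<Rightarrow> nat" where [simp]: "dec_nat n = n"
instance by standard auto
end

instantiation int :: coded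
begin
definition enc_int :: "int \<Rightarrow> nat" where "enc_int = int_encode"
definition dec_int :: "nat \<Rightarrow> int" where "dec_int = int_decode"
instance by standard (auto simp: enc_int_def dec_int_def)
end

instantiation prod :: (coded, coded) coded
begin
definition enc_prod :: "'a \<times> 'b \<Rightarrow> nat" where
  "enc_prod z = prod_encode (enc (fst z), enc (snd z))"
definition dec_prod :: "nat \<Rightarrow> 'a \<times> 'b" where
  "dec_prod n = (dec (fst (prod_decode n)), dec (snd (prod_decode n)))"
instance by standard (auto simp: enc_prod_def dec_prod_def)
end

instantiation list :: (coded) coded
begin
definition enc_list :: "'a list \<Rightarrow> nat" where "enc_list xs = list_encode (map enc xs)"
definition dec_list :: "nat \<Rightarrow> 'a list" where "dec_list n = map dec (list_decode n)"
instance by standard (auto simp: enc_list_def dec_list_def o_def)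
end

lemma enc_nat_list: "enc w = word_code w"
proof -
  have "enc = (id :: nat \<Rightarrow> nat)" by (simp add: fun_eq_iff)
  then show ?thesis by (simp add: enc_list_def word_code_def)
qed

definition computable :: "('a::coded \<Rightarrow> 'b::coded) \<Rightarrow> bool" where
  "computable f \<longleftrightarrow> crec 1 (\<lambda>xs. enc (f (dec (xs ! 0))))"

lemma computable_iff: "computable f \<longleftrightarrow> (\<exists>p. \<forall>x. eval p [enc x] (enc (f x)))"
proof
  assume "computable f"
  then obtain p where p: "\<And>xs. length xs = 1 \<Longrightarrow> eval p xs (enc (f (dec (xs ! 0))))"
    unfolding computable_def crec_def by blast
  have "eval p [enc x] (enc (f x))" for x using p[of "[enc x]"] by simp
  then show "\<exists>p. \<forall>x. eval p [enc x] (enc (f x))" by blast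
next
  assume "\<exists>p. \<forall>x. eval p [enc x] (enc (f x))"
  then obtain p where "\<And>x. eval p [enc x] (enc (f x))" by blast
  from this[of "dec _"] show "computable f"
    unfolding computable_def crec_def length_1_conv by (intro exI[of _ p]) auto
qed

named_theorems computable_intros

lemma computable_id [computable_intros]: "computable (\<lambda>x. x)"
  by (simp add: computable_def crec_proj)

lemma computable_const [computable_intros]: "computable (\<lambda>_. c)"
  by (simp add: computable_def crec_const)

lemma computable_comp:
  assumes "computable f" "computable g" shows "computable (\<lambda>x. f (g x))"
  using crec_comp1[of "\<lambda>n. enc (f (dec n))" 1 "\<lambda>xs. enc (g (dec (xs ! 0)))"] assms
  by (simp add: computable_def)

lemma computable_Pair [computable_intros]:
  "computable f \<Longrightarrow> computable g \<Longrightarrow> computable (\<lambda>x. (f x, g x))"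
  by (simp add: computable_def enc_prod_def crec_prod_encode)

lemma computable_fst [computable_intros]: "computable f \<Longrightarrow> computable (\<lambda>x. fst (f x))"
proof -
  have "computable (fst :: 'b::coded \<times> 'c::coded \<Rightarrow> 'b)"
    by (simp add: computable_def dec_prod_def crec_fst_decode crec_proj)
  then show "computable f \<Longrightarrow> computable (\<lambda>x. fst (f x :: 'b \<times> 'c))" by (rule computable_comp)
qed

lemma computable_snd [computable_intros]: "computable f \<Longrightarrow> computable (\<lambda>x. snd (f x))"
proof -
  have "computable (snd :: 'b::coded \<times> 'c::coded \<Rightarrow> 'c)"
    by (simp add: computable_def dec_prod_def crec_snd_decode crec_proj)
  then show "computable f \<Longrightarrow> computable (\<lambda>x. snd (f x :: 'b \<times> 'c))" by (rule computable_comp)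
qed

text \<open>As \<open>computable\<close> concerns unary functions, a binary \<open>h\<close> is
  given on pairs. The form with \<open>fst z\<close> and \<open>snd z\<close> lets the rule be
  applied under binders, where one component is the parameter and the other the bound
  variable.\<close>

lemma computable_comp2:
  assumes "computable (\<lambda>z. h (fst z) (snd z))" "computable f" "computable g"
  shows "computable (\<lambda>x. h (f x) (g x))"
  using computable_comp[OF assms(1) computable_Pair[OF assms(2,3)]] by simp

lemma computable_comp3:
  assumes "computable (\<lambda>z. h (fst z) (fst (snd z)) (snd (snd z)))"
    "computable f" "computable g" "computable k"
  shows "computable (\<lambda>x. h (f x) (g x) (k x))"
  using computable_comp[OF assms(1) computable_Pair[OF assms(2) computable_Pair[OF assms(3,4)]]]
  by simp

lemma computable_enc [computable_intros]: "computable f \<Longrightarrow> computable (\<lambda>x. enc (f x))"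
  by (simp add: computable_def)

lemma computable_dec [computable_intros]: "computable f \<Longrightarrow> computable (\<lambda>x. dec (f x))"
  by (simp add: computable_def)

lemma computable_Suc [computable_intros]: "computable f \<Longrightarrow> computable (\<lambda>x. Suc (f x))"
  and computable_add [computable_intros]:
    "computable f \<Longrightarrow> computable g \<Longrightarrow> computable (\<lambda>x. f x + g x :: nat)"
  and computable_diff [computable_intros]:
    "computable f \<Longrightarrow> computable g \<Longrightarrow> computable (\<lambda>x. f x - g x :: nat)"
  and computable_mult [computable_intros]:
    "computable f \<Longrightarrow> computable g \<Longrightarrow> computable (\<lambda>x. f x * g x :: nat)"
  by (simp_all add: computable_def crec_Suc crec_add crec_diff crec_mult)

text \<open>In \<open>crec_prim\<close> the parameter and the states are numbers. Here the code of x
  is the parameter, and each step decodes the state and encodes the new one.\<close>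

lemma computable_rec_nat [computable_intros]:
  assumes n: "computable n" and b: "computable b"
    and h: "computable (\<lambda>z. h (fst z) (fst (snd z)) (snd (snd z)))"
  shows "computable (\<lambda>x. rec_nat (b x) (h x) (n x))"
proof -
  let ?h = "\<lambda>i y x. enc (h (dec x) i (dec y))"
  have "crec 3 (\<lambda>xs. ?h (xs ! 0) (xs ! 1) (xs ! 2))"
    using crec_comp1[OF h[unfolded computable_def], of 3
        "\<lambda>xs. prod_encode (xs ! 2, prod_encode (xs ! 0, xs ! 1))"]
    by (simp add: dec_prod_def crec_prod_encode crec_proj)
  from crec_prim[of "\<lambda>x. enc (b (dec x))", OF b[unfolded computable_def] this]
  have 1: "crec 2 (\<lambda>xs. rec_nat (enc (b (dec (xs ! 1)))) (\<lambda>i y. ?h i y (xs ! 1)) (xs ! 0))" .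
  have "rec_nat (enc (b x)) (\<lambda>i y. enc (h x i (dec y))) m = enc (rec_nat (b x) (h x) m)" for x m
    by (induction m) auto
  with crec_comp2[OF 1 n[unfolded computable_def] crec_proj[of 0 1]]
  show ?thesis by (simp add: computable_def)
qed

section \<open>Decidable predicates\<close>

definition decidable :: "('a::coded \<Rightarrow> bool) \<Rightarrow> bool" where
  "decidable P \<longleftrightarrow> computable (\<lambda>x. if P x then 1 else 0 :: nat)"

text \<open>A recursion of length 0 or 1 selects the branch: it starts with \<open>g x\<close>, and
  its only step replaces this by \<open>f x\<close>.\<close>

lemma computable_if [computable_intros]:
  assumes "decidable P" "computable f" "computable g"
  shows "computable (\<lambda>x. if P x then f x else g x)"
proof -
  have "computable (\<lambda>z. f (fst z))" by (rule computable_comp[OF assms(2) computable_fst[OF computable_id]])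
  then have "computable (\<lambda>x. rec_nat (g x) (\<lambda>_ _. f x) (if P x then 1 else 0))"
    using assms unfolding decidable_def by (intro computable_intros)
  moreover have "rec_nat (g x) (\<lambda>_ _. f x) (if P x then 1 else 0) = (if P x then f x else g x)" for x
    by simp
  ultimately show ?thesis by simp
qed

lemma decidable_eq_0: "computable f \<Longrightarrow> decidable (\<lambda>x. f x = (0::nat))"
proof -
  assume "computable f"
  then have "computable (\<lambda>x. 1 - f x)" by (intro computable_intros)
  moreover have "1 - f x = (if f x = 0 then 1 else 0)" for x by simp
  ultimately show ?thesis unfolding decidable_def by simp
qed

lemma decidable_comp: "decidable P \<Longrightarrow> computable f \<Longrightarrow> decidable (\<lambda>x. P (f x))"
  unfolding decidable_def by (rule computable_comp)

lemma decidable_comp2: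
  assumes "decidable (\<lambda>z. P (fst z) (snd z))" "computable f" "computable g"
  shows "decidable (\<lambda>x. P (f x) (g x))"
  using decidable_comp[OF assms(1) computable_Pair[OF assms(2,3)]] by simp

lemma decidable_not [computable_intros]: "decidable P \<Longrightarrow> decidable (\<lambda>x. \<not> P x)"
proof -
  assume "decidable P"
  then have "decidable (\<lambda>x. (if P x then 1 else 0::nat) = 0)"
    by (intro decidable_eq_0 computable_intros)
  moreover have "((if P x then 1 else 0::nat) = 0) = (\<not> P x)" for x by simp
  ultimately show ?thesis by simp
qed

lemma decidable_conj [computable_intros]:
  "decidable P \<Longrightarrow> decidable Q \<Longrightarrow> decidable (\<lambda>x. P x \<and> Q x)"
proof -
  assume "decidable P" "decidable Q"
  then have "decidable (\<lambda>x. \<not> (if P x then (if Q x then 1 else 0) else 0::nat) = 0)"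
    by (intro decidable_eq_0 decidable_not computable_intros)
  moreover have "(\<not> (if P x then (if Q x then 1 else 0) else 0::nat) = 0) = (P x \<and> Q x)" for x
    by simp
  ultimately show ?thesis by simp
qed

lemma decidable_disj [computable_intros]:
  "decidable P \<Longrightarrow> decidable Q \<Longrightarrow> decidable (\<lambda>x. P x \<or> Q x)"
  using decidable_not[OF decidable_conj[OF decidable_not[of P] decidable_not[of Q]]] by simp

lemma decidable_le [computable_intros]:
  "computable f \<Longrightarrow> computable g \<Longrightarrow> decidable (\<lambda>x. f x \<le> (g x :: nat))"
  using decidable_eq_0[OF computable_diff, of f g] by simp

lemma decidable_less [computable_intros]:
  "computable f \<Longrightarrow> computable g \<Longrightarrow> decidable (\<lambda>x. f x < (g x :: nat))"
  using decidable_not[OF decidable_le] by (simp add: not_le)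

lemma decidable_eq [computable_intros]:
  assumes "computable f" "computable g" shows "decidable (\<lambda>x. f x = g x)"
proof -
  have "decidable (\<lambda>x. enc (f x) \<le> enc (g x) \<and> enc (g x) \<le> enc (f x))"
    using assms by (intro computable_intros)
  moreover have "(enc (f x) \<le> enc (g x) \<and> enc (g x) \<le> enc (f x)) \<longleftrightarrow> f x = g x" for x
    by (metis antisym enc_eq_iff order_refl)
  ultimately show ?thesis by simp
qed

lemma decidable_all_less [computable_intros]:
  fixes n :: "'a::coded \<Rightarrow> nat"
  assumes n: "computable n" and P: "decidable (\<lambda>z. P (fst z) (snd z))"
  shows "decidable (\<lambda>x. \<forall>i<n x. P x i)"
proof -
  let ?h = "\<lambda>x (i::nat) (y::nat). if P x i then y else 0"
  have "decidable (\<lambda>z. P (fst z) (fst (snd z)))"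
    by (rule decidable_comp2[OF P]; intro computable_intros)
  then have "decidable (\<lambda>x. \<not> rec_nat 1 (?h x) (n x) = 0)"
    using n by (intro computable_intros)
  moreover have "(\<not> rec_nat 1 (?h x) m = 0) = (\<forall>i<m. P x i)" for x m
    by (induction m) (auto simp: less_Suc_eq)
  ultimately show ?thesis by simp
qed

lemma decidable_ex_less [computable_intros]:
  fixes n :: "'a::coded \<Rightarrow> nat"
  assumes "computable n" "decidable (\<lambda>z. P (fst z) (snd z))"
  shows "decidable (\<lambda>x. \<exists>i<n x. P x i)"
  using decidable_not[OF decidable_all_less[OF assms(1) decidable_not[OF assms(2)]]] by simp

section \<open>Computable operations on lists\<close>

lemma computable_Cons [computable_intros]:
  "computable f \<Longrightarrow> computable g \<Longrightarrow> computable (\<lambda>x. f x # g x)"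
  by (simp add: computable_def enc_list_def crec_Suc crec_prod_encode)

lemma computable_case_list [computable_intros]:
  assumes l: "computable l" and b: "computable b"
    and h: "computable (\<lambda>z. h (fst z) (fst (snd z)) (snd (snd z)))"
  shows "computable (\<lambda>x. case l x of [] \<Rightarrow> b x | a # as \<Rightarrow> h x a as)"
proof -
  \<comment> \<open>The code of a nonempty list is the successor of the code of the pair of head and
    tail. For the empty list, whose code is 0, the decoded pair is junk and is never looked
    at.\<close>
  let ?d = "\<lambda>x. (dec (enc (l x) - 1) :: 'b \<times> 'b list)"
  have "computable (\<lambda>x. h x (fst (?d x)) (snd (?d x)))"
    by (rule computable_comp3[OF h]; intro computable_intros l)
  then have "computable (\<lambda>x. if enc (l x) = 0 then b x else h x (fst (?d x)) (snd (?d x)))"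
    using l b by (intro computable_intros)
  moreover have "(if enc (l x) = 0 then b x else h x (fst (?d x)) (snd (?d x)))
      = (case l x of [] \<Rightarrow> b x | a # as \<Rightarrow> h x a as)" for x
    by (cases "l x") (auto simp: enc_list_def dec_prod_def dec_list_def o_def)
  ultimately show ?thesis by simp
qed

lemma length_le_enc: "length xs \<le> enc xs"
proof (induction xs)
  case (Cons a xs)
  then show ?case
    using le_prod_encode_2[of "enc xs" "enc a"] by (simp add: enc_list_def)
qed auto

text \<open>The state of the iteration consists of the accumulator and the rest of the list. The
  code of the list serves as the number of rounds: it is at least the length, and rounds after the
  end change nothing.\<close>

lemma computable_foldl [computable_intros]:
  assumes l: "computable l" and b: "computable b"
    and h: "computable (\<lambda>z. h (fst z) (fst (snd z)) (snd (snd z)))"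
  shows "computable (\<lambda>x. foldl (h x) (b x) (l x))"
proof -
  let ?step = "\<lambda>x (i::nat) s. case snd s of [] \<Rightarrow> s | a # as \<Rightarrow> (h x (fst s) a, as)"
  let ?it = "\<lambda>x l n. rec_nat (b x, l) (?step x) n"
  have "computable (\<lambda>x. fst (?it x (l x) (enc (l x))))"
    using l b by (intro computable_intros computable_comp3[OF h])
  moreover have "rec_nat (c, l) (?step x) n = (foldl (h x) c (take n l), drop n l)" for x l n c
  proof (induction n)
    case (Suc n)
    show ?case
    proof (cases "n < length l")
      case True
      then have "drop n l = l ! n # drop (Suc n) l" by (simp add: Cons_nth_drop_Suc)
      with Suc True show ?thesis by (simp add: take_Suc_conv_app_nth)
    qed (use Suc in auto)
  qed auto
  moreover have "take (enc (l x)) (l x) = l x" for x by (simp add: length_le_enc)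
  ultimately show ?thesis by simp
qed

lemma computable_rev [computable_intros]:
  assumes "computable l" shows "computable (\<lambda>x. rev (l x))"
proof -
  have "computable (\<lambda>x. foldl (\<lambda>r a. a # r) [] (l x))" using assms by (intro computable_intros)
  moreover have "foldl (\<lambda>r a. a # r) r l = rev l @ r" for r l :: "'b list"
    by (induction l arbitrary: r) auto
  ultimately show ?thesis by simp
qed

lemma computable_append [computable_intros]:
  assumes "computable l" "computable m" shows "computable (\<lambda>x. l x @ m x)"
proof -
  have "computable (\<lambda>x. foldl (\<lambda>r a. a # r) (m x) (rev (l x)))"
    using assms by (intro computable_intros)
  moreover have "foldl (\<lambda>r a. a # r) r l = rev l @ r" for r l :: "'b list"
    by (induction l arbitrary: r) auto
  ultimately show ?thesis by simp
qed

lemma computable_length [computable_intros]: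
  assumes "computable l" shows "computable (\<lambda>x. length (l x))"
proof -
  have "computable (\<lambda>x. foldl (\<lambda>r a. Suc r) 0 (l x))" using assms by (intro computable_intros)
  moreover have "foldl (\<lambda>r a. Suc r) n l = length l + n" for n and l :: "'b list"
    by (induction l arbitrary: n) auto
  ultimately show ?thesis by simp
qed

lemma computable_map [computable_intros]:
  assumes "computable l" "computable (\<lambda>z. h (fst z) (snd z))"
  shows "computable (\<lambda>x. map (h x) (l x))"
proof -
  have h: "computable (\<lambda>z. h (fst z) (snd (snd z)))"
    by (rule computable_comp2[OF assms(2)]; intro computable_intros)
  have "computable (\<lambda>x. rev (foldl (\<lambda>r a. h x a # r) [] (l x)))"
    using assms by (intro computable_intros h)
  moreover have "foldl (\<lambda>r a. h x a # r) r l = rev (map (h x) l) @ r" for x r l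
    by (induction l arbitrary: r) auto
  ultimately show ?thesis by simp
qed

lemma computable_map_list:
  assumes "\<And>g. g \<in> set gs \<Longrightarrow> computable (h g)"
  shows "computable (\<lambda>x. map (\<lambda>g. h g x) gs)"
  using assms
proof (induction gs)
  case (Cons g gs)
  then have "computable (\<lambda>x. h g x # map (\<lambda>g. h g x) gs)" by (intro computable_Cons) simp_all
  then show ?case by simp
qed (simp add: computable_const)

lemma decidable_ball_set [computable_intros]:
  assumes l: "computable l" and P: "decidable (\<lambda>z. P (fst z) (snd z))"
  shows "decidable (\<lambda>x. \<forall>a\<in>set (l x). P x a)"
proof -
  have P': "decidable (\<lambda>z. P (fst z) (snd (snd z)))"
    by (rule decidable_comp2[OF P]; intro computable_intros)
  have "decidable (\<lambda>x. \<not> foldl (\<lambda>y a. if P x a then y else 0) (1::nat) (l x) = 0)"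
    using l by (intro computable_intros P')
  moreover have "(\<not> foldl (\<lambda>y a. if P x a then y else 0) y l = 0) = (y \<noteq> 0 \<and> (\<forall>a\<in>set l. P x a))"
    for x and y :: nat and l
    by (induction l arbitrary: y) auto
  ultimately show ?thesis by simp
qed

lemma computable_drop [computable_intros]:
  assumes "computable l" "computable n" shows "computable (\<lambda>x. drop (n x) (l x))"
proof -
  have "computable (\<lambda>x. rec_nat (l x) (\<lambda>i r. case r of [] \<Rightarrow> [] | a # as \<Rightarrow> as) (n x))"
    using assms by (intro computable_intros)
  moreover have "(case r of [] \<Rightarrow> [] | a # as \<Rightarrow> as) = tl r" for r :: "'b list"
    by (cases r) auto
  moreover have "rec_nat l (\<lambda>i r. tl r) n = drop n l" for n and l :: "'b list"
    by (induction n) (auto simp: drop_Suc tl_drop)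
  ultimately show ?thesis by simp
qed

section \<open>Semidecidable predicates\<close>

text \<open>\<open>sim p s xs\<close> runs \<open>p\<close> on \<open>xs\<close> with every unbounded search cut off at \<open>s\<close>; it returns the successor
  of the value, or \<open>0\<close> if there is none.\<close>
fun sim :: "recf \<Rightarrow> nat \<Rightarrow> nat list \<Rightarrow> nat" where
  "sim Zero s xs = 1"
| "sim Succ s xs = (case xs of [] \<Rightarrow> 0 | x # _ \<Rightarrow> Suc (Suc x))"
| "sim (Proj i) s xs = (case drop i xs of [] \<Rightarrow> 0 | x # _ \<Rightarrow> Suc x)"
| "sim (Comp f gs) s xs =
    (if \<forall>y\<in>set (map (\<lambda>g. sim g s xs) gs). y \<noteq> 0
     then sim f s (map (\<lambda>y. y - 1) (map (\<lambda>g. sim g s xs) gs)) else 0)"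
| "sim (Prim f g) s xs =
    (case xs of [] \<Rightarrow> 0
     | n # as \<Rightarrow> rec_nat (sim f s as) (\<lambda>i y. if y = 0 then 0 else sim g s (i # (y - 1) # as)) n)"
| "sim (Mn f) s xs =
    rec_nat 0 (\<lambda>i r. if r \<noteq> 0 then r
      else if sim f s (i # xs) = 1 \<and> (\<forall>j<i. 1 < sim f s (j # xs)) then Suc i else 0) s"

text \<open>The program is fixed from outside, so structural induction over \<open>recf\<close>
  builds one computable function for each program.\<close>

lemma computable_sim: "computable (\<lambda>z. sim p (fst z) (snd z))"
proof (induction p)
  case Zero
  show ?case by (simp add: computable_const)
next
  case Succ
  show ?case by (simp, intro computable_intros)
next
  case (Proj i)
  show ?case by (simp, intro computable_intros)
next
  case (Comp f gs)
  have gs: "computable (\<lambda>z. map (\<lambda>g. sim g (fst z) (snd z)) gs)"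
    using Comp(2) by (rule computable_map_list)
  show ?case
    unfolding sim.simps by (intro computable_intros computable_comp2[OF Comp(1)] gs)
next
  case (Prim f g)
  show ?case
    unfolding sim.simps
    by (intro computable_intros computable_comp2[OF Prim(1)] computable_comp2[OF Prim(2)])
next
  case (Mn f)
  show ?case
    unfolding sim.simps by (intro computable_intros computable_comp2[OF Mn])
qed

text \<open>When this is applied to \<open>Mn\<close>, the condition at i includes that all values
  before i are positive, so at most one i satisfies it. This is why uniqueness may be assumed in the
  second part.\<close>

lemma rec_nat_search:
  fixes Q :: "nat \<Rightarrow> bool"
  defines "F \<equiv> rec_nat 0 (\<lambda>i r. if r \<noteq> 0 then r else if Q i then Suc i else 0)"
  shows "F s = Suc n \<Longrightarrow> Q n"
    and "n < s \<Longrightarrow> Q n \<Longrightarrow> (\<And>m. Q m \<Longrightarrow> m = n) \<Longrightarrow> F s = Suc n"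
proof -
  show Q: "F s = Suc n \<Longrightarrow> Q n" for s n
    unfolding F_def by (induction s) (auto split: if_splits)
  have nz: "n < s \<Longrightarrow> Q n \<Longrightarrow> F s \<noteq> 0"
    unfolding F_def by (induction s) (auto simp: less_Suc_eq)
  show "n < s \<Longrightarrow> Q n \<Longrightarrow> (\<And>m. Q m \<Longrightarrow> m = n) \<Longrightarrow> F s = Suc n"
    using nz Q by (metis not0_implies_Suc)
qed

lemma sim_sound: "sim p s xs = Suc v \<Longrightarrow> eval p xs v"
proof (induction p arbitrary: xs v)
  case Zero
  then show ?case by (auto intro: eval.zero)
next
  case Succ
  then show ?case by (auto intro: eval.succ split: list.splits)
next
  case (Proj i)
  then obtain as where "drop i xs = v # as" by (auto split: list.splits)
  then have "i < length xs" "v = xs ! i"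
    by (auto simp: nth_via_drop intro: ccontr)
  then show ?case by (auto intro: eval.proj)
next
  case (Comp f gs)
  let ?ys = "map (\<lambda>g. sim g s xs - 1) gs"
  from Comp.prems have nz: "\<forall>g\<in>set gs. sim g s xs \<noteq> 0" and f: "sim f s ?ys = Suc v"
    by (auto split: if_splits simp: o_def)
  show ?case
  proof (rule eval.comp)
    show "\<forall>j<length gs. eval (gs ! j) xs (?ys ! j)"
      using nz by (auto intro!: Comp.IH(2))
    show "eval f ?ys v" using f by (rule Comp.IH(1))
  qed simp
next
  case (Prim f g)
  then obtain n as where xs: "xs = n # as" by (auto split: list.splits)
  have "rec_nat (sim f s as) (\<lambda>i y. if y = 0 then 0 else sim g s (i # (y - 1) # as)) n = Suc v
      \<Longrightarrow> eval (Prim f g) (n # as) v" for n v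
  proof (induction n arbitrary: v)
    case 0
    then show ?case by (auto intro: eval.prim0 Prim.IH(1))
  next
    case (Suc n)
    then show ?case
      by (auto split: if_splits intro!: eval.primS Suc.IH Prim.IH(2))
  qed
  then show ?case using Prim.prems xs by simp
next
  case (Mn f)
  from rec_nat_search(1)[OF Mn.prems[unfolded sim.simps]]
  have v: "sim f s (v # xs) = 1" and m: "\<forall>j<v. 1 < sim f s (j # xs)" by auto
  show ?case
  proof (rule eval.mn)
    show "eval f (v # xs) 0" using v by (auto intro: Mn.IH)
    show "\<forall>m<v. \<exists>u. u > 0 \<and> eval f (m # xs) u"
    proof (intro allI impI)
      fix j assume "j < v"
      with m have "sim f s (j # xs) = Suc (sim f s (j # xs) - 1)" "sim f s (j # xs) - 1 > 0" by auto
      then show "\<exists>u. u > 0 \<and> eval f (j # xs) u" using Mn.IH by blast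
    qed
  qed
qed

text \<open>The filter form lets the cut-offs of finitely many subcomputations be combined directly,
  as the cases of \<open>Comp\<close> and \<open>Mn\<close> require.\<close>

lemma sim_complete: "eval p xs v \<Longrightarrow> \<forall>\<^sub>F s in sequentially. sim p s xs = Suc v"
proof (induction rule: eval.induct)
  case (proj i xs)
  then show ?case by (simp add: Cons_nth_drop_Suc[symmetric])
next
  case (comp ys gs xs f z)
  have "\<forall>\<^sub>F s in sequentially. \<forall>j\<in>{..<length gs}. sim (gs ! j) s xs = Suc (ys ! j)"
    using comp.IH comp.hyps by (intro eventually_ball_finite) auto
  with comp.IH(2) show ?case
  proof eventually_elim
    case (elim s)
    then have "map (\<lambda>g. sim g s xs) gs = map Suc ys"
      using comp(1) by (intro nth_equalityI) auto
    with elim show ?case by (simp add: o_def)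
  qed
next
  case (primS f g n xs y z)
  from primS.IH show ?case by eventually_elim simp
next
  case (mn f n xs)
  have "\<forall>\<^sub>F s in sequentially. \<forall>m\<in>{..<n}. 1 < sim f s (m # xs)"
  proof (intro eventually_ball_finite ballI)
    fix m assume "m \<in> {..<n}"
    with mn.IH(2) obtain u where "u > 0" "\<forall>\<^sub>F s in sequentially. sim f s (m # xs) = Suc u" by auto
    from this(2,1) show "\<forall>\<^sub>F s in sequentially. 1 < sim f s (m # xs)"
      by (auto elim: eventually_mono)
  qed auto
  \<comment> \<open>The search tries only candidates below the cut-off, so s must also exceed the
    result n.\<close>
  with mn.IH(1) eventually_gt_at_top[of n] show ?case
  proof eventually_elim
    case (elim s)
    show ?case unfolding sim.simps
    proof (rule rec_nat_search(2)[OF elim(2)])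
      fix m assume m: "sim f s (m # xs) = 1 \<and> (\<forall>j<m. 1 < sim f s (j # xs))"
      show "m = n"
      proof (rule linorder_cases[of m n])
        assume "m < n"
        then have "1 < sim f s (m # xs)" using elim(3) by blast
        then show ?thesis using m by simp
      next
        assume "n < m" then show ?thesis using elim(1) m by auto
      qed
    qed (use elim in auto)
  qed
qed auto

definition semidecidable :: "('a::coded \<Rightarrow> bool) \<Rightarrow> bool" where
  "semidecidable P \<longleftrightarrow> (\<exists>Q. decidable Q \<and> (\<forall>x. P x \<longleftrightarrow> (\<exists>s::nat. Q (x, s))))"

lemma semidecidableE:
  assumes "semidecidable P"
  obtains Q where "decidable (\<lambda>z. Q (fst z) (snd z))" "\<And>x. P x \<longleftrightarrow> (\<exists>s::nat. Q x s)"
proof -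
  from assms obtain Q where "decidable Q" "\<And>x. P x \<longleftrightarrow> (\<exists>s::nat. Q (x, s))"
    unfolding semidecidable_def by blast
  then show ?thesis using that[of "\<lambda>x s. Q (x, s)"] by simp
qed

text \<open>Witnesses may come from any coded type, in particular tuples and lists;
  \<open>dec\<close> makes them numbers.\<close>

lemma semidecidableI:
  assumes "decidable (\<lambda>z. Q (fst z) (snd z))" "\<And>x. P x \<longleftrightarrow> (\<exists>y::'b::coded. Q x y)"
  shows "semidecidable P"
  unfolding semidecidable_def
proof (intro exI[of _ "\<lambda>z. Q (fst z) (dec (snd z))"] conjI allI)
  show "decidable (\<lambda>z. Q (fst z) (dec (snd z)))"
    by (rule decidable_comp2[OF assms(1)]; intro computable_intros)
  show "P x \<longleftrightarrow> (\<exists>s. Q (fst (x, s)) (dec (snd (x, s))))" for x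
    using assms(2)[of x] by (metis dec_enc fst_conv snd_conv)
qed

named_theorems semidecidable_intros

lemma semidecidable_decidable: "decidable P \<Longrightarrow> semidecidable P"
  by (rule semidecidableI[of "\<lambda>x (s::nat). P x"])
     (simp_all add: decidable_comp[OF _ computable_fst[OF computable_id]])

lemma semidecidable_comp:
  assumes "semidecidable P" "computable f" shows "semidecidable (\<lambda>x. P (f x))"
proof -
  obtain Q where Q: "decidable (\<lambda>z. Q (fst z) (snd z))" "\<And>x. P x \<longleftrightarrow> (\<exists>s::nat. Q x s)"
    using assms(1) by (rule semidecidableE) blast
  show ?thesis
  proof (rule semidecidableI[of "\<lambda>x s. Q (f x) s"])
    show "decidable (\<lambda>z. Q (f (fst z)) (snd z))"
      by (rule decidable_comp2[OF Q(1)]; intro computable_comp[OF assms(2)] computable_intros)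
  qed (rule Q(2))
qed

lemma semidecidable_comp3:
  assumes "semidecidable (\<lambda>z. P (fst z) (fst (snd z)) (snd (snd z)))"
    "computable f" "computable g" "computable h"
  shows "semidecidable (\<lambda>x. P (f x) (g x) (h x))"
  using semidecidable_comp[OF assms(1) computable_Pair[OF assms(2) computable_Pair[OF assms(3,4)]]]
  by simp

lemma semidecidable_conj [semidecidable_intros]:
  assumes "semidecidable P" "semidecidable P'" shows "semidecidable (\<lambda>x. P x \<and> P' x)"
proof -
  obtain Q where Q: "decidable (\<lambda>z. Q (fst z) (snd z))" "\<And>x. P x \<longleftrightarrow> (\<exists>s::nat. Q x s)"
    using assms(1) by (rule semidecidableE) blast
  obtain Q' where Q': "decidable (\<lambda>z. Q' (fst z) (snd z))" "\<And>x. P' x \<longleftrightarrow> (\<exists>s::nat. Q' x s)"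
    using assms(2) by (rule semidecidableE) blast
  show ?thesis
  proof (rule semidecidableI[of "\<lambda>x s. Q x (fst s) \<and> Q' x (snd s)"])
    show "decidable (\<lambda>z. Q (fst z) (fst (snd z)) \<and> Q' (fst z) (snd (snd z)))"
      by (intro computable_intros decidable_comp2[OF Q(1)] decidable_comp2[OF Q'(1)])
  qed (auto simp: Q(2) Q'(2))
qed

lemma semidecidable_ex [semidecidable_intros]:
  fixes P :: "'a::coded \<Rightarrow> 'b::coded \<Rightarrow> bool"
  assumes "semidecidable (\<lambda>z. P (fst z) (snd z))" shows "semidecidable (\<lambda>x. \<exists>y. P x y)"
proof -
  obtain Q where Q: "decidable (\<lambda>z. Q (fst z) (snd z))"
      "\<And>x. P (fst x) (snd x) \<longleftrightarrow> (\<exists>s::nat. Q x s)"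
    using assms by (rule semidecidableE) blast
  show ?thesis
  proof (rule semidecidableI[of "\<lambda>x s. Q (x, fst s) (snd s)"])
    show "decidable (\<lambda>z. Q (fst z, fst (snd z)) (snd (snd z)))"
      by (rule decidable_comp2[OF Q(1)]; intro computable_intros)
    show "(\<exists>y. P x y) \<longleftrightarrow> (\<exists>s. Q (x, fst s) (snd s))" for x
      using Q(2)[of "(x, _)"] by simp
  qed
qed

lemma semidecidable_disj [semidecidable_intros]:
  assumes "semidecidable P" "semidecidable P'" shows "semidecidable (\<lambda>x. P x \<or> P' x)"
proof -
  obtain Q where Q: "decidable (\<lambda>z. Q (fst z) (snd z))" "\<And>x. P x \<longleftrightarrow> (\<exists>s::nat. Q x s)"
    using assms(1) by (rule semidecidableE) blast
  obtain Q' where Q': "decidable (\<lambda>z. Q' (fst z) (snd z))" "\<And>x. P' x \<longleftrightarrow> (\<exists>s::nat. Q' x s)"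
    using assms(2) by (rule semidecidableE) blast
  show ?thesis
  proof (rule semidecidableI[of "\<lambda>x s. Q x s \<or> Q' x s"])
    show "decidable (\<lambda>z. Q (fst z) (snd z) \<or> Q' (fst z) (snd z))"
      by (intro computable_intros Q(1) Q'(1))
  qed (auto simp: Q(2) Q'(2))
qed

text \<open>Finitely many witnesses have a common strict bound t, and the existential quantifier
  below t is decidable.\<close>

lemma semidecidable_ball_set [semidecidable_intros]:
  fixes P :: "'a::coded \<Rightarrow> 'b::coded \<Rightarrow> bool"
  assumes l: "computable l" and P: "semidecidable (\<lambda>z. P (fst z) (snd z))"
  shows "semidecidable (\<lambda>x. \<forall>a\<in>set (l x). P x a)"
proof -
  obtain Q where Q: "decidable (\<lambda>z. Q (fst z) (snd z))"
      "\<And>x. P (fst x) (snd x) \<longleftrightarrow> (\<exists>s::nat. Q x s)"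
    using P by (rule semidecidableE) blast
  show ?thesis
  proof (rule semidecidableI[of "\<lambda>x t. \<forall>a\<in>set (l x). \<exists>s<t. Q (x, a) s"])
    show "decidable (\<lambda>z. \<forall>a\<in>set (l (fst z)). \<exists>s<snd z. Q (fst z, a) s)"
      by (intro computable_intros computable_comp[OF l] decidable_comp2[OF Q(1)])
    show "(\<forall>a\<in>set (l x). P x a) \<longleftrightarrow> (\<exists>t. \<forall>a\<in>set (l x). \<exists>s<t. Q (x, a) s)" for x
    proof
      assume "\<forall>a\<in>set (l x). P x a"
      then obtain s where s: "\<And>a. a \<in> set (l x) \<Longrightarrow> Q (x, a) (s a)"
        using Q(2)[of "(x, _)"] by simp metis
      have "\<forall>a\<in>set (l x). s a < Suc (Max (s ` set (l x)))" by (simp add: less_Suc_eq_le)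
      with s show "\<exists>t. \<forall>a\<in>set (l x). \<exists>s<t. Q (x, a) s" by blast
    next
      assume "\<exists>t. \<forall>a\<in>set (l x). \<exists>s<t. Q (x, a) s"
      then show "\<forall>a\<in>set (l x). P x a" using Q(2)[of "(x, _)"] by auto
    qed
  qed
qed

text \<open>The list may contain steps that do not start at the current point; they are skipped.\<close>
lemma rtranclp_iff_foldl:
  "r\<^sup>*\<^sup>* a b \<longleftrightarrow> (\<exists>ps. foldl (\<lambda>c p. if fst p = c then snd p else c) a ps = b
                  \<and> (\<forall>p\<in>set ps. r (fst p) (snd p)))"
    (is "_ \<longleftrightarrow> (\<exists>ps. foldl ?f a ps = b \<and> ?A ps)")
proof
  show "r\<^sup>*\<^sup>* a b \<Longrightarrow> \<exists>ps. foldl ?f a ps = b \<and> ?A ps"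
  proof (induction rule: rtranclp_induct)
    case base
    show ?case by (rule exI[of _ "[]"]) simp
  next
    case (step y z)
    then obtain ps where "foldl ?f a ps = y" "?A ps" by blast
    with step show ?case by (intro exI[of _ "ps @ [(y, z)]"]) auto
  qed
next
  assume "\<exists>ps. foldl ?f a ps = b \<and> ?A ps"
  then obtain ps where "foldl ?f a ps = b" "?A ps" by blast
  then show "r\<^sup>*\<^sup>* a b"
  proof (induction ps arbitrary: b rule: rev_induct)
    case (snoc p ps)
    then have "r\<^sup>*\<^sup>* a (foldl ?f a ps)" by simp
    then show ?case using snoc.prems by (auto intro: rtranclp.rtrancl_into_rtrancl)
  qed simp
qed

lemma semidecidable_rtranclp:
  assumes "semidecidable (\<lambda>z. r (fst z) (fst (snd z)) (snd (snd z)))"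
    "computable f" "computable g" "computable h"
  shows "semidecidable (\<lambda>x. (r (f x))\<^sup>*\<^sup>* (g x) (h x))"
  unfolding rtranclp_iff_foldl
  by (intro semidecidable_intros semidecidable_comp3[OF assms(1)] computable_intros
      computable_comp[OF assms(2)] computable_comp[OF assms(3)] computable_comp[OF assms(4)]
      semidecidable_decidable)

text \<open>The witness for membership is a cut-off at which the simulated program returns a
  value.\<close>

lemma rec_enum_semidecidable:
  assumes "rec_enum (word_code ` R)" shows "semidecidable (\<lambda>w. w \<in> R)"
proof -
  obtain p where p: "\<And>n. n \<in> word_code ` R \<longleftrightarrow> (\<exists>v. eval p [n] v)"
    using assms unfolding rec_enum_def by blast
  have R: "w \<in> R \<longleftrightarrow> (\<exists>v. eval p [enc w] v)" for w
    using p[of "enc w"] unfolding enc_nat_list by (auto simp: word_code_def list_encode_eq)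
  show ?thesis
  proof (rule semidecidableI[of "\<lambda>w s. sim p s [enc w] \<noteq> 0"])
    show "decidable (\<lambda>z. sim p (snd z) [enc (fst z)] \<noteq> 0)"
      by (intro computable_intros computable_comp2[OF computable_sim])
    show "w \<in> R \<longleftrightarrow> (\<exists>s. sim p s [enc w] \<noteq> 0)" for w
    proof
      assume "w \<in> R"
      then obtain v where "\<forall>\<^sub>F s in sequentially. sim p s [enc w] = Suc v"
        using R sim_complete by blast
      then show "\<exists>s. sim p s [enc w] \<noteq> 0"
        unfolding eventually_sequentially by (metis Zero_not_Suc order_refl)
    next
      assume "\<exists>s. sim p s [enc w] \<noteq> 0"
      then show "w \<in> R" using R sim_sound by (metis not0_implies_Suc)
    qed
  qed
qed

text \<open>Both witness relations are tried at s = 0, 1, 2, ... until one of them holds, and the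
  one that holds gives the answer. On W the search stops, since exactly one of \<open>P x\<close>
  and \<open>Q x\<close> is true; outside W it may run forever.\<close>

lemma semidecidable_complementary_decider:
  assumes "semidecidable P" "semidecidable Q" and W: "\<And>x. x \<in> W \<Longrightarrow> Q x \<longleftrightarrow> \<not> P x"
  shows "\<exists>p. \<forall>x\<in>W. eval p [enc x] (if P x then 1 else 0)"
proof -
  obtain A where A: "decidable (\<lambda>z. A (fst z) (snd z))" "\<And>x. P x \<longleftrightarrow> (\<exists>s::nat. A x s)"
    using assms(1) by (rule semidecidableE) blast
  obtain B where B: "decidable (\<lambda>z. B (fst z) (snd z))" "\<And>x. Q x \<longleftrightarrow> (\<exists>s::nat. B x s)"
    using assms(2) by (rule semidecidableE) blast
  let ?f = "\<lambda>s x. if A x s \<or> B x s then 0 else 1 :: nat"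
  have "computable (\<lambda>z. ?f (fst z) (snd z))"
    by (intro computable_intros decidable_comp2[OF A(1)] decidable_comp2[OF B(1)])
  from crec_comp1[OF this[unfolded computable_def], of 2 "\<lambda>xs. prod_encode (xs ! 0, xs ! 1)"]
  have "crec 2 (\<lambda>xs. ?f (xs ! 0) (dec (xs ! 1)))"
    by (simp add: crec_prod_encode crec_proj dec_prod_def if_distrib cong: if_cong)
  then obtain p where p: "\<And>xs. length xs = 2 \<Longrightarrow> eval p xs (?f (xs ! 0) (dec (xs ! 1)))"
    unfolding crec_def by blast
  have p: "eval p [s, enc x] (?f s x)" for s x
    using p[of "[s, enc x]"] by (simp cong: if_cong)
  have "computable (\<lambda>z. if A (fst z) (snd z) then 1 else 0 :: nat)"
    using A(1) unfolding decidable_def .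
  from crec_comp1[OF this[unfolded computable_def], of 2 "\<lambda>xs. prod_encode (xs ! 0, xs ! 1)"]
  have "crec 2 (\<lambda>xs. if A (dec (xs ! 0)) (xs ! 1) then 1 else 0)"
    by (simp add: crec_prod_encode crec_proj dec_prod_def if_distrib cong: if_cong)
  then obtain q where q: "\<And>xs. length xs = 2 \<Longrightarrow>
      eval q xs (if A (dec (xs ! 0)) (xs ! 1) then 1 else 0)"
    unfolding crec_def by blast
  have q: "eval q [enc x, s] (if A x s then 1 else 0)" for s x
    using q[of "[enc x, s]"] by (simp cong: if_cong)
  \<comment> \<open>\<open>Mn p\<close> finds the first successful stage, and q reads off whether it
    is a witness for P.\<close>
  have "eval (Comp q [Proj 0, Mn p]) [enc x] (if P x then 1 else 0)" if "x \<in> W" for x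
  proof -
    define s where "s = (LEAST s. A x s \<or> B x s)"
    have ex: "\<exists>s. A x s \<or> B x s" using W[OF that] A(2) B(2) by blast
    then have s: "A x s \<or> B x s" unfolding s_def by (rule LeastI_ex)
    have "eval (Mn p) [enc x] s"
    proof (rule eval.mn)
      show "eval p [s, enc x] 0" using p[of s x] s by simp
      show "\<forall>m<s. \<exists>v. v > 0 \<and> eval p [m, enc x] v"
      proof (intro allI impI)
        fix m assume "m < s"
        then have "\<not> (A x m \<or> B x m)" unfolding s_def by (rule not_less_Least)
        then show "\<exists>v. v > 0 \<and> eval p [m, enc x] v" using p[of m x] by (intro exI[of _ 1]) simp
      qed
    qed
    moreover have "eval (Proj 0) [enc x] (enc x)" using eval.proj[of 0 "[enc x]"] by simp
    ultimately have "eval (Comp q [Proj 0, Mn p]) [enc x] (if A x s then 1 else 0)"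
      by (intro eval.comp[of "[enc x, s]"] q) (auto simp: less_Suc_eq)
    moreover have "A x s \<longleftrightarrow> P x" using s W[OF that] A(2) B(2) by blast
    ultimately show ?thesis by simp
  qed
  then show ?thesis by blast
qed

section \<open>Parity, integer arithmetic and powers\<close>

lemma computable_mod_2 [computable_intros]:
  assumes "computable f" shows "computable (\<lambda>x. f x mod 2 :: nat)"
proof -
  have "computable (\<lambda>x. rec_nat 0 (\<lambda>i y. 1 - y) (f x) :: nat)" using assms by (intro computable_intros)
  moreover have "rec_nat 0 (\<lambda>i y. 1 - y) n = n mod (2::nat)" for n
    by (induction n) (auto simp: mod_Suc)
  ultimately show ?thesis by (simp only:)
qed

lemma computable_div_2 [computable_intros]:
  assumes "computable f" shows "computable (\<lambda>x. f x div 2 :: nat)"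
proof -
  have "computable (\<lambda>x. rec_nat 0 (\<lambda>i y. y + i mod 2) (f x) :: nat)"
    using assms by (intro computable_intros)
  moreover have "rec_nat 0 (\<lambda>i y. y + i mod 2) n = n div (2::nat)" for n
    by (induction n) (auto, presburger)
  ultimately show ?thesis by (simp only:)
qed

lemma decidable_even [computable_intros]:
  "computable f \<Longrightarrow> decidable (\<lambda>x. even (f x :: nat))"
  unfolding even_iff_mod_2_eq_zero by (intro computable_intros)

text \<open>Nonnegative integers have even codes and negative ones odd codes, so both parts can be
  read off a code. The other integer operations are reduced to positive and negative parts.\<close>

lemma computable_nat [computable_intros]:
  assumes "computable f" shows "computable (\<lambda>x. nat (f x))" "computable (\<lambda>x. nat (- f x))"
proof -
  have c: "even c \<Longrightarrow> int_decode c = int (c div 2)" "odd c \<Longrightarrow> int_decode c = - int (c div 2) - 1" for c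
    by (simp_all add: int_decode_def sum_decode_def)
  have "nat (int_decode c) = (if even c then c div 2 else 0)"
    "nat (- int_decode c) = (if even c then 0 else Suc (c div 2))" for c
    by (simp_all add: c nat_add_distrib)
  from this[of "enc (f _)"]
  have eq: "nat (f x) = (if even (enc (f x)) then enc (f x) div 2 else 0)"
    "nat (- f x) = (if even (enc (f x)) then 0 else Suc (enc (f x) div 2))" for x
    by (simp_all add: enc_int_def)
  show "computable (\<lambda>x. nat (f x))"
    unfolding eq using assms by (intro computable_intros)
  show "computable (\<lambda>x. nat (- f x))"
    unfolding eq using assms by (intro computable_intros)
qed

lemma computable_int_minus_int [computable_intros]:
  assumes "computable f" "computable g" shows "computable (\<lambda>x. int (f x) - int (g x))"
proof -
  have "computable (\<lambda>x. dec (if g x \<le> f x then 2 * (f x - g x) else Suc (2 * (g x - f x - 1))) :: int)"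
    using assms by (intro computable_intros)
  moreover have "dec (if b \<le> a then 2 * (a - b) else Suc (2 * (b - a - 1))) = int a - int b" for a b
    by (auto simp: dec_int_def int_decode_def sum_decode_def)
  ultimately show ?thesis by simp
qed

lemma computable_int [computable_intros]: "computable f \<Longrightarrow> computable (\<lambda>x. int (f x))"
  using computable_int_minus_int[OF _ computable_const[of 0]] by simp

lemma computable_int_add [computable_intros]:
  assumes "computable f" "computable g" shows "computable (\<lambda>x. f x + g x :: int)"
proof -
  have "computable (\<lambda>x. int (nat (f x) + nat (g x)) - int (nat (- f x) + nat (- g x)))"
    using assms by (intro computable_intros)
  moreover have "int (nat a + nat b) - int (nat (- a) + nat (- b)) = a + b" for a b
    by simp
  ultimately show ?thesis by (simp only:)
qed

lemma computable_int_mult [computable_intros]: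
  assumes "computable f" "computable g" shows "computable (\<lambda>x. f x * g x :: int)"
proof -
  have "computable (\<lambda>x. int (nat (f x) * nat (g x) + nat (- f x) * nat (- g x))
      - int (nat (f x) * nat (- g x) + nat (- f x) * nat (g x)))"
    using assms by (intro computable_intros)
  moreover have "int (nat a * nat b + nat (- a) * nat (- b))
      - int (nat a * nat (- b) + nat (- a) * nat b) = a * b" for a b
    by (cases "a \<ge> 0"; cases "b \<ge> 0") auto
  ultimately show ?thesis by (simp only:)
qed

lemma decidable_int_less [computable_intros]:
  assumes "computable f" "computable g" shows "decidable (\<lambda>x. f x < (g x :: int))"
proof -
  have "decidable (\<lambda>x. nat (f x) + nat (- g x) < nat (g x) + nat (- f x))"
    using assms by (intro computable_intros)
  moreover have "nat a + nat (- b) < nat b + nat (- a) \<longleftrightarrow> a < b" for a b by auto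
  ultimately show ?thesis by simp
qed

lemma decidable_int_le [computable_intros]:
  "computable f \<Longrightarrow> computable g \<Longrightarrow> decidable (\<lambda>x. f x \<le> (g x :: int))"
  using decidable_not[OF decidable_int_less, of g f] by (simp add: not_less)

lemma computable_power [computable_intros]:
  assumes "computable f" "computable g" shows "computable (\<lambda>x. f x ^ g x :: nat)"
proof -
  have "computable (\<lambda>x. rec_nat 1 (\<lambda>i y. f x * y) (g x))"
    using assms by (intro computable_intros computable_comp[OF assms(1)])
  moreover have "rec_nat 1 (\<lambda>i y. b * y) n = b ^ n" for b n :: nat by (induction n) auto
  ultimately show ?thesis by simp
qed

section \<open>Upper bounds for real algebraic numbers\<close>

definition eval_coeffs :: "int list \<Rightarrow> int \<Rightarrow> int" where
  "eval_coeffs qs x = foldr (\<lambda>a v. a + x * v) qs 0"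

lemma of_int_eval_coeffs:
  "real_of_int (eval_coeffs qs x) = poly (Poly (map real_of_int qs)) (real_of_int x)"
  unfolding eval_coeffs_def by (induction qs) auto

lemma computable_eval_coeffs [computable_intros]:
  assumes "computable f" "computable g" shows "computable (\<lambda>x. eval_coeffs (f x) (g x))"
  unfolding eval_coeffs_def foldr_conv_foldl
  using assms by (intro computable_intros computable_comp[OF assms(2)])

lemma decidable_distinct [computable_intros]:
  assumes "computable l" shows "decidable (\<lambda>x. distinct (l x))"
proof -
  have "decidable (\<lambda>x. \<forall>i<length (l x).
      (case drop i (l x) of [] \<Rightarrow> 1 | a # as \<Rightarrow> if \<forall>b\<in>set as. b \<noteq> a then 1 else 0) = (1::nat))"
    using assms by (intro computable_intros computable_comp[OF assms])
  moreover have "(\<forall>i<length l. (case drop i l of [] \<Rightarrow> 1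
      | a # as \<Rightarrow> if \<forall>b\<in>set as. b \<noteq> a then 1 else 0) = (1::nat)) \<longleftrightarrow> distinct l" for l :: "'b list"
  proof (induction l)
    case (Cons a l)
    then show ?case by (auto simp: All_less_Suc2 if_split_eq1)
  qed simp
  ultimately show ?thesis by simp
qed

text \<open>A root of odd multiplicity of \<open>Q\<close> is witnessed by a sign change, and a divisor \<open>Q(b x)\<close> of
  \<open>P(x)\<close> with the same roots as \<open>P\<close>, all of them simple, exists over the rationals.
  Substituting \<open>b x\<close> makes all end points of the isolating intervals integers.\<close>
definition root_certificate ::
  "int list \<Rightarrow> nat \<Rightarrow> nat \<Rightarrow> nat \<Rightarrow> int \<Rightarrow> int list \<Rightarrow> int list \<Rightarrow> (int \<times> int) list \<Rightarrow> bool" where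
  "root_certificate ps K a b c D Q I \<longleftrightarrow> 0 < b \<and> c \<noteq> 0 \<and>
     (\<forall>x<Suc (length ps + length D + length Q).
        c * eval_coeffs ps (int x) = eval_coeffs D (int x) * eval_coeffs Q (int b * int x)) \<and>
     length I = Suc K \<and> distinct I \<and>
     (\<forall>i\<in>set I. fst i < snd i \<and> snd i \<le> int a \<and> eval_coeffs Q (fst i) * eval_coeffs Q (snd i) < 0 \<and>
        (\<forall>j\<in>set I. i = j \<or> snd i \<le> fst j \<or> snd j \<le> fst i))"

text \<open>For the polynomial and the index coded by c, this certifies
  \<open>alg_val c < a / b\<close>. Not every pair a, b with this property has a certificate, since
  b also fixes the grid of end points. But for every positive y above \<open>alg_val c\<close> some
  certified bound is at most y.\<close>

definition root_below :: "int list \<Rightarrow> nat \<Rightarrow> nat \<Rightarrow> nat \<Rightarrow> bool" where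
  "root_below ps K a b \<longleftrightarrow> (\<exists>c D Q I. root_certificate ps K a b c D Q I)"

lemma semidecidable_root_below:
  assumes "computable f" "computable g" "computable h" "computable l"
  shows "semidecidable (\<lambda>x. root_below (f x) (g x) (h x) (l x))"
  unfolding root_below_def root_certificate_def
  by (intro semidecidable_ex semidecidable_decidable computable_intros
      computable_comp[OF assms(1)] computable_comp[OF assms(2)] computable_comp[OF assms(3)]
      computable_comp[OF assms(4)])

text \<open>Otherwise all of B would lie among the first K entries of the sorted list.\<close>

lemma sorted_list_of_set_nth_less:
  assumes "finite A" "B \<subseteq> A" "K < card B" "\<And>x. x \<in> B \<Longrightarrow> x < (y::real)"
  shows "sorted_list_of_set A ! K < y"
proof (rule ccontr)
  let ?l = "sorted_list_of_set A"
  assume "\<not> ?l ! K < y"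
  have "B \<subseteq> set (take K ?l)"
  proof
    fix x assume "x \<in> B"
    then have "x \<in> set ?l" using assms by auto
    then obtain i where i: "i < length ?l" "?l ! i = x" by (auto simp: in_set_conv_nth)
    have "i < K"
    proof (rule ccontr)
      assume "\<not> i < K"
      then have "?l ! K \<le> ?l ! i" using i by (intro sorted_nth_mono) auto
      with \<open>\<not> ?l ! K < y\<close> assms(4)[OF \<open>x \<in> B\<close>] i show False by simp
    qed
    with i show "x \<in> set (take K ?l)" by (auto simp: in_set_conv_nth)
  qed
  then have "card B \<le> card (set (take K ?l))" by (intro card_mono) auto
  also have "\<dots> \<le> K" by (rule order.trans[OF card_length]) simp
  finally show False using assms(3) by simp
qed

definition alg_coeffs :: "nat \<Rightarrow> int list" where
  "alg_coeffs c = fst (dec c :: int list \<times> nat)"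

definition alg_index :: "nat \<Rightarrow> nat" where
  "alg_index c = snd (dec c :: int list \<times> nat)"

lemma alg_poly_eq: "alg_poly c = Poly (map real_of_int (alg_coeffs c))"
  unfolding alg_poly_def alg_coeffs_def dec_prod_def dec_list_def dec_int_def by (simp add: o_def)

lemma alg_index_eq: "snd (prod_decode c) = alg_index c"
  unfolding alg_index_def dec_prod_def by simp

lemma poly_sign_change:
  fixes p :: "real poly"
  assumes "a < b" "poly p a * poly p b < 0"
  shows "\<exists>x. a < x \<and> x < b \<and> poly p x = 0"
  using assms poly_IVT_pos[of a b p] poly_IVT_neg[of a b p] by (auto simp: mult_less_0_iff)

text \<open>Sign changes on K + 1 nonoverlapping intervals give as many distinct roots of Q. Divided
  by b they are roots of P below a / b, so the root with index K, counted from 0, is below a / b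
  too.\<close>

lemma root_below_sound:
  assumes "alg_valid c" "root_below (alg_coeffs c) (alg_index c) a b"
  shows "alg_val c < real a / real b"
proof -
  let ?ps = "alg_coeffs c"
  define P where "P = alg_poly c"
  have P0: "P \<noteq> 0" using assms(1) by (simp add: alg_valid_def P_def)
  from assms(2) obtain d D Q I where cert: "root_certificate ?ps (alg_index c) a b d D Q I"
    unfolding root_below_def by blast
  define PQ where "PQ = Poly (map real_of_int Q)"
  define PD where "PD = Poly (map real_of_int D)"
  define A where "A = smult (of_int d) P - PD * pcompose PQ [:0, real b:]"
  let ?n = "length ?ps + length D + length Q"
  have b: "b > 0" and d: "d \<noteq> 0" using cert by (auto simp: root_certificate_def)
  \<comment> \<open>The certificate compares values at 0, ..., n only. As n bounds the degree of A,
    these n + 1 zeros are one too many for a nonzero A.\<close>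
  have "A = 0"
  proof (rule ccontr)
    assume "A \<noteq> 0"
    have degPQ: "degree (pcompose PQ [:0, real b:]) \<le> length Q"
      using degree_pcompose_le[of PQ "[:0, real b:]"] degree_Poly[of "map real_of_int Q"] b
      by (simp add: PQ_def)
    have "degree A \<le> ?n"
      unfolding A_def
    proof (rule degree_diff_le)
      show "degree (smult (of_int d) P) \<le> ?n"
        using degree_Poly[of "map real_of_int ?ps"] degree_smult_le[of "of_int d" P]
        by (simp add: P_def alg_poly_eq)
      show "degree (PD * pcompose PQ [:0, real b:]) \<le> ?n"
        using degree_mult_le[of PD "pcompose PQ [:0, real b:]"] degPQ
          degree_Poly[of "map real_of_int D"] by (simp add: PD_def)
    qed
    moreover have "real ` {..<Suc ?n} \<subseteq> {x. poly A x = 0}"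
    proof (rule image_subsetI)
      fix x assume "x \<in> {..<Suc ?n}"
      then have "d * eval_coeffs ?ps (int x) = eval_coeffs D (int x) * eval_coeffs Q (int b * int x)"
        using cert by (auto simp: root_certificate_def)
      then have "real_of_int (d * eval_coeffs ?ps (int x))
          = real_of_int (eval_coeffs D (int x) * eval_coeffs Q (int b * int x))" by (simp only:)
      then show "real x \<in> {x. poly A x = 0}"
        unfolding of_int_mult of_int_eval_coeffs
        by (simp add: A_def P_def PD_def PQ_def alg_poly_eq poly_pcompose mult.commute)
    qed
    then have "card (real ` {..<Suc ?n}) \<le> card {x. poly A x = 0}"
      using poly_roots_finite[OF \<open>A \<noteq> 0\<close>] by (intro card_mono)
    ultimately show False
      using card_poly_roots_bound[OF \<open>A \<noteq> 0\<close>] by (simp add: card_image)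
  qed
  then have eq: "of_int d * poly P x = poly PD x * poly PQ (real b * x)" for x
    by (auto simp: A_def poly_pcompose mult.commute dest: arg_cong[of _ _ "\<lambda>p. poly p x"])
  have "\<forall>i\<in>set I. \<exists>x. real_of_int (fst i) < x \<and> x < real_of_int (snd i) \<and> poly PQ x = 0"
  proof
    fix i assume "i \<in> set I"
    then have "fst i < snd i" and "eval_coeffs Q (fst i) * eval_coeffs Q (snd i) < 0"
      using cert by (auto simp: root_certificate_def)
    then have "real_of_int (eval_coeffs Q (fst i) * eval_coeffs Q (snd i)) < 0" by linarith
    then show "\<exists>x. real_of_int (fst i) < x \<and> x < real_of_int (snd i) \<and> poly PQ x = 0"
      using \<open>fst i < snd i\<close> unfolding of_int_mult of_int_eval_coeffs PQ_def
      by (intro poly_sign_change) auto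
  qed
  then obtain r where r: "\<And>i. i \<in> set I \<Longrightarrow> real_of_int (fst i) < r i \<and> r i < real_of_int (snd i)
      \<and> poly PQ (r i) = 0" by metis
  have disj: "i = j \<or> snd i \<le> fst j \<or> snd j \<le> fst i" if "i \<in> set I" "j \<in> set I" for i j
    using cert that by (auto simp: root_certificate_def)
  have inj: "inj_on (\<lambda>i. r i / real b) (set I)"
  proof (rule inj_onI)
    fix i j assume ij: "i \<in> set I" "j \<in> set I" "r i / real b = r j / real b"
    then have "r i = r j" using b by simp
    then show "i = j" using disj[OF ij(1,2)] r[OF ij(1)] r[OF ij(2)] by linarith
  qed
  show ?thesis
    unfolding alg_val_def alg_index_eq P_def[symmetric]
  proof (rule sorted_list_of_set_nth_less)
    show "finite {x. poly P x = 0}" using P0 by (rule poly_roots_finite)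
    show "(\<lambda>i. r i / real b) ` set I \<subseteq> {x. poly P x = 0}"
    proof (rule image_subsetI)
      fix i assume "i \<in> set I"
      then have "poly PQ (r i) = 0" using r by blast
      then show "r i / real b \<in> {x. poly P x = 0}" using eq[of "r i / real b"] b d by simp
    qed
    show "alg_index c < card ((\<lambda>i. r i / real b) ` set I)"
      using cert unfolding card_image[OF inj] root_certificate_def by (simp add: distinct_card)
    show "x < real a / real b" if "x \<in> (\<lambda>i. r i / real b) ` set I" for x
    proof -
      from that obtain i where i: "i \<in> set I" "x = r i / real b" by blast
      have "snd i \<le> int a" using cert i by (auto simp: root_certificate_def)
      then have "r i < real a" using r[OF i(1)] by linarith
      then show ?thesis using i b by (simp add: divide_strict_right_mono)
    qed
  qed
qed

section \<open>Squarefree parts over the rationals and sign changes at simple roots\<close>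

lemma map_poly_of_rat_mult:
  "map_poly real_of_rat (p * q) = map_poly real_of_rat p * map_poly real_of_rat q"
  by (rule poly_eqI) (simp add: coeff_map_poly coeff_mult of_rat_sum of_rat_mult)

lemma map_poly_of_rat_add:
  "map_poly real_of_rat (p + q) = map_poly real_of_rat p + map_poly real_of_rat q"
  by (rule poly_eqI) (simp add: coeff_map_poly of_rat_add)

lemma map_poly_of_rat_pderiv:
  "map_poly real_of_rat (pderiv p) = pderiv (map_poly real_of_rat p)"
  by (rule poly_eqI) (simp add: coeff_map_poly coeff_pderiv of_rat_mult of_rat_add)

lemma clear_denominators:
  "\<exists>N qs. N \<noteq> 0 \<and> smult (of_int N) (map_poly real_of_rat q) = Poly (map real_of_int qs)"
proof (induction q)
  case 0
  show ?case by (rule exI[of _ 1], rule exI[of _ "[]"]) simp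
next
  case (pCons a q)
  then obtain N qs where N: "N \<noteq> 0" "smult (of_int N) (map_poly real_of_rat q) = Poly (map real_of_int qs)"
    by blast
  obtain u v where uv: "a = of_int u / of_int v" "v > 0"
    by (metis quotient_of_div quotient_of_denom_pos surj_pair)
  have "smult (of_int (v * N)) (map_poly real_of_rat (pCons a q))
      = pCons (of_int (u * N)) (smult (of_int v) (Poly (map real_of_int qs)))"
    using uv by (simp add: map_poly_pCons N(2)[symmetric] of_rat_divide)
  also have "smult (of_int v) (Poly (map real_of_int qs)) = Poly (map real_of_int (map ((*) v) qs))"
    by (simp add: Poly_map[symmetric] o_def)
  finally have "smult (of_int (v * N)) (map_poly real_of_rat (pCons a q))
      = Poly (map real_of_int (u * N # map ((*) v) qs))" by simp
  moreover have "v * N \<noteq> 0" using uv N by simp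
  ultimately show ?case by blast
qed

text \<open>Q is p / gcd(p, p') up to a factor. The gcd is taken over the rationals, so that
  clearing denominators leaves integer coefficients. The Bezout identity carries over to the reals,
  where \<open>poly_squarefree_decomp_order\<close> derives from it that all roots of the quotient
  are simple.\<close>

lemma rational_squarefree_part:
  fixes ps :: "int list"
  defines "P \<equiv> Poly (map real_of_int ps)"
  assumes "poly P r\<^sub>0 = 0" "P \<noteq> 0"
  obtains Q D :: "int list" and c :: int where "c \<noteq> 0"
    "smult (of_int c) P = Poly (map real_of_int D) * Poly (map real_of_int Q)"
    "\<And>r. poly P r = 0 \<Longrightarrow> order r (Poly (map real_of_int Q)) = 1"
proof -
  define p :: "rat poly" where "p = Poly (map of_int ps)"
  have Pp: "P = map_poly real_of_rat p"
    by (rule poly_eqI) (simp add: P_def p_def coeff_map_poly nth_default_map_eq[of real_of_rat 0 0, symmetric]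
        o_def)
  \<comment> \<open>A constant polynomial with a root is zero.\<close>
  have "pderiv P \<noteq> 0"
  proof
    assume "pderiv P = 0"
    then obtain h where "P = [:h:]" using pderiv_iszero by blast
    moreover have "poly P r\<^sub>0 = 0" "P \<noteq> 0" using assms by simp_all
    ultimately show False by auto
  qed
  define d where "d = gcd p (pderiv p)"
  obtain q e where q: "p = q * d" "pderiv p = e * d"
    unfolding d_def by (metis dvd_def gcd_dvd1 gcd_dvd2 mult.commute)
  obtain x y where d: "d = x * p + y * pderiv p"
    using bezout_coefficients_fst_snd[of p "pderiv p"] d_def by metis
  let ?m = "map_poly real_of_rat"
  have ord: "order r (?m q) = (if order r P = 0 then 0 else 1)" for r
  proof (rule poly_squarefree_decomp_order[OF \<open>pderiv P \<noteq> 0\<close>])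
    show "P = ?m q * ?m d" using q(1) Pp map_poly_of_rat_mult by metis
    show "pderiv P = ?m e * ?m d" using q(2) Pp map_poly_of_rat_mult map_poly_of_rat_pderiv by metis
    show "?m d = ?m x * P + ?m y * pderiv P"
      using d Pp map_poly_of_rat_mult map_poly_of_rat_add map_poly_of_rat_pderiv by metis
  qed
  obtain N Q where N: "N \<noteq> 0" "smult (of_int N) (?m q) = Poly (map real_of_int Q)"
    using clear_denominators by blast
  obtain M D where M: "M \<noteq> 0" "smult (of_int M) (?m d) = Poly (map real_of_int D)"
    using clear_denominators by blast
  show ?thesis
  proof
    show "M * N \<noteq> 0" using M N by simp
    have "P = ?m q * ?m d" using q(1) Pp map_poly_of_rat_mult by metis
    then show "smult (of_int (M * N)) P = Poly (map real_of_int D) * Poly (map real_of_int Q)"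
      by (simp add: M(2)[symmetric] N(2)[symmetric] mult.commute)
    fix r assume "poly P r = 0"
    then have "order r P \<noteq> 0" using \<open>P \<noteq> 0\<close> by (simp add: order_root)
    then show "order r (Poly (map real_of_int Q)) = 1"
      using ord[of r] N by (simp add: N(2)[symmetric] order_smult)
  qed
qed

text \<open>Dividing by x - r leaves a polynomial that does not vanish at r and so keeps its sign
  nearby, while x - r changes its sign.\<close>

lemma sign_change_at_simple_root:
  fixes p :: "real poly"
  assumes "order r p = 1" "p \<noteq> 0"
  obtains \<epsilon> where "\<epsilon> > 0" "\<And>l u. r - \<epsilon> < l \<Longrightarrow> l < r \<Longrightarrow> r < u \<Longrightarrow> u < r + \<epsilon> \<Longrightarrow> poly p l * poly p u < 0"
proof -
  obtain s where s: "p = [:- r, 1:] * s" "\<not> [:- r, 1:] dvd s"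
    using order_decomp[OF assms(2), of r] assms by auto
  then have "poly s r \<noteq> 0" by (simp add: poly_eq_0_iff_dvd)
  then have "poly s r * poly s r > 0" by (metis not_real_square_gt_zero)
  moreover have "((\<lambda>x. poly s x * poly s r) \<longlongrightarrow> poly s r * poly s r) (at r)"
    using poly_isCont[of r s] unfolding isCont_def by (intro tendsto_intros)
  ultimately have "\<forall>\<^sub>F x in at r. poly s x * poly s r > 0"
    by (rule order_tendstoD(1)[rotated])
  then obtain \<epsilon> where \<epsilon>: "\<epsilon> > 0" "\<And>x. x \<noteq> r \<Longrightarrow> \<bar>x - r\<bar> < \<epsilon> \<Longrightarrow> poly s x * poly s r > 0"
    unfolding eventually_at by (auto simp: dist_real_def)
  show ?thesis
  proof
    fix l u assume lu: "r - \<epsilon> < l" "l < r" "r < u" "u < r + \<epsilon>"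
    then have "poly s l * poly s r > 0" "poly s u * poly s r > 0" using \<epsilon>(2) by auto
    then have "(poly s l * poly s u) * (poly s r * poly s r) > 0"
      by (metis mult.assoc mult.left_commute mult_pos_pos)
    then have "poly s l * poly s u > 0"
      using \<open>poly s r * poly s r > 0\<close> zero_less_mult_pos2 by blast
    moreover have "(l - r) * (u - r) < 0" using lu by (simp add: mult_neg_pos)
    ultimately have "((l - r) * (u - r)) * (poly s l * poly s u) < 0" by (rule mult_neg_pos[rotated])
    then show "poly p l * poly p u < 0" by (simp add: s(1) algebra_simps)
  qed (rule \<epsilon>(1))
qed


text \<open>The coefficient of degree i is multiplied by b^(\<open>length qs\<close> - i), so the
  coefficients stay integers.\<close>

lemma eval_rescaled_coeffs:
  "\<exists>qs'. length qs' = length qs \<and> (\<forall>x. poly (Poly (map real_of_int qs')) (real b * x)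
      = real b ^ length qs * poly (Poly (map real_of_int qs)) x)"
proof (induction qs)
  case (Cons a qs)
  then obtain qs' where qs': "length qs' = length qs"
    "\<And>x. poly (Poly (map real_of_int qs')) (real b * x) = real b ^ length qs * poly (Poly (map real_of_int qs)) x"
    by blast
  have "poly (Poly (map real_of_int (int b ^ Suc (length qs) * a # qs'))) (real b * x)
      = real b ^ Suc (length qs) * poly (Poly (map real_of_int (a # qs))) x" for x
  proof -
    have "poly (Poly (map real_of_int (int b ^ Suc (length qs) * a # qs'))) (real b * x)
        = real b ^ Suc (length qs) * a + real b * x * poly (Poly (map real_of_int qs')) (real b * x)"
      by simp
    then show ?thesis unfolding qs'(2) by (simp add: distrib_left mult_ac)
  qed
  then show ?case using qs'(1) by (intro exI[of _ "int b ^ Suc (length qs) * a # qs'"]) simp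
qed auto

text \<open>Scaling by a large b separates the roots up to index K so far from each other and from y
  that the neighbouring integers of each b r form an isolating interval below b y.\<close>

lemma root_below_complete:
  assumes valid: "alg_valid c" and y: "alg_val c < y" "0 < y"
  shows "\<exists>a b. 0 < b \<and> real a / real b \<le> y \<and> root_below (alg_coeffs c) (alg_index c) a b"
proof -
  let ?ps = "alg_coeffs c" and ?K = "alg_index c"
  define P where "P = alg_poly c"
  define A where "A = {x. poly P x = 0}"
  define l where "l = sorted_list_of_set A"
  have P0: "P \<noteq> 0" and K: "?K < card A"
    using valid by (auto simp: alg_valid_def P_def alg_index_eq A_def)
  have fin: "finite A" unfolding A_def using P0 by (rule poly_roots_finite)
  have len: "length l = card A" by (simp add: l_def)
  define rs where "rs = take (Suc ?K) l"
  have rs: "length rs = Suc ?K" "distinct rs" using len K by (auto simp: rs_def l_def)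
  have rsA: "set rs \<subseteq> A" unfolding rs_def l_def using fin set_take_subset by fastforce
  have rsy: "r < y" if "r \<in> set rs" for r
  proof -
    from that obtain i where i: "i \<le> ?K" "r = l ! i" by (auto simp: rs_def in_set_conv_nth less_Suc_eq_le)
    then have "r \<le> l ! ?K" using K len by (auto simp: l_def intro!: sorted_nth_mono)
    also have "\<dots> = alg_val c" by (simp add: alg_val_def l_def A_def P_def alg_index_eq)
    finally show ?thesis using y by simp
  qed
  have "A \<noteq> {}" using K by auto
  then obtain r\<^sub>0 where "poly P r\<^sub>0 = 0" by (auto simp: A_def)
  then obtain Q D :: "int list" and e :: int where e: "e \<noteq> 0"
    and fac: "smult (of_int e) P = Poly (map real_of_int D) * Poly (map real_of_int Q)"
    and ord: "\<And>r. poly P r = 0 \<Longrightarrow> order r (Poly (map real_of_int Q)) = 1"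
    using rational_squarefree_part[of ?ps r\<^sub>0] P0 unfolding P_def alg_poly_eq by metis
  define PQ where "PQ = Poly (map real_of_int Q)"
  have "\<exists>\<epsilon>>0. \<forall>l u. r - \<epsilon> < l \<longrightarrow> l < r \<longrightarrow> r < u \<longrightarrow> u < r + \<epsilon> \<longrightarrow> poly PQ l * poly PQ u < 0"
    if "r \<in> set rs" for r
  proof -
    have "order r PQ = 1" using ord that rsA by (auto simp: PQ_def A_def)
    moreover have "PQ \<noteq> 0" using fac e P0 by (auto simp: PQ_def)
    ultimately show ?thesis using sign_change_at_simple_root by blast
  qed
  then obtain \<epsilon> where \<epsilon>: "\<And>r. r \<in> set rs \<Longrightarrow> \<epsilon> r > 0"
    "\<And>r l u. r \<in> set rs \<Longrightarrow> r - \<epsilon> r < l \<Longrightarrow> l < r \<Longrightarrow> r < u \<Longrightarrow> u < r + \<epsilon> r \<Longrightarrow> poly PQ l * poly PQ u < 0"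
    by metis
  have ev: "\<forall>\<^sub>F b in sequentially. 1 / real b < \<delta>" if "\<delta> > 0" for \<delta>
    using order_tendstoD(2)[OF lim_1_over_n that] .
  have "\<forall>\<^sub>F b in sequentially. \<forall>r\<in>set rs. 1 / real b < \<epsilon> r \<and> 1 / real b < y - r \<and>
      (\<forall>s\<in>set rs. r < s \<longrightarrow> 1 / real b < (s - r) / 2)"
  proof (intro eventually_ball_finite ballI eventually_conj ev)
    fix r s assume "r \<in> set rs" "s \<in> set rs"
    show "\<forall>\<^sub>F b in sequentially. r < s \<longrightarrow> 1 / real b < (s - r) / 2"
      using ev[of "(s - r) / 2"] by (cases "r < s") auto
  qed (use \<epsilon> rsy in auto)
  then have "\<forall>\<^sub>F b in sequentially. b > 0 \<and> (\<forall>r\<in>set rs. 1 / real b < \<epsilon> r \<and> 1 / real b < y - r \<and>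
      (\<forall>s\<in>set rs. r < s \<longrightarrow> 1 / real b < (s - r) / 2))"
    using eventually_gt_at_top[of 0] by eventually_elim simp
  then obtain b where b: "b > 0" and small: "\<And>r. r \<in> set rs \<Longrightarrow> 1 / real b < \<epsilon> r"
    "\<And>r. r \<in> set rs \<Longrightarrow> 1 / real b < y - r"
    "\<And>r s. r \<in> set rs \<Longrightarrow> s \<in> set rs \<Longrightarrow> r < s \<Longrightarrow> 1 / real b < (s - r) / 2"
    unfolding eventually_sequentially by blast
  have scale: "1 < real b * d" if "1 / real b < d" for d
    using b that by (simp add: pos_divide_less_eq mult.commute)
  \<comment> \<open>As y is positive, \<open>nat\<close> does not change the floor, and a / b is at
    most y.\<close>
  define a where "a = nat \<lfloor>real b * y\<rfloor>"
  \<comment> \<open>\<open>lo r\<close> and \<open>hi r\<close> are the nearest integers strictly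
    below and strictly above b r; plain rounding would hit the root itself when b r is an
    integer.\<close>
  define lo where "lo r = \<lceil>real b * r\<rceil> - 1" for r
  define hi where "hi r = \<lfloor>real b * r\<rfloor> + 1" for r
  have lohi: "real_of_int (lo r) < real b * r" "real b * r - 1 \<le> real_of_int (lo r)"
    "real b * r < real_of_int (hi r)" "real_of_int (hi r) \<le> real b * r + 1" for r
    unfolding lo_def hi_def by linarith+
  obtain Q' where Q': "length Q' = length Q" "\<And>x. poly (Poly (map real_of_int Q')) (real b * x)
      = real b ^ length Q * poly PQ x"
    using eval_rescaled_coeffs[of Q b] unfolding PQ_def by blast
  have evQ': "real_of_int (eval_coeffs Q' m) = real b ^ length Q * poly PQ (real_of_int m / real b)" for m
    using Q'(2)[of "real_of_int m / real b"] b by (simp add: of_int_eval_coeffs)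
  have "root_certificate ?ps ?K a b (e * int b ^ length Q) D Q' (map (\<lambda>r. (lo r, hi r)) rs)"
    unfolding root_certificate_def
  proof (intro conjI ballI allI impI)
    show "0 < b" by (rule b)
    show "e * int b ^ length Q \<noteq> 0" using e b by simp
    show "length (map (\<lambda>r. (lo r, hi r)) rs) = Suc ?K" using rs by simp
  next
    fix x assume "x < Suc (length ?ps + length D + length Q')"
    have "real_of_int e * poly P (real x) = poly (Poly (map real_of_int D)) (real x) * poly PQ (real x)"
      using arg_cong[OF fac, of "\<lambda>p. poly p (real x)"] by (simp add: PQ_def)
    then have "real_of_int (e * int b ^ length Q * eval_coeffs ?ps (int x))
        = real_of_int (eval_coeffs D (int x) * eval_coeffs Q' (int b * int x))"
      using b by (simp add: evQ') (simp add: of_int_eval_coeffs P_def alg_poly_eq)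
    then show "e * int b ^ length Q * eval_coeffs ?ps (int x)
        = eval_coeffs D (int x) * eval_coeffs Q' (int b * int x)"
      by (simp only: of_int_eq_iff)
  next
    \<comment> \<open>End points are within 1 of the scaled roots, and these are more than 2 apart:
      this is the purpose of the bound (s - r) / 2 in the choice of b.\<close>
    have sep: "hi r \<le> lo s" if "r \<in> set rs" "s \<in> set rs" "r < s" for r s
    proof -
      have "1 < real b * ((s - r) / 2)" using scale[OF small(3)[OF that]] .
      then have "real b * r + 2 < real b * s" by (simp add: right_diff_distrib)
      then show ?thesis using lohi(4)[of r] lohi(2)[of s] by linarith
    qed
    have lh: "lo r < hi r" for r using lohi(1,3)[of r] by linarith
    show "distinct (map (\<lambda>r. (lo r, hi r)) rs)"
    proof -
      have "inj_on (\<lambda>r. (lo r, hi r)) (set rs)"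
      proof (rule inj_onI)
        fix r s assume *: "r \<in> set rs" "s \<in> set rs" "(lo r, hi r) = (lo s, hi s)"
        show "r = s"
        proof (rule ccontr)
          assume "r \<noteq> s"
          then consider "r < s" | "s < r" by linarith
          then show False using * sep[of r s] sep[of s r] lh[of r] lh[of s] by cases auto
        qed
      qed
      then show ?thesis using rs by (simp add: distinct_map)
    qed
    fix i assume "i \<in> set (map (\<lambda>r. (lo r, hi r)) rs)"
    then obtain r where r: "r \<in> set rs" "i = (lo r, hi r)" by auto
    show "fst i < snd i" using r lh by simp
    have "real b * r + 1 \<le> real b * y"
      using scale[OF small(2)[OF r(1)]] by (simp add: right_diff_distrib)
    then have "real_of_int (hi r) \<le> real b * y" using lohi(4)[of r] by linarith
    then have "hi r \<le> \<lfloor>real b * y\<rfloor>" by (simp add: le_floor_iff)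
    moreover have "0 \<le> \<lfloor>real b * y\<rfloor>" using y b by simp
    ultimately show "snd i \<le> int a" using r by (simp add: a_def)
    have "poly PQ (real_of_int (lo r) / real b) * poly PQ (real_of_int (hi r) / real b) < 0"
    proof (rule \<epsilon>(2)[OF r(1)])
      have *: "1 < real b * \<epsilon> r" by (rule scale[OF small(1)[OF r(1)]])
      then have "real b * (r - \<epsilon> r) < real_of_int (lo r)"
        using lohi(2)[of r] unfolding right_diff_distrib by linarith
      then show "r - \<epsilon> r < real_of_int (lo r) / real b"
        using b by (simp add: pos_less_divide_eq mult.commute)
      show "real_of_int (lo r) / real b < r"
        using lohi(1)[of r] b by (simp add: pos_divide_less_eq mult.commute)
      show "r < real_of_int (hi r) / real b"
        using lohi(3)[of r] b by (simp add: pos_less_divide_eq mult.commute)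
      have "real_of_int (hi r) < real b * (r + \<epsilon> r)"
        using * lohi(4)[of r] unfolding distrib_left by linarith
      then show "real_of_int (hi r) / real b < r + \<epsilon> r"
        using b by (simp add: pos_divide_less_eq mult.commute)
    qed
    then have "(real b ^ length Q * real b ^ length Q) *
        (poly PQ (real_of_int (lo r) / real b) * poly PQ (real_of_int (hi r) / real b)) < 0"
      using b by (simp add: mult_pos_neg)
    then have "real_of_int (eval_coeffs Q' (fst i) * eval_coeffs Q' (snd i)) < 0"
      unfolding of_int_mult evQ' r(2) by (simp add: mult_ac)
    then show "eval_coeffs Q' (fst i) * eval_coeffs Q' (snd i) < 0" by linarith
    fix j assume "j \<in> set (map (\<lambda>r. (lo r, hi r)) rs)"
    then obtain s where s: "s \<in> set rs" "j = (lo s, hi s)" by auto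
    consider "r = s" | "r < s" | "s < r" by linarith
    then show "i = j \<or> snd i \<le> fst j \<or> snd j \<le> fst i"
      using r s sep[of r s] sep[of s r] by cases auto
  qed
  moreover have "real a / real b \<le> y"
  proof -
    have "real a \<le> real b * y" using y b by (simp add: a_def)
    then show ?thesis using b by (simp add: pos_divide_le_eq mult.commute)
  qed
  ultimately show ?thesis using b unfolding root_below_def by blast
qed

section \<open>Finitely supported functions\<close>

text \<open>Square summable functions on X are represented by this dense subspace only. Translations
  and averages preserve it, and almost optimal vectors can be found in it.\<close>

definition fsupp :: "'a set \<Rightarrow> ('a \<Rightarrow> real) set" where
  "fsupp X = {f. finite {x. f x \<noteq> 0} \<and> {x. f x \<noteq> 0} \<subseteq> X}"

text \<open>This is an inner product only for finitely supported functions: the sum is \<open>0\<close> if \<open>f\<close> has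
  infinite support.\<close>
definition ip :: "('a \<Rightarrow> real) \<Rightarrow> ('a \<Rightarrow> real) \<Rightarrow> real" where
  "ip f g = (\<Sum>x | f x \<noteq> 0. f x * g x)"

lemma fsupp_finite: "f \<in> fsupp X \<Longrightarrow> finite {x. f x \<noteq> 0}"
  and fsupp_outside: "f \<in> fsupp X \<Longrightarrow> x \<notin> X \<Longrightarrow> f x = 0"
  by (auto simp: fsupp_def)

lemma fsuppI:
  "finite A \<Longrightarrow> A \<subseteq> X \<Longrightarrow> (\<And>x. f x \<noteq> 0 \<Longrightarrow> x \<in> A) \<Longrightarrow> f \<in> fsupp X"
  unfolding fsupp_def by (auto intro: finite_subset)

lemma fsupp_add: "f \<in> fsupp X \<Longrightarrow> g \<in> fsupp X \<Longrightarrow> (\<lambda>x. f x + g x) \<in> fsupp X"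
  by (rule fsuppI[of "{x. f x \<noteq> 0} \<union> {x. g x \<noteq> 0}"]) (auto simp: fsupp_def)

lemma fsupp_scale: "f \<in> fsupp X \<Longrightarrow> (\<lambda>x. c * f x) \<in> fsupp X"
  by (rule fsuppI[of "{x. f x \<noteq> 0}"]) (auto simp: fsupp_def)

lemma fsupp_abs: "f \<in> fsupp X \<Longrightarrow> (\<lambda>x. \<bar>f x\<bar>) \<in> fsupp X"
  by (rule fsuppI[of "{x. f x \<noteq> 0}"]) (auto simp: fsupp_def)

lemma fsupp_sum:
  "finite I \<Longrightarrow> (\<And>i. i \<in> I \<Longrightarrow> F i \<in> fsupp X) \<Longrightarrow> (\<lambda>x. \<Sum>i\<in>I. F i x) \<in> fsupp X"
proof (induction I rule: finite_induct)
  case empty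
  show ?case by (auto simp: fsupp_def)
qed (auto intro!: fsupp_add)

lemma ip_eq:
  assumes "f \<in> fsupp X" "finite A" "\<And>x. f x \<noteq> 0 \<Longrightarrow> g x \<noteq> 0 \<Longrightarrow> x \<in> A"
  shows "ip f g = (\<Sum>x\<in>A. f x * g x)"
proof -
  have "ip f g = (\<Sum>x\<in>{x. f x \<noteq> 0} \<union> A. f x * g x)"
    unfolding ip_def using assms fsupp_finite[OF assms(1)] by (intro sum.mono_neutral_left) auto
  also have "\<dots> = (\<Sum>x\<in>A. f x * g x)"
    using assms fsupp_finite[OF assms(1)] by (intro sum.mono_neutral_right) auto
  finally show ?thesis .
qed

lemma ip_commute: "f \<in> fsupp X \<Longrightarrow> g \<in> fsupp X \<Longrightarrow> ip f g = ip g f"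
  using ip_eq[of f X "{x. g x \<noteq> 0}" g] fsupp_finite[of g X] by (simp add: ip_def mult.commute)

lemma ip_add_left:
  assumes "f \<in> fsupp X" "g \<in> fsupp X"
  shows "ip (\<lambda>x. f x + g x) h = ip f h + ip g h"
proof -
  let ?A = "{x. f x \<noteq> 0} \<union> {x. g x \<noteq> 0}"
  have "finite ?A" using assms fsupp_finite by blast
  then show ?thesis
    using ip_eq[OF fsupp_add[OF assms], of ?A h] ip_eq[OF assms(1), of ?A h] ip_eq[OF assms(2), of ?A h]
    by (auto simp: sum.distrib distrib_right)
qed

lemma ip_scale_left: "f \<in> fsupp X \<Longrightarrow> ip (\<lambda>x. c * f x) h = c * ip f h"
  using ip_eq[OF fsupp_scale[of f X c], of "{x. f x \<noteq> 0}" h] fsupp_finite[of f X]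
  by (auto simp: ip_def sum_distrib_left mult.assoc)

lemma ip_zero_left: "ip (\<lambda>x. 0) h = 0"
  by (simp add: ip_def)

lemma ip_sum_left:
  "finite I \<Longrightarrow> (\<And>i. i \<in> I \<Longrightarrow> F i \<in> fsupp X) \<Longrightarrow> ip (\<lambda>x. \<Sum>i\<in>I. F i x) h = (\<Sum>i\<in>I. ip (F i) h)"
proof (induction I rule: finite_induct)
  case (insert i I)
  then show ?case using ip_add_left[of "F i" X "\<lambda>x. \<Sum>i\<in>I. F i x" h] fsupp_sum[of I F X] by simp
qed (simp add: ip_zero_left)

lemma ip_add_right: "ip h (\<lambda>x. f x + g x) = ip h f + ip h g"
  by (simp add: ip_def sum.distrib distrib_left)

lemma ip_scale_right: "ip h (\<lambda>x. c * f x) = c * ip h f"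
  by (simp add: ip_def sum_distrib_left mult_ac)

lemma ip_self_nonneg: "0 \<le> ip f f"
  unfolding ip_def by (intro sum_nonneg) auto

lemma ip_cauchy_schwarz:
  assumes "f \<in> fsupp X" "g \<in> fsupp X"
  shows "(ip f g)\<^sup>2 \<le> ip f f * ip g g"
proof -
  let ?A = "{x. f x \<noteq> 0} \<union> {x. g x \<noteq> 0}"
  have A: "finite ?A" using assms fsupp_finite by blast
  have "ip f g = (\<Sum>x\<in>?A. f x * g x)" "ip f f = (\<Sum>x\<in>?A. (f x)\<^sup>2)" "ip g g = (\<Sum>x\<in>?A. (g x)\<^sup>2)"
    using ip_eq[OF assms(1) A, of g] ip_eq[OF assms(1) A, of f] ip_eq[OF assms(2) A, of g]
    by (auto simp: power2_eq_square)
  then show ?thesis using Cauchy_Schwarz_ineq_sum[of f g ?A] by simp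
qed

lemma ip_cauchy_schwarz_sqrt:
  assumes "f \<in> fsupp X" "g \<in> fsupp X"
  shows "\<bar>ip f g\<bar> \<le> sqrt (ip f f) * sqrt (ip g g)"
  using real_sqrt_le_mono[OF ip_cauchy_schwarz[OF assms]] by (simp add: real_sqrt_mult)

lemma ip_self_pos: "f \<in> fsupp X \<Longrightarrow> ip g f \<noteq> 0 \<Longrightarrow> 0 < ip f f"
proof -
  assume f: "f \<in> fsupp X" and "ip g f \<noteq> 0"
  then obtain x where "f x \<noteq> 0" unfolding ip_def by (metis (mono_tags, lifting) mult_zero_right sum.neutral)
  then show ?thesis
    unfolding ip_def using fsupp_finite[OF f] by (intro sum_pos2[of _ x]) (auto simp: zero_less_mult_iff linorder_neq_iff)
qed

lemma ip_mono_abs: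
  assumes "f \<in> fsupp X" "f' \<in> fsupp X" "\<And>x. \<bar>f x\<bar> \<le> f' x" "\<And>x. \<bar>g x\<bar> \<le> g' x"
  shows "\<bar>ip f g\<bar> \<le> ip f' g'"
proof -
  have sub: "{x. f x \<noteq> 0} \<subseteq> {x. f' x \<noteq> 0}" using assms(3) by (smt (verit) Collect_mono)
  have nn: "f' x \<ge> 0" "g' x \<ge> 0" for x using assms(3)[of x] assms(4)[of x] by linarith+
  have "\<bar>ip f g\<bar> \<le> (\<Sum>x | f x \<noteq> 0. \<bar>f x * g x\<bar>)" unfolding ip_def by (rule sum_abs)
  also have "\<dots> \<le> (\<Sum>x | f x \<noteq> 0. f' x * g' x)"
    using assms nn by (intro sum_mono) (auto simp: abs_mult intro!: mult_mono)
  also have "\<dots> \<le> ip f' g'"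
    unfolding ip_def using sub nn fsupp_finite[OF assms(2)] by (intro sum_mono2) auto
  finally show ?thesis .
qed

text \<open>Log-convexity makes the ratios of consecutive terms nondecreasing, so s grows at least
  like (s 1 / s 0)^n. A first ratio above q would violate the bound for large n, however large C
  is.\<close>

lemma log_convex_growth:
  fixes s :: "nat \<Rightarrow> real"
  assumes nonneg: "\<And>n. 0 \<le> s n" and conv: "\<And>n. (s (Suc n))\<^sup>2 \<le> s n * s (Suc (Suc n))"
    and bound: "\<And>n. s n \<le> C * q ^ n" and q: "0 \<le> q"
  shows "s 1 \<le> q * s 0"
proof (cases "s 0 = 0")
  case True
  then show ?thesis using conv[of 0] by simp
next
  case False
  then have s0: "s 0 > 0" using nonneg[of 0] by simp
  show ?thesis
  proof (rule ccontr)
    assume "\<not> s 1 \<le> q * s 0"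
    define c where "c = s 1 / s 0"
    have cq: "c > q" using \<open>\<not> s 1 \<le> q * s 0\<close> s0 by (simp add: c_def field_simps)
    have step: "s (Suc n) \<ge> c * s n \<and> s n > 0" for n
    proof (induction n)
      case 0
      show ?case using s0 by (simp add: c_def)
    next
      case (Suc n)
      then have pos: "s (Suc n) > 0" using cq q by (smt (verit) mult_pos_pos)
      have "c * s (Suc n) * s n \<le> s (Suc n) * s (Suc n)"
        using Suc pos by (simp add: mult.commute mult.left_commute)
      also have "\<dots> \<le> s (Suc (Suc n)) * s n"
        using conv[of n] by (simp add: power2_eq_square mult.commute)
      finally have "c * s (Suc n) \<le> s (Suc (Suc n))" using Suc by simp
      with pos show ?case by simp
    qed
    have low: "s n \<ge> c ^ n * s 0" for n
    proof (induction n)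
      case (Suc n)
      have "c ^ Suc n * s 0 \<le> c * s n" using Suc cq q by (simp add: mult.assoc mult_left_mono)
      then show ?case using step[of n] by simp
    qed simp
    have "q \<noteq> 0"
    proof
      assume "q = 0"
      then have "c * s 0 \<le> 0" using low[of 1] bound[of 1] by simp
      then show False using cq s0 \<open>q = 0\<close> by (simp add: mult_le_0_iff)
    qed
    then have q0: "q > 0" using q by simp
    have "1 < c / q" using cq q0 by simp
    then obtain n where n: "C / s 0 < (c / q) ^ n" using real_arch_pow by blast
    then have "C * q ^ n < c ^ n * s 0" using q0 s0 by (simp add: power_divide field_simps)
    then show False using low[of n] bound[of n] by simp
  qed
qed

section \<open>Averaging operators on groups\<close>

definition words :: "nat \<Rightarrow> nat \<Rightarrow> nat list set" where
  "words k n = {w \<in> lists {..<k}. length w = n}"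

lemma words_alt: "words k n = {w. set w \<subseteq> {..<k} \<and> length w = n}"
  by (auto simp: words_def)

lemma finite_words: "finite (words k n)"
  unfolding words_alt by (rule finite_lists_length_eq) simp

lemma card_words: "card (words k n) = k ^ n"
  unfolding words_alt by (simp add: card_lists_length_eq)

lemma words_0: "words k 0 = {[]}"
  by (auto simp: words_alt)

lemma sum_words_Suc: "(\<Sum>w\<in>words k (Suc n). g w) = (\<Sum>i<k. \<Sum>w\<in>words k n. g (i # w))"
proof -
  have eq: "words k (Suc n) = (\<lambda>(i, w). i # w) ` ({..<k} \<times> words k n)"
    by (auto simp: words_alt length_Suc_conv image_iff)
  have "inj_on (\<lambda>(i, w). i # w) ({..<k} \<times> words k n)"
    by (auto simp: inj_on_def)
  then show ?thesis
    unfolding eq by (simp add: sum.reindex sum.cartesian_product case_prod_unfold)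
qed

context group
begin

text \<open>The cut-off outside the carrier keeps the result in \<open>fsupp (carrier G)\<close>. As
  g acts on the argument, composing shifts reverses the order of the factors.\<close>

definition shift :: "'a \<Rightarrow> ('a \<Rightarrow> real) \<Rightarrow> 'a \<Rightarrow> real" where
  "shift g f x = (if x \<in> carrier G then f (g \<otimes> x) else 0)"

definition point :: "'a \<Rightarrow> 'a \<Rightarrow> real" where
  "point g x = (if x = g then 1 else 0)"

lemma shift_fsupp:
  assumes "g \<in> carrier G" "f \<in> fsupp (carrier G)" shows "shift g f \<in> fsupp (carrier G)"
proof (rule fsuppI[of "(\<lambda>x. inv g \<otimes> x) ` {x. f x \<noteq> 0}"])
  show "(\<lambda>x. inv g \<otimes> x) ` {x. f x \<noteq> 0} \<subseteq> carrier G"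
    using assms by (auto simp: fsupp_def)
  fix x assume "shift g f x \<noteq> 0"
  then have "x \<in> carrier G" "f (g \<otimes> x) \<noteq> 0" by (auto simp: shift_def split: if_splits)
  moreover have "x = inv g \<otimes> (g \<otimes> x)" using assms \<open>x \<in> carrier G\<close> by (simp add: m_assoc[symmetric])
  ultimately show "x \<in> (\<lambda>x. inv g \<otimes> x) ` {x. f x \<noteq> 0}" by blast
qed (use fsupp_finite[OF assms(2)] in auto)

lemma point_fsupp: "g \<in> carrier G \<Longrightarrow> point g \<in> fsupp (carrier G)"
  by (rule fsuppI[of "{g}"]) (auto simp: point_def split: if_splits)

lemma ip_point_right: "f \<in> fsupp (carrier G) \<Longrightarrow> ip f (point g) = f g"
  by (subst ip_eq[of f _ "{g}"]) (auto simp: point_def split: if_splits)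

lemma shift_shift:
  "a \<in> carrier G \<Longrightarrow> b \<in> carrier G \<Longrightarrow> shift a (shift b f) = shift (b \<otimes> a) f"
  by (auto simp: shift_def fun_eq_iff m_assoc)

lemma shift_one: "f \<in> fsupp (carrier G) \<Longrightarrow> shift \<one> f = f"
  by (auto simp: shift_def fun_eq_iff fsupp_outside)

lemma ip_shift:
  assumes g: "g \<in> carrier G" and "f \<in> fsupp (carrier G)" "h \<in> fsupp (carrier G)"
  shows "ip (shift g f) (shift g h) = ip f h"
proof -
  let ?S = "{x. f x \<noteq> 0}"
  let ?i = "\<lambda>x. inv g \<otimes> x"
  have S: "?S \<subseteq> carrier G" "finite ?S" using assms by (auto simp: fsupp_def)
  have inj: "inj_on ?i ?S"
  proof (rule inj_onI)
    fix x y assume "x \<in> ?S" "y \<in> ?S" "inv g \<otimes> x = inv g \<otimes> y"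
    moreover from this have "x \<in> carrier G" "y \<in> carrier G" using S by auto
    ultimately show "x = y" using g by simp
  qed
  have "ip (shift g f) (shift g h) = (\<Sum>x\<in>?i ` ?S. shift g f x * shift g h x)"
  proof (rule ip_eq[OF shift_fsupp[OF g assms(2)]])
    fix x assume "shift g f x \<noteq> 0"
    then have "x \<in> carrier G" "f (g \<otimes> x) \<noteq> 0" by (auto simp: shift_def split: if_splits)
    moreover have "x = ?i (g \<otimes> x)" using g \<open>x \<in> carrier G\<close> by (simp add: m_assoc[symmetric])
    ultimately show "x \<in> ?i ` ?S" by blast
  qed (use S in auto)
  also have "\<dots> = (\<Sum>x\<in>?S. shift g f (?i x) * shift g h (?i x))"
    by (simp add: sum.reindex[OF inj])
  also have "\<dots> = ip f h" unfolding ip_def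
    using S g by (intro sum.cong) (auto simp: shift_def m_assoc[symmetric])
  finally show ?thesis .
qed

lemma ip_shift_adjoint:
  assumes g: "g \<in> carrier G" and "f \<in> fsupp (carrier G)" "h \<in> fsupp (carrier G)"
  shows "ip (shift g f) h = ip f (shift (inv g) h)"
proof -
  have "h = shift g (shift (inv g) h)" using assms by (simp add: shift_shift shift_one)
  then have "ip (shift g f) h = ip (shift g f) (shift g (shift (inv g) h))" by simp
  then show ?thesis using assms by (simp add: ip_shift shift_fsupp)
qed

end

text \<open>Distinct letters may have the same value, so that the letters of G also define a walk on
  a quotient. The permutation \<iota> of the letters expresses the symmetry of the generating set in
  a form that passes to quotients.\<close>

locale symmetric_walk = group G for G (structure) +
  fixes k :: nat and \<sigma> :: "nat \<Rightarrow> 'a" and \<iota> :: "nat \<Rightarrow> nat"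
  assumes k_pos: "0 < k"
    and \<sigma>_closed: "i < k \<Longrightarrow> \<sigma> i \<in> carrier G"
    and \<iota>_bij: "bij_betw \<iota> {..<k} {..<k}"
    and \<sigma>_\<iota>: "i < k \<Longrightarrow> \<sigma> (\<iota> i) = inv (\<sigma> i)"
begin

lemma word_val_closed: "w \<in> lists {..<k} \<Longrightarrow> word_val G \<sigma> w \<in> carrier G"
  by (induction w) (auto simp: \<sigma>_closed)

definition avg :: "('a \<Rightarrow> real) \<Rightarrow> 'a \<Rightarrow> real" where
  "avg f x = 1 / real k * (\<Sum>i<k. shift (\<sigma> i) f x)"

lemma avg_fsupp: "f \<in> fsupp (carrier G) \<Longrightarrow> avg f \<in> fsupp (carrier G)"
  unfolding avg_def by (intro fsupp_scale fsupp_sum shift_fsupp) (auto simp: \<sigma>_closed)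

lemma avg_pow_fsupp: "f \<in> fsupp (carrier G) \<Longrightarrow> (avg ^^ n) f \<in> fsupp (carrier G)"
  by (induction n) (auto intro: avg_fsupp)

lemma ip_avg_left:
  "f \<in> fsupp (carrier G) \<Longrightarrow> ip (avg f) h = 1 / real k * (\<Sum>i<k. ip (shift (\<sigma> i) f) h)"
proof -
  assume f: "f \<in> fsupp (carrier G)"
  have "avg f = (\<lambda>x. 1 / real k * (\<Sum>i<k. shift (\<sigma> i) f x))" by (simp add: avg_def fun_eq_iff)
  moreover have "(\<lambda>x. \<Sum>i<k. shift (\<sigma> i) f x) \<in> fsupp (carrier G)"
    using f by (intro fsupp_sum shift_fsupp) (auto simp: \<sigma>_closed)
  ultimately have "ip (avg f) h = 1 / real k * ip (\<lambda>x. \<Sum>i<k. shift (\<sigma> i) f x) h"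
    using ip_scale_left[of _ _ "1 / real k" h] by metis
  also have "ip (\<lambda>x. \<Sum>i<k. shift (\<sigma> i) f x) h = (\<Sum>i<k. ip (shift (\<sigma> i) f) h)"
    using f by (intro ip_sum_left[of _ _ "carrier G"] shift_fsupp) (auto simp: \<sigma>_closed)
  finally show ?thesis .
qed

text \<open>Passing to the adjoint replaces each letter by its inverse, which only permutes the
  sum.\<close>

lemma ip_avg_adjoint:
  assumes "f \<in> fsupp (carrier G)" "h \<in> fsupp (carrier G)"
  shows "ip (avg f) h = ip f (avg h)"
proof -
  have "(\<Sum>i<k. ip (shift (\<sigma> i) f) h) = (\<Sum>i<k. ip (shift (\<sigma> (\<iota> i)) h) f)"
  proof (rule sum.cong[OF HOL.refl])
    fix i assume "i \<in> {..<k}"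
    then have i: "\<sigma> i \<in> carrier G" "\<sigma> (\<iota> i) = inv (\<sigma> i)" by (auto simp: \<sigma>_closed \<sigma>_\<iota>)
    then have "ip (shift (\<sigma> i) f) h = ip f (shift (\<sigma> (\<iota> i)) h)"
      using assms by (simp add: ip_shift_adjoint)
    also have "\<dots> = ip (shift (\<sigma> (\<iota> i)) h) f"
      using assms i by (intro ip_commute[of _ "carrier G"]) (simp_all add: shift_fsupp)
    finally show "ip (shift (\<sigma> i) f) h = ip (shift (\<sigma> (\<iota> i)) h) f" .
  qed
  also have "\<dots> = (\<Sum>i<k. ip (shift (\<sigma> i) h) f)"
    by (rule sum.reindex_bij_betw[OF \<iota>_bij])
  finally have "ip (avg f) h = ip (avg h) f" using assms by (simp add: ip_avg_left)
  also have "\<dots> = ip f (avg h)" by (rule ip_commute[OF avg_fsupp[OF assms(2)] assms(1)])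
  finally show ?thesis .
qed

lemma ip_avg_pow_adjoint:
  assumes "f \<in> fsupp (carrier G)" "h \<in> fsupp (carrier G)"
  shows "ip ((avg ^^ n) f) h = ip f ((avg ^^ n) h)"
  using assms
proof (induction n arbitrary: h)
  case (Suc n)
  have "ip ((avg ^^ Suc n) f) h = ip ((avg ^^ n) f) (avg h)"
    using Suc.prems by (simp add: ip_avg_adjoint avg_pow_fsupp)
  also have "\<dots> = ip f ((avg ^^ n) (avg h))" using Suc.prems by (intro Suc.IH avg_fsupp)
  finally show ?case by (simp add: funpow_swap1)
qed simp

lemma ip_avg_pow_add:
  assumes "f \<in> fsupp (carrier G)" "h \<in> fsupp (carrier G)"
  shows "ip ((avg ^^ (m + n)) f) h = ip ((avg ^^ n) f) ((avg ^^ m) h)"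
  using ip_avg_pow_adjoint[of "(avg ^^ n) f" h m] assms by (simp add: funpow_add avg_pow_fsupp)

lemma shift_avg:
  assumes "g \<in> carrier G" shows "shift g (avg f) x = 1 / real k * (\<Sum>i<k. shift (\<sigma> i \<otimes> g) f x)"
proof (cases "x \<in> carrier G")
  case True
  then have "shift (\<sigma> i \<otimes> g) f x = shift (\<sigma> i) f (g \<otimes> x)" if "i < k" for i
    using assms that by (simp add: shift_def m_assoc \<sigma>_closed)
  then show ?thesis using True by (simp add: shift_def[of g] avg_def)
qed (simp add: shift_def)

lemma avg_pow:
  "f \<in> fsupp (carrier G) \<Longrightarrow>
    (avg ^^ n) f x = 1 / real k ^ n * (\<Sum>w\<in>words k n. shift (word_val G \<sigma> w) f x)"
proof (induction n arbitrary: f)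
  case 0
  then show ?case by (simp add: words_0 shift_one)
next
  case (Suc n)
  have "(avg ^^ Suc n) f x = (avg ^^ n) (avg f) x" by (simp only: funpow_Suc_right o_def)
  also have "\<dots> = 1 / real k ^ n * (\<Sum>w\<in>words k n. shift (word_val G \<sigma> w) (avg f) x)"
    by (rule Suc.IH[OF avg_fsupp[OF Suc.prems]])
  also have "(\<Sum>w\<in>words k n. shift (word_val G \<sigma> w) (avg f) x)
      = (\<Sum>w\<in>words k n. 1 / real k * (\<Sum>i<k. shift (word_val G \<sigma> (i # w)) f x))"
    by (intro sum.cong HOL.refl) (auto simp: shift_avg words_def word_val_closed)
  also have "\<dots> = 1 / real k * (\<Sum>w\<in>words k (Suc n). shift (word_val G \<sigma> w) f x)"
    by (simp add: sum_words_Suc sum_distrib_left sum.swap[of _ "words k n"])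
  finally show ?case by simp
qed

lemma ip_avg_pow:
  assumes "f \<in> fsupp (carrier G)"
  shows "ip ((avg ^^ n) f) h = 1 / real k ^ n * (\<Sum>w\<in>words k n. ip (shift (word_val G \<sigma> w) f) h)"
proof -
  have cl: "w \<in> words k n \<Longrightarrow> shift (word_val G \<sigma> w) f \<in> fsupp (carrier G)" for w
    using assms by (intro shift_fsupp word_val_closed) (auto simp: words_def)
  have "(avg ^^ n) f = (\<lambda>x. 1 / real k ^ n * (\<Sum>w\<in>words k n. shift (word_val G \<sigma> w) f x))"
    using avg_pow[OF assms] by (simp add: fun_eq_iff)
  moreover have "(\<lambda>x. \<Sum>w\<in>words k n. shift (word_val G \<sigma> w) f x) \<in> fsupp (carrier G)"
    using cl by (intro fsupp_sum finite_words)
  ultimately have "ip ((avg ^^ n) f) h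
      = 1 / real k ^ n * ip (\<lambda>x. \<Sum>w\<in>words k n. shift (word_val G \<sigma> w) f x) h"
    using ip_scale_left[of _ _ "1 / real k ^ n" h] by metis
  also have "ip (\<lambda>x. \<Sum>w\<in>words k n. shift (word_val G \<sigma> w) f x) h
      = (\<Sum>w\<in>words k n. ip (shift (word_val G \<sigma> w) f) h)"
    using cl by (intro ip_sum_left[of _ _ "carrier G"] finite_words)
  finally show ?thesis .
qed

text \<open>A word fixes g under left multiplication exactly if its value is \<one>, so all diagonal
  matrix entries of the n-th power agree.\<close>

lemma avg_pow_point_self:
  assumes "g \<in> carrier G"
  shows "(avg ^^ n) (point g) g = return_prob G k \<sigma> n"
proof -
  have "(\<Sum>w\<in>words k n. shift (word_val G \<sigma> w) (point g) g)
      = (\<Sum>w\<in>words k n. if word_val G \<sigma> w = \<one> then 1 else 0)"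
    using assms by (intro sum.cong)
      (auto simp: shift_def point_def words_def word_val_closed l_cancel_one')
  also have "\<dots> = real (card {w \<in> words k n. word_val G \<sigma> w = \<one>})"
    by (simp add: sum.If_cases[OF finite_words] Int_def)
  also have "{w \<in> words k n. word_val G \<sigma> w = \<one>}
      = {w \<in> lists {..<k}. length w = n \<and> word_val G \<sigma> w = \<one>}"
    by (auto simp: words_def)
  finally show ?thesis
    using avg_pow[OF point_fsupp[OF assms]] by (simp add: return_prob_def)
qed

lemma ip_avg_pow_point:
  assumes "g \<in> carrier G"
  shows "ip ((avg ^^ n) (point g)) ((avg ^^ n) (point g)) = return_prob G k \<sigma> (2 * n)"
  using ip_avg_pow_add[of "point g" "point g" n n] assms
  by (simp add: point_fsupp ip_point_right avg_pow_fsupp avg_pow_point_self mult_2)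

lemma return_prob_nonneg: "0 \<le> return_prob G k \<sigma> n"
  by (simp add: return_prob_def)

lemma avg_pow_expand:
  assumes "f \<in> fsupp (carrier G)" "x \<in> carrier G"
  shows "(avg ^^ n) f x = (\<Sum>y | f y \<noteq> 0. f y * (avg ^^ n) (point y) x)"
proof -
  let ?S = "{y. f y \<noteq> 0}"
  have S: "finite ?S" "?S \<subseteq> carrier G" using assms by (auto simp: fsupp_def)
  have *: "shift g f x = (\<Sum>y\<in>?S. f y * shift g (point y) x)" for g
  proof -
    have "(\<Sum>y\<in>?S. f y * shift g (point y) x) = (\<Sum>y\<in>?S. if y = g \<otimes> x then f y else 0)"
      using assms(2) by (intro sum.cong) (auto simp: shift_def point_def)
    also have "\<dots> = f (g \<otimes> x)" using S by (auto simp: sum.delta')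
    finally show ?thesis using assms(2) by (simp add: shift_def)
  qed
  have "(\<Sum>w\<in>words k n. shift (word_val G \<sigma> w) f x)
      = (\<Sum>y\<in>?S. f y * (\<Sum>w\<in>words k n. shift (word_val G \<sigma> w) (point y) x))"
    unfolding * sum_distrib_left by (rule sum.swap)
  moreover have "(\<Sum>y\<in>?S. f y * (avg ^^ n) (point y) x)
      = (\<Sum>y\<in>?S. f y * (1 / real k ^ n * (\<Sum>w\<in>words k n. shift (word_val G \<sigma> w) (point y) x)))"
    using S by (intro sum.cong) (auto simp: avg_pow[OF point_fsupp])
  moreover have "c * (\<Sum>y\<in>?S. f y * W y) = (\<Sum>y\<in>?S. f y * (c * W y))" for c and W :: "'a \<Rightarrow> real"
    by (simp add: sum_distrib_left mult.left_commute)
  ultimately show ?thesis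
    by (simp only: avg_pow[OF assms(1)])
qed

text \<open>The squared norms of the iterates are log-convex, since \<open>avg\<close> is
  self-adjoint. By Cauchy-Schwarz every matrix entry of the power 2n is at most the return
  probability at 2n, so these squared norms are at most C r^(2n), with C depending on f.
  \<open>log_convex_growth\<close> removes C.\<close>

lemma avg_norm_bound:
  assumes r: "0 \<le> r" "\<And>n. return_prob G k \<sigma> (2 * n) \<le> r ^ (2 * n)" and f: "f \<in> fsupp (carrier G)"
  shows "ip (avg f) (avg f) \<le> r\<^sup>2 * ip f f"
proof -
  let ?S = "{y. f y \<noteq> 0}"
  define s where "s n = ip ((avg ^^ n) f) ((avg ^^ n) f)" for n
  have S: "finite ?S" "?S \<subseteq> carrier G" using f by (auto simp: fsupp_def)
  have kernel: "\<bar>(avg ^^ (n + n)) (point y) x\<bar> \<le> (r\<^sup>2) ^ n" if "x \<in> carrier G" "y \<in> carrier G" for n x y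
  proof -
    have "(avg ^^ (n + n)) (point y) x = ip ((avg ^^ n) (point y)) ((avg ^^ n) (point x))"
      using that ip_avg_pow_add[of "point y" "point x" n n]
      by (simp add: point_fsupp ip_point_right avg_pow_fsupp)
    also have "\<bar>\<dots>\<bar> \<le> sqrt (return_prob G k \<sigma> (2 * n)) * sqrt (return_prob G k \<sigma> (2 * n))"
      using ip_cauchy_schwarz_sqrt[of "(avg ^^ n) (point y)" "carrier G" "(avg ^^ n) (point x)"] that
      by (simp add: point_fsupp avg_pow_fsupp ip_avg_pow_point)
    also have "\<dots> \<le> (r\<^sup>2) ^ n" using r(2)[of n] by (simp add: return_prob_nonneg power_mult)
    finally show ?thesis .
  qed
  have "s 1 \<le> r\<^sup>2 * s 0"
  proof (rule log_convex_growth)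
    show "0 \<le> s n" for n by (simp add: s_def ip_self_nonneg)
    show "(s (Suc n))\<^sup>2 \<le> s n * s (Suc (Suc n))" for n
    proof -
      have "s (Suc n) = ip ((avg ^^ n) f) ((avg ^^ Suc (Suc n)) f)"
        unfolding s_def using f by (simp add: ip_avg_adjoint avg_pow_fsupp avg_fsupp)
      then show ?thesis
        unfolding s_def using f ip_cauchy_schwarz avg_pow_fsupp by metis
    qed
    show "s n \<le> (\<Sum>y\<in>?S. \<bar>f y\<bar>)\<^sup>2 * (r\<^sup>2) ^ n" for n
    proof -
      have "s n = ip f ((avg ^^ (n + n)) f)"
        unfolding s_def using f ip_avg_pow_add[of f f n n] ip_commute[of f "carrier G" "(avg ^^ (n + n)) f"]
        by (simp add: avg_pow_fsupp)
      also have "\<dots> = (\<Sum>x\<in>?S. f x * (\<Sum>y\<in>?S. f y * (avg ^^ (n + n)) (point y) x))"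
        unfolding ip_def using S f by (intro sum.cong) (auto simp: avg_pow_expand)
      also have "\<dots> \<le> (\<Sum>x\<in>?S. \<bar>f x\<bar> * (\<Sum>y\<in>?S. \<bar>f y\<bar> * (r\<^sup>2) ^ n))"
      proof (rule sum_mono)
        fix x assume x: "x \<in> ?S"
        have "\<bar>\<Sum>y\<in>?S. f y * (avg ^^ (n + n)) (point y) x\<bar>
            \<le> (\<Sum>y\<in>?S. \<bar>f y * (avg ^^ (n + n)) (point y) x\<bar>)" by (rule sum_abs)
        also have "\<dots> \<le> (\<Sum>y\<in>?S. \<bar>f y\<bar> * (r\<^sup>2) ^ n)"
          using kernel x S by (intro sum_mono) (auto simp: abs_mult intro!: mult_left_mono)
        finally have "\<bar>f x\<bar> * \<bar>\<Sum>y\<in>?S. f y * (avg ^^ (n + n)) (point y) x\<bar>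
            \<le> \<bar>f x\<bar> * (\<Sum>y\<in>?S. \<bar>f y\<bar> * (r\<^sup>2) ^ n)" by (intro mult_left_mono) auto
        then show "f x * (\<Sum>y\<in>?S. f y * (avg ^^ (n + n)) (point y) x)
            \<le> \<bar>f x\<bar> * (\<Sum>y\<in>?S. \<bar>f y\<bar> * (r\<^sup>2) ^ n)"
          by (rule order_trans[OF order_trans[OF abs_ge_self eq_refl[OF abs_mult]]])
      qed
      also have "\<dots> = (\<Sum>y\<in>?S. \<bar>f y\<bar>)\<^sup>2 * (r\<^sup>2) ^ n"
        by (simp add: sum_distrib_right[symmetric] power2_eq_square)
      finally show ?thesis .
    qed
  qed simp
  then show ?thesis by (simp add: s_def)
qed

lemma avg_pow_norm_bound:
  assumes r: "0 \<le> r" "\<And>f. f \<in> fsupp (carrier G) \<Longrightarrow> ip (avg f) (avg f) \<le> r\<^sup>2 * ip f f"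
    and f: "f \<in> fsupp (carrier G)"
  shows "sqrt (ip ((avg ^^ n) f) ((avg ^^ n) f)) \<le> r ^ n * sqrt (ip f f)"
proof (induction n)
  case (Suc n)
  have "sqrt (ip ((avg ^^ Suc n) f) ((avg ^^ Suc n) f)) \<le> r * sqrt (ip ((avg ^^ n) f) ((avg ^^ n) f))"
    using real_sqrt_le_mono[OF r(2)[OF avg_pow_fsupp[OF f, of n]]] r(1) by (simp add: real_sqrt_mult)
  also have "\<dots> \<le> r * (r ^ n * sqrt (ip f f))" using Suc r by (intro mult_left_mono)
  finally show ?case by simp
qed simp

lemma avg_abs_le: "\<bar>avg f x\<bar> \<le> avg (\<lambda>x. \<bar>f x\<bar>) x"
proof -
  have "\<bar>\<Sum>i<k. shift (\<sigma> i) f x\<bar> \<le> (\<Sum>i<k. \<bar>shift (\<sigma> i) f x\<bar>)" by (rule sum_abs)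
  also have "\<dots> = (\<Sum>i<k. shift (\<sigma> i) (\<lambda>x. \<bar>f x\<bar>) x)"
    by (cases "x \<in> carrier G") (simp_all add: shift_def)
  finally show ?thesis by (simp add: avg_def abs_mult divide_right_mono)
qed

lemma avg_add: "avg (\<lambda>x. f x + g x) x = avg f x + avg g x"
  by (cases "x \<in> carrier G") (simp_all add: avg_def shift_def sum.distrib add_divide_distrib)

lemma avg_scale: "avg (\<lambda>x. c * f x) x = c * avg f x"
  by (cases "x \<in> carrier G") (simp_all add: avg_def shift_def sum_distrib_left)

text \<open>This is the equality of norm and numerical radius for self-adjoint operators.
  Nonnegative test functions suffice because of \<open>avg_abs_le\<close>. Polarization of
  \<open>ip (avg f) g\<close> with g = t \<open>avg f\<close> gives a quadratic inequality in
  t.\<close>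

lemma numerical_radius_bound:
  assumes \<beta>: "0 \<le> \<beta>"
    and pos: "\<And>f. f \<in> fsupp (carrier G) \<Longrightarrow> (\<And>x. 0 \<le> f x) \<Longrightarrow> ip (avg f) f \<le> \<beta> * ip f f"
    and f: "f \<in> fsupp (carrier G)"
  shows "ip (avg f) (avg f) \<le> \<beta>\<^sup>2 * ip f f"
proof -
  have abs: "\<bar>ip (avg h) h\<bar> \<le> \<beta> * ip h h" if h: "h \<in> fsupp (carrier G)" for h
  proof -
    have "\<bar>ip (avg h) h\<bar> \<le> ip (avg (\<lambda>x. \<bar>h x\<bar>)) (\<lambda>x. \<bar>h x\<bar>)"
      using h by (intro ip_mono_abs[of _ "carrier G"] avg_abs_le avg_fsupp fsupp_abs) auto
    also have "\<dots> \<le> \<beta> * ip (\<lambda>x. \<bar>h x\<bar>) (\<lambda>x. \<bar>h x\<bar>)" by (rule pos[OF fsupp_abs[OF h]]) simp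
    also have "ip (\<lambda>x. \<bar>h x\<bar>) (\<lambda>x. \<bar>h x\<bar>) = ip h h" by (simp add: ip_def)
    finally show ?thesis .
  qed
  define a where "a = ip f f"
  define b where "b = ip (avg f) (avg f)"
  have main: "2 * t * b \<le> \<beta> * (a + t\<^sup>2 * b)" for t
  proof -
    define g where "g = (\<lambda>x. t * avg f x)"
    have g: "g \<in> fsupp (carrier G)" unfolding g_def using f by (intro fsupp_scale avg_fsupp)
    let ?p = "\<lambda>x. f x + g x" and ?m = "\<lambda>x. f x + (- 1) * g x"
    have mg: "(\<lambda>x. (- 1) * g x) \<in> fsupp (carrier G)" using g by (rule fsupp_scale)
    have p: "?p \<in> fsupp (carrier G)" and m: "?m \<in> fsupp (carrier G)"
      by (rule fsupp_add[OF f g], rule fsupp_add[OF f mg])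
    have avgp: "avg ?p = (\<lambda>x. avg f x + avg g x)" by (simp add: fun_eq_iff avg_add)
    have avgm: "avg ?m = (\<lambda>x. avg f x + (- 1) * avg g x)"
      using avg_add[of f "\<lambda>x. (- 1) * g x"] avg_scale[of "- 1" g] by (simp add: fun_eq_iff)
    note A = avg_fsupp[OF f] avg_fsupp[OF g] fsupp_scale[OF avg_fsupp[OF g], of "- 1"] f g mg p m
    have gf: "ip (avg g) f = ip (avg f) g" 
      using ip_avg_adjoint[OF g f] ip_commute[OF g avg_fsupp[OF f]] by simp
    have gf': "ip g f = ip f g" by (rule ip_commute[OF g f])
    have e1: "ip (avg ?p) ?p = ip (avg f) f + 2 * ip (avg f) g + ip (avg g) g"
      unfolding avgp ip_add_left[OF A(1,2)] ip_add_right gf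
      by simp
    have e2: "ip (avg ?m) ?m = ip (avg f) f - 2 * ip (avg f) g + ip (avg g) g"
      unfolding avgm ip_add_left[OF A(1,3)] ip_scale_left[OF A(2)]
        ip_add_right ip_scale_right gf
      by simp
    have e3: "ip ?p ?p = a + 2 * ip f g + ip g g"
      unfolding ip_add_left[OF A(4,5)] ip_add_right gf' a_def
      by simp
    have e4: "ip ?m ?m = a - 2 * ip f g + ip g g"
      unfolding ip_add_left[OF A(4,6)] ip_scale_left[OF A(5)] ip_add_right ip_scale_right gf' a_def
      by simp
    have "4 * ip (avg f) g = ip (avg ?p) ?p - ip (avg ?m) ?m" unfolding e1 e2 by simp
    also have "\<dots> \<le> \<beta> * ip ?p ?p + \<beta> * ip ?m ?m" using abs[OF p] abs[OF m] by linarith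
    also have "\<dots> = 2 * (\<beta> * (a + ip g g))" unfolding e3 e4 by (simp add: algebra_simps)
    finally have "2 * ip (avg f) g \<le> \<beta> * (a + ip g g)" by simp
    moreover have "ip (avg f) g = t * b" unfolding g_def b_def by (rule ip_scale_right)
    moreover have "ip g g = t\<^sup>2 * b"
      unfolding g_def b_def by (simp only: ip_scale_right ip_scale_left[OF avg_fsupp[OF f]] power2_eq_square mult.assoc)
    ultimately show ?thesis by simp
  qed
  show ?thesis
  proof (cases "\<beta> = 0")
    case True
    then have "b \<le> 0" using main[of 1] by simp
    then show ?thesis using True by (simp add: b_def)
  next
    case False
    then have "\<beta> > 0" using \<beta> by simp
    \<comment> \<open>The value t = 1 / \<beta> maximizes 2 t - \<beta> t^2, the factor of b once
      all terms with b are on the left.\<close>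
    have "2 * (1 / \<beta>) * b \<le> \<beta> * (a + (1 / \<beta>)\<^sup>2 * b)" by (rule main)
    then have "\<beta> * (2 * (1 / \<beta>) * b) \<le> \<beta> * (\<beta> * (a + (1 / \<beta>)\<^sup>2 * b))"
      using \<open>\<beta> > 0\<close> by (intro mult_left_mono) auto
    then have "2 * b \<le> \<beta>\<^sup>2 * a + b"
      using \<open>\<beta> > 0\<close> by (simp add: distrib_left power2_eq_square)
    then show ?thesis by (simp add: a_def b_def)
  qed
qed

text \<open>Used in contrapositive form: a return probability above \<beta>^n yields a vector f with
  \<open>ip (avg f) f\<close> above \<beta> \<open>ip f f\<close>.\<close>

lemma return_prob_le_of_numerical_radius:
  assumes \<beta>: "0 \<le> \<beta>"
    and pos: "\<And>f. f \<in> fsupp (carrier G) \<Longrightarrow> (\<And>x. 0 \<le> f x) \<Longrightarrow> ip (avg f) f \<le> \<beta> * ip f f"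
  shows "return_prob G k \<sigma> n \<le> \<beta> ^ n"
proof -
  let ?e = "point \<one>"
  have e: "?e \<in> fsupp (carrier G)" by (simp add: point_fsupp)
  have ee: "ip ?e ?e = 1" using ip_point_right[OF e, of \<one>] by (simp add: point_def)
  have "ip (avg f) (avg f) \<le> \<beta>\<^sup>2 * ip f f" if "f \<in> fsupp (carrier G)" for f
    by (rule numerical_radius_bound[OF \<beta> _ that]) (rule pos)
  then have bound: "sqrt (ip ((avg ^^ n) ?e) ((avg ^^ n) ?e)) \<le> \<beta> ^ n * sqrt (ip ?e ?e)"
    using \<beta> e by (intro avg_pow_norm_bound)
  have "return_prob G k \<sigma> n = ip ((avg ^^ n) ?e) ?e"
    using avg_pow_point_self[of \<one> n] e by (simp add: ip_point_right avg_pow_fsupp)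
  also have "\<dots> \<le> sqrt (ip ((avg ^^ n) ?e) ((avg ^^ n) ?e)) * sqrt (ip ?e ?e)"
    using ip_cauchy_schwarz_sqrt[OF avg_pow_fsupp[OF e] e, of n] by linarith
  also have "\<dots> \<le> \<beta> ^ n"
    using bound ee by simp
  finally show ?thesis .
qed

text \<open>A vector that almost attains the norm \<open>\<rho>\<close> is almost an eigenvector.\<close>
lemma almost_eigenvector_powers:
  assumes \<rho>: "0 \<le> \<rho>" "\<rho> \<le> 1"
    and norm: "\<And>f. f \<in> fsupp (carrier G) \<Longrightarrow> ip (avg f) (avg f) \<le> \<rho>\<^sup>2 * ip f f"
    and f: "f \<in> fsupp (carrier G)" and \<epsilon>: "0 \<le> \<epsilon>" "(\<rho> - \<epsilon>) * ip f f \<le> ip (avg f) f"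
  shows "(\<rho> ^ n - real n * sqrt (2 * \<rho> * \<epsilon>)) * ip f f \<le> ip ((avg ^^ n) f) f"
proof -
  let ?a = "ip f f"
  \<comment> \<open>The defect from being an eigenvector. Its squared norm is at most (\<rho>^2 - 2
    \<rho> (\<rho> - \<epsilon>) + \<rho>^2) \<open>ip f f\<close>, that is 2 \<rho> \<epsilon>
    \<open>ip f f\<close>, and each further power adds one error of this origin.\<close>
  define g where "g = (\<lambda>x. avg f x + (- \<rho>) * f x)"
  have mf: "(\<lambda>x. (- \<rho>) * f x) \<in> fsupp (carrier G)" using f by (rule fsupp_scale)
  have g: "g \<in> fsupp (carrier G)" unfolding g_def using f mf by (intro fsupp_add avg_fsupp)
  note A = avg_fsupp[OF f] f mf
  have "ip f (avg f) = ip (avg f) f" by (rule ip_commute[OF A(2,1)])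
  then have gg: "ip g g = ip (avg f) (avg f) - 2 * \<rho> * ip (avg f) f + \<rho>\<^sup>2 * ?a"
    unfolding g_def ip_add_left[OF A(1,3)] ip_scale_left[OF f] ip_add_right ip_scale_right
    by (simp add: algebra_simps power2_eq_square)
  have "\<rho> * ((\<rho> - \<epsilon>) * ?a) \<le> \<rho> * ip (avg f) f" using \<epsilon>(2) \<rho>(1) by (intro mult_left_mono)
  then have "ip g g \<le> 2 * \<rho> * \<epsilon> * ?a"
    unfolding gg using norm[OF f] by (simp add: algebra_simps power2_eq_square)
  then have ng: "sqrt (ip g g) \<le> sqrt (2 * \<rho> * \<epsilon>) * sqrt ?a"
    using real_sqrt_le_mono real_sqrt_mult by metis
  have bound: "sqrt (ip ((avg ^^ n) f) ((avg ^^ n) f)) \<le> \<rho> ^ n * sqrt (ip f f)" for n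
    using \<rho>(1) norm f by (intro avg_pow_norm_bound)
  show ?thesis
  proof (induction n)
    case (Suc n)
    have pf: "(avg ^^ n) f \<in> fsupp (carrier G)" using f by (rule avg_pow_fsupp)
    have "(\<lambda>x. g x + \<rho> * f x) = avg f" by (simp add: g_def fun_eq_iff)
    moreover have "ip ((avg ^^ Suc n) f) f = ip ((avg ^^ n) f) (avg f)"
      using f pf by (simp add: ip_avg_adjoint)
    ultimately have "ip ((avg ^^ Suc n) f) f = ip ((avg ^^ n) f) g + \<rho> * ip ((avg ^^ n) f) f"
      using ip_add_right ip_scale_right by metis
    moreover have "\<bar>ip ((avg ^^ n) f) g\<bar> \<le> sqrt (2 * \<rho> * \<epsilon>) * ?a"
    proof -
      have "\<bar>ip ((avg ^^ n) f) g\<bar> \<le> sqrt (ip ((avg ^^ n) f) ((avg ^^ n) f)) * sqrt (ip g g)"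
        by (rule ip_cauchy_schwarz_sqrt[OF pf g])
      also have "\<dots> \<le> (\<rho> ^ n * sqrt ?a) * (sqrt (2 * \<rho> * \<epsilon>) * sqrt ?a)"
        using bound[of n] ng \<rho> ip_self_nonneg[of f] ip_self_nonneg[of g]
        by (intro mult_mono) auto
      also have "\<dots> = \<rho> ^ n * (sqrt (2 * \<rho> * \<epsilon>) * ?a)"
        using ip_self_nonneg[of f] by (simp add: mult_ac)
      also have "\<dots> \<le> 1 * (sqrt (2 * \<rho> * \<epsilon>) * ?a)"
        using \<rho> \<epsilon> ip_self_nonneg[of f] by (intro mult_right_mono power_le_one) auto
      finally show ?thesis by simp
    qed
    moreover have "\<rho> * ((\<rho> ^ n - real n * sqrt (2 * \<rho> * \<epsilon>)) * ?a) \<le> \<rho> * ip ((avg ^^ n) f) f"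
      using Suc \<rho>(1) by (intro mult_left_mono)
    moreover have "\<rho> * (real n * sqrt (2 * \<rho> * \<epsilon>) * ?a) \<le> 1 * (real n * sqrt (2 * \<rho> * \<epsilon>) * ?a)"
      using \<rho> \<epsilon> ip_self_nonneg[of f] by (intro mult_right_mono) auto
    ultimately show ?case by (simp add: algebra_simps)
  qed simp
qed

end

section \<open>Amenability from almost invariant vectors\<close>

text \<open>The probability density f^2 / \<open>ip f f\<close> on G is pushed to N along an
  N-equivariant map. Translating a set by n changes its mass by at most the l1 distance between the
  densities of f and \<open>shift n f\<close>, and Cauchy-Schwarz bounds this distance through their
  inner product.\<close>

lemma (in group) approximate_mean:
  assumes N: "subgroup N G" and E: "E \<subseteq> N"
    and f: "f \<in> fsupp (carrier G)" "0 < ip f f"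
    and \<eta>: "0 \<le> \<eta>" "\<eta> \<le> 1" "\<And>n. n \<in> E \<Longrightarrow> (1 - \<eta>) * ip f f \<le> ip (shift n f) f"
  shows "\<exists>\<mu> :: 'a set \<Rightarrow> real. (\<forall>A. 0 \<le> \<mu> A \<and> \<mu> A \<le> 1) \<and> \<mu> N = 1 \<and>
    (\<forall>A B. A \<inter> B = {} \<longrightarrow> \<mu> (A \<union> B) = \<mu> A + \<mu> B) \<and>
    (\<forall>n\<in>E. \<forall>A\<subseteq>N. \<bar>\<mu> (n <# A) - \<mu> A\<bar> \<le> sqrt (8 * \<eta>))"
proof -
  interpret N: subgroup N G by (rule N)
  define a where "a = ip f f"
  have a: "a > 0" using f by (simp add: a_def)
  let ?S = "{x. f x \<noteq> 0}"
  have S: "finite ?S" "?S \<subseteq> carrier G" using f by (auto simp: fsupp_def)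
  \<comment> \<open>A representative in each right coset of N splits off the N-part \<pi> x of x,
    and \<pi> (n x) = n \<pi> x because n x and x share their representative.\<close>
  define rep where "rep C = (SOME x. x \<in> C)" for C :: "'a set"
  define \<pi> where "\<pi> x = x \<otimes> inv (rep (N #> x))" for x
  have rep: "rep (N #> x) \<in> N #> x" if "x \<in> carrier G" for x
    unfolding rep_def using rcos_self[OF that N] by (rule someI)
  have repc: "rep (N #> x) \<in> carrier G" if "x \<in> carrier G" for x
    using rep[OF that] r_coset_subset_G[OF N.subset that] by blast
  have \<pi>N: "\<pi> x \<in> N" if x: "x \<in> carrier G" for x
  proof -
    from rep[OF x] obtain n where n: "n \<in> N" "rep (N #> x) = n \<otimes> x" by (auto simp: r_coset_def)
    then have "\<pi> x = inv n"
      using x by (simp add: \<pi>_def inv_mult_group m_assoc[symmetric] N.mem_carrier)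
    then show ?thesis using n by simp
  qed
  have \<pi>_equiv: "\<pi> (n \<otimes> x) = n \<otimes> \<pi> x" if "n \<in> N" "x \<in> carrier G" for n x
  proof -
    have "N #> (n \<otimes> x) = N #> x"
      using that coset_mult_assoc[OF N.subset, of n x] coset_join2[OF _ N, of n] by (simp add: N.mem_carrier)
    then show ?thesis using that repc by (simp add: \<pi>_def m_assoc N.mem_carrier)
  qed
  define \<mu> where "\<mu> A = (\<Sum>x\<in>?S. if \<pi> x \<in> A then (f x)\<^sup>2 / a else 0)" for A
  have tot: "(\<Sum>x\<in>?S. (f x)\<^sup>2 / a) = 1"
    using a by (simp add: sum_divide_distrib[symmetric] a_def ip_def power2_eq_square)
  have "0 \<le> \<mu> A \<and> \<mu> A \<le> 1" for A
  proof
    show "0 \<le> \<mu> A" unfolding \<mu>_def using a by (intro sum_nonneg) auto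
    have "\<mu> A \<le> (\<Sum>x\<in>?S. (f x)\<^sup>2 / a)" unfolding \<mu>_def using a by (intro sum_mono) auto
    then show "\<mu> A \<le> 1" using tot by simp
  qed
  moreover have "\<mu> N = 1"
  proof -
    have "\<mu> N = (\<Sum>x\<in>?S. (f x)\<^sup>2 / a)" unfolding \<mu>_def using S \<pi>N by (intro sum.cong) auto
    then show ?thesis using tot by simp
  qed
  moreover have "\<mu> (A \<union> B) = \<mu> A + \<mu> B" if "A \<inter> B = {}" for A B
    unfolding \<mu>_def sum.distrib[symmetric] using that by (intro sum.cong) auto
  moreover have "\<bar>\<mu> (n <# A) - \<mu> A\<bar> \<le> sqrt (8 * \<eta>)" if n: "n \<in> E" and A: "A \<subseteq> N" for n A
  proof -
    have nN: "n \<in> N" and nG: "n \<in> carrier G" using n E N.mem_carrier by auto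
    define g where "g = shift n f"
    have g: "g \<in> fsupp (carrier G)" unfolding g_def using nG f by (intro shift_fsupp)
    let ?U = "?S \<union> {x. g x \<noteq> 0}"
    have U: "finite ?U" "?U \<subseteq> carrier G" using S g by (auto simp: fsupp_def)
    have mem: "\<pi> x \<in> n <# A \<longleftrightarrow> \<pi> (inv n \<otimes> x) \<in> A" if x: "x \<in> carrier G" for x
    proof -
      have "\<pi> (inv n \<otimes> x) = inv n \<otimes> \<pi> x" using \<pi>_equiv x nN by simp
      moreover have "\<pi> x \<in> n <# A \<longleftrightarrow> inv n \<otimes> \<pi> x \<in> A"
      proof
        assume "\<pi> x \<in> n <# A"
        then obtain b where b: "b \<in> A" "\<pi> x = n \<otimes> b" by (auto simp: l_coset_def)
        then have "inv n \<otimes> \<pi> x = b" using nG A by (simp add: m_assoc[symmetric] N.mem_carrier subset_iff)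
        with b show "inv n \<otimes> \<pi> x \<in> A" by simp
      next
        assume *: "inv n \<otimes> \<pi> x \<in> A"
        have "\<pi> x = n \<otimes> (inv n \<otimes> \<pi> x)" using nG \<pi>N[OF x] by (simp add: m_assoc[symmetric] N.mem_carrier)
        with * show "\<pi> x \<in> n <# A" unfolding l_coset_def by blast
      qed
      ultimately show ?thesis by simp
    qed
    have "\<mu> (n <# A) = (\<Sum>x\<in>?S. if \<pi> (inv n \<otimes> x) \<in> A then (f x)\<^sup>2 / a else 0)"
      unfolding \<mu>_def using S mem by (intro sum.cong) auto
    also have "\<dots> = (\<Sum>z | g z \<noteq> 0. if \<pi> z \<in> A then (g z)\<^sup>2 / a else 0)"
    proof (rule sum.reindex_bij_witness[of _ "\<lambda>z. n \<otimes> z" "\<lambda>x. inv n \<otimes> x"])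
      fix x assume "x \<in> ?S"
      then have x: "x \<in> carrier G" "f x \<noteq> 0" using S by auto
      then show "n \<otimes> (inv n \<otimes> x) = x" using nG by (simp add: m_assoc[symmetric])
      then have gx: "g (inv n \<otimes> x) = f x" using x nG by (simp add: g_def shift_def)
      with x show "inv n \<otimes> x \<in> {z. g z \<noteq> 0}" by simp
      show "(if \<pi> (inv n \<otimes> x) \<in> A then (g (inv n \<otimes> x))\<^sup>2 / a else 0)
          = (if \<pi> (inv n \<otimes> x) \<in> A then (f x)\<^sup>2 / a else 0)" using gx by simp
    next
      fix z assume "z \<in> {z. g z \<noteq> 0}"
      then have z: "z \<in> carrier G" "f (n \<otimes> z) \<noteq> 0" by (auto simp: g_def shift_def split: if_splits)
      then show "inv n \<otimes> (n \<otimes> z) = z" "n \<otimes> z \<in> ?S" using nG by (simp_all add: m_assoc[symmetric])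
    qed
    also have "\<dots> = (\<Sum>z\<in>?U. if \<pi> z \<in> A then (g z)\<^sup>2 / a else 0)"
      using U by (intro sum.mono_neutral_left) auto
    finally have 1: "\<mu> (n <# A) = (\<Sum>z\<in>?U. if \<pi> z \<in> A then (g z)\<^sup>2 / a else 0)" .
    have 2: "\<mu> A = (\<Sum>z\<in>?U. if \<pi> z \<in> A then (f z)\<^sup>2 / a else 0)"
      unfolding \<mu>_def using U by (intro sum.mono_neutral_left) auto
    have "\<mu> (n <# A) - \<mu> A = (\<Sum>z\<in>?U. if \<pi> z \<in> A then (g z)\<^sup>2 / a - (f z)\<^sup>2 / a else 0)"
      unfolding 1 2 sum_subtractf[symmetric] by (intro sum.cong) auto
    also have "\<bar>\<dots>\<bar> \<le> (\<Sum>z\<in>?U. \<bar>if \<pi> z \<in> A then (g z)\<^sup>2 / a - (f z)\<^sup>2 / a else 0\<bar>)"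
      by (rule sum_abs)
    also have "\<dots> \<le> (\<Sum>z\<in>?U. \<bar>g z - f z\<bar> * \<bar>g z + f z\<bar> / a)"
    proof (rule sum_mono)
      fix z
      have "(g z)\<^sup>2 - (f z)\<^sup>2 = (g z - f z) * (g z + f z)"
        by (simp add: power2_eq_square algebra_simps)
      then have "(g z)\<^sup>2 / a - (f z)\<^sup>2 / a = (g z - f z) * (g z + f z) / a"
        unfolding diff_divide_distrib[symmetric] by (simp only:)
      then show "\<bar>if \<pi> z \<in> A then (g z)\<^sup>2 / a - (f z)\<^sup>2 / a else 0\<bar> \<le> \<bar>g z - f z\<bar> * \<bar>g z + f z\<bar> / a"
        using a by (simp add: abs_mult)
    qed
    also have "\<dots> = (\<Sum>z\<in>?U. \<bar>g z - f z\<bar> * \<bar>g z + f z\<bar>) / a" by (simp add: sum_divide_distrib)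
    also have "\<dots> \<le> sqrt (8 * \<eta>)"
    proof -
      define c where "c = ip g f"
      have c: "(1 - \<eta>) * a \<le> c" using \<eta>(3)[OF n] by (simp add: c_def g_def a_def)
      have ff: "(\<Sum>z\<in>?U. (f z)\<^sup>2) = a"
        unfolding a_def power2_eq_square using f U by (subst ip_eq[OF f(1) U(1)]) auto
      have "ip g g = a" unfolding g_def a_def using nG f by (simp add: ip_shift)
      then have gg: "(\<Sum>z\<in>?U. (g z)\<^sup>2) = a"
        unfolding power2_eq_square using ip_eq[OF g U(1), of g] by auto
      have gf: "(\<Sum>z\<in>?U. g z * f z) = c" unfolding c_def using ip_eq[OF g U(1), of f] by auto
      have "(\<Sum>z\<in>?U. \<bar>g z - f z\<bar> * \<bar>g z + f z\<bar>)\<^sup>2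
          \<le> (\<Sum>z\<in>?U. \<bar>g z - f z\<bar>\<^sup>2) * (\<Sum>z\<in>?U. \<bar>g z + f z\<bar>\<^sup>2)"
        by (rule Cauchy_Schwarz_ineq_sum)
      also have "(\<Sum>z\<in>?U. \<bar>g z - f z\<bar>\<^sup>2) = 2 * a - 2 * c"
      proof -
        have "(\<Sum>z\<in>?U. \<bar>g z - f z\<bar>\<^sup>2) = (\<Sum>z\<in>?U. (g z)\<^sup>2 + (f z)\<^sup>2 - 2 * (g z * f z))"
          by (intro sum.cong) (auto simp: power2_diff)
        then show ?thesis
          unfolding sum_subtractf sum.distrib sum_distrib_left[symmetric] ff gg gf by simp
      qed
      also have "(\<Sum>z\<in>?U. \<bar>g z + f z\<bar>\<^sup>2) = 2 * a + 2 * c"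
      proof -
        have "(\<Sum>z\<in>?U. \<bar>g z + f z\<bar>\<^sup>2) = (\<Sum>z\<in>?U. (g z)\<^sup>2 + (f z)\<^sup>2 + 2 * (g z * f z))"
          by (intro sum.cong) (auto simp: power2_sum)
        then show ?thesis
          unfolding sum.distrib sum_distrib_left[symmetric] ff gg gf by simp
      qed
      \<comment> \<open>From c \<ge> (1 - \<eta>) a \<ge> 0 it follows that a^2 - c^2 is at most 2
        \<eta> a^2, whence the constant 8.\<close>
      also have "(2 * a - 2 * c) * (2 * a + 2 * c) = 4 * (a\<^sup>2 - c\<^sup>2)"
        by (simp add: power2_eq_square algebra_simps)
      also have "\<dots> \<le> 8 * \<eta> * a\<^sup>2"
      proof -
        have "((1 - \<eta>) * a)\<^sup>2 \<le> c\<^sup>2" using c \<eta> a by (intro power_mono) auto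
        then have "a\<^sup>2 - c\<^sup>2 \<le> 2 * (\<eta> * a\<^sup>2) - (\<eta> * a)\<^sup>2"
          by (simp add: power2_eq_square algebra_simps)
        moreover have "u \<le> 2 * v - d \<Longrightarrow> 0 \<le> d \<Longrightarrow> 4 * u \<le> 8 * v" for u v d :: real by linarith
        ultimately have "4 * (a\<^sup>2 - c\<^sup>2) \<le> 8 * (\<eta> * a\<^sup>2)" using zero_le_power2 by blast
        then show ?thesis by (simp only: mult.assoc)
      qed
      finally have "(\<Sum>z\<in>?U. \<bar>g z - f z\<bar> * \<bar>g z + f z\<bar>) \<le> sqrt (8 * \<eta> * a\<^sup>2)" by (rule real_le_rsqrt)
      also have "\<dots> = sqrt (8 * \<eta>) * a" using a by (simp add: real_sqrt_mult)
      finally show ?thesis using a by (simp add: pos_divide_le_eq)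
    qed
    finally show ?thesis .
  qed
  ultimately show ?thesis by (intro exI[of _ \<mu>]) simp
qed

text \<open>Reiter's condition yields an invariant mean by compactness of the cube of all set functions
  with values in the unit interval.\<close>
lemma (in group) amenable_of_almost_invariant_vectors:
  assumes N: "subgroup N G"
    and ai: "\<And>E \<eta>. finite E \<Longrightarrow> E \<subseteq> N \<Longrightarrow> 0 < \<eta> \<Longrightarrow>
      \<exists>f\<in>fsupp (carrier G). 0 < ip f f \<and> (\<forall>n\<in>E. (1 - \<eta>) * ip f f \<le> ip (shift n f) f)"
  shows "amenable (G\<lparr>carrier := N\<rparr>)"
proof -
  define K :: "('a set \<Rightarrow> real) set" where "K = PiE UNIV (\<lambda>_. {0..1})"
  have "compactin (product_topology (\<lambda>_. euclideanreal) UNIV) K"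
    unfolding K_def compactin_PiE by simp
  then have K: "compact K"
    unfolding euclidean_product_topology by simp
  define add where "add = {\<mu> :: 'a set \<Rightarrow> real. \<mu> N = 1 \<and> (\<forall>A B. A \<inter> B = {} \<longrightarrow> \<mu> (A \<union> B) = \<mu> A + \<mu> B)}"
  \<comment> \<open>A pair (n, \<epsilon>) stands for invariance under n up to \<epsilon>. The
    finite intersection property asks for only finitely many such conditions at a time.\<close>
  define C where "C p = add \<inter> {\<mu>. \<forall>A. A \<subseteq> N \<longrightarrow> \<bar>\<mu> (fst p <# A) - \<mu> A\<bar> \<le> snd p}" for p :: "'a \<times> real"
  have "add = {\<mu>. \<mu> N = 1} \<inter> (\<Inter>A. \<Inter>B. {\<mu>. A \<inter> B = {} \<longrightarrow> \<mu> (A \<union> B) = \<mu> A + \<mu> B})"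
    by (auto simp: add_def)
  also have "closed \<dots>"
    by (intro closed_Int closed_INT ballI closed_Collect_imp closed_Collect_eq continuous_intros) auto
  finally have "closed add" .
  have C: "closed (C p)" for p
  proof -
    have "{\<mu>. \<forall>A. A \<subseteq> N \<longrightarrow> \<bar>\<mu> (fst p <# A) - \<mu> A\<bar> \<le> snd p}
        = (\<Inter>A\<in>Pow N. {\<mu>. \<bar>\<mu> (fst p <# A) - \<mu> A\<bar> \<le> snd p})" by auto
    also have "closed \<dots>"
      by (intro closed_INT ballI closed_Collect_le continuous_intros) auto
    finally show ?thesis unfolding C_def using \<open>closed add\<close> by (intro closed_Int)
  qed
  have "K \<inter> (\<Inter>p\<in>N \<times> {0<..}. C p) \<noteq> {}"
  proof (rule compact_imp_fip_image[OF K C])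
    fix I assume I: "finite I" "I \<subseteq> N \<times> {0::real<..}"
    define E where "E = fst ` I"
    define \<epsilon> where "\<epsilon> = Min (insert 1 (snd ` I))"
    have \<epsilon>: "\<epsilon> > 0" unfolding \<epsilon>_def using I by (subst Min_gr_iff) auto
    have \<epsilon>1: "\<epsilon> \<le> 1" and \<epsilon>I: "\<And>p. p \<in> I \<Longrightarrow> \<epsilon> \<le> snd p" unfolding \<epsilon>_def using I by auto
    \<comment> \<open>\<open>approximate_mean\<close> has the error sqrt (8 \<eta>), which is
      \<epsilon> for this \<eta>. The 1 inserted into the minimum covers an empty I and ensures
      \<eta> \<le> 1.\<close>
    have \<eta>: "\<epsilon>\<^sup>2 / 8 > 0" "\<epsilon>\<^sup>2 / 8 \<le> 1" using \<epsilon> power_mono[OF \<epsilon>1, of 2] by auto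
    have E: "finite E" "E \<subseteq> N" using I by (auto simp: E_def)
    from ai[OF E \<eta>(1)] obtain f where f: "f \<in> fsupp (carrier G)" "0 < ip f f"
      "\<And>n. n \<in> E \<Longrightarrow> (1 - \<epsilon>\<^sup>2 / 8) * ip f f \<le> ip (shift n f) f" by blast
    have "\<exists>\<mu> :: 'a set \<Rightarrow> real. (\<forall>A. 0 \<le> \<mu> A \<and> \<mu> A \<le> 1) \<and> \<mu> N = 1 \<and>
        (\<forall>A B. A \<inter> B = {} \<longrightarrow> \<mu> (A \<union> B) = \<mu> A + \<mu> B) \<and>
        (\<forall>n\<in>E. \<forall>A\<subseteq>N. \<bar>\<mu> (n <# A) - \<mu> A\<bar> \<le> sqrt (8 * (\<epsilon>\<^sup>2 / 8)))"
      using N E(2) f \<eta> by (intro approximate_mean) auto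
    then obtain \<mu> :: "'a set \<Rightarrow> real" where \<mu>: "\<And>A. 0 \<le> \<mu> A \<and> \<mu> A \<le> 1" "\<mu> N = 1"
        "\<And>A B. A \<inter> B = {} \<Longrightarrow> \<mu> (A \<union> B) = \<mu> A + \<mu> B"
        "\<And>n A. n \<in> E \<Longrightarrow> A \<subseteq> N \<Longrightarrow> \<bar>\<mu> (n <# A) - \<mu> A\<bar> \<le> sqrt (8 * (\<epsilon>\<^sup>2 / 8))" by metis
    have "\<mu> \<in> K" using \<mu>(1) by (auto simp: K_def)
    moreover have "\<mu> \<in> C p" if p: "p \<in> I" for p
    proof -
      have "\<bar>\<mu> (fst p <# A) - \<mu> A\<bar> \<le> snd p" if "A \<subseteq> N" for A
        using \<mu>(4)[of "fst p" A] that p \<epsilon> \<epsilon>I[OF p] by (auto simp: E_def)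
      then show ?thesis using \<mu>(2,3) by (auto simp: C_def add_def)
    qed
    ultimately show "K \<inter> (\<Inter>p\<in>I. C p) \<noteq> {}" by blast
  qed
  then obtain \<mu> where \<mu>: "\<mu> \<in> K" "\<And>p. p \<in> N \<times> {0<..} \<Longrightarrow> \<mu> \<in> C p" by blast
  have "\<one> \<in> N" using N by (simp add: subgroup.one_closed)
  then have "\<mu> \<in> add" using \<mu>(2)[of "(\<one>, 1)"] by (simp add: C_def)
  have inv: "\<mu> (g <# A) = \<mu> A" if "g \<in> N" "A \<subseteq> N" for g A
  proof -
    have "\<bar>\<mu> (g <# A) - \<mu> A\<bar> \<le> 0 + \<epsilon>" if "\<epsilon> > 0" for \<epsilon>
      using \<mu>(2)[of "(g, \<epsilon>)"] \<open>g \<in> N\<close> \<open>A \<subseteq> N\<close> that by (simp add: C_def)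
    then have "\<bar>\<mu> (g <# A) - \<mu> A\<bar> \<le> 0" by (rule field_le_epsilon)
    then show ?thesis by simp
  qed
  have "g <#\<^bsub>G\<lparr>carrier := N\<rparr>\<^esub> A = g <# A" for g A by (simp add: l_coset_def)
  then show ?thesis
    unfolding amenable_def using \<mu>(1) \<open>\<mu> \<in> add\<close> inv
    by (intro exI[of _ \<mu>]) (auto simp: K_def add_def PiE_iff)
qed

section \<open>Norms on the fibres of a homomorphism\<close>

definition fibre_norm :: "('a \<Rightarrow> 'c) \<Rightarrow> ('a \<Rightarrow> real) \<Rightarrow> 'c \<Rightarrow> real" where
  "fibre_norm \<phi> f y = sqrt (\<Sum>x | f x \<noteq> 0 \<and> \<phi> x = y. (f x)\<^sup>2)"

lemma fibre_norm_nonneg: "0 \<le> fibre_norm \<phi> f y"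
  by (simp add: fibre_norm_def sum_nonneg)

lemma fibre_norm_fsupp:
  assumes "f \<in> fsupp X" "\<phi> ` X \<subseteq> Y" shows "fibre_norm \<phi> f \<in> fsupp Y"
proof (rule fsuppI[of "\<phi> ` {x. f x \<noteq> 0}"])
  fix y assume "fibre_norm \<phi> f y \<noteq> 0"
  then have "{x. f x \<noteq> 0 \<and> \<phi> x = y} \<noteq> {}" unfolding fibre_norm_def by force
  then show "y \<in> \<phi> ` {x. f x \<noteq> 0}" by auto
qed (use assms in \<open>auto simp: fsupp_def\<close>)

lemma ip_fibre_norm:
  assumes "f \<in> fsupp X" shows "ip (fibre_norm \<phi> f) (fibre_norm \<phi> f) = ip f f"
proof -
  let ?S = "{x. f x \<noteq> 0}"
  have S: "finite ?S" using assms by (rule fsupp_finite)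
  have "ip (fibre_norm \<phi> f) (fibre_norm \<phi> f) = (\<Sum>y\<in>\<phi> ` ?S. fibre_norm \<phi> f y * fibre_norm \<phi> f y)"
  proof (rule ip_eq[OF fibre_norm_fsupp[OF assms, of \<phi> UNIV]])
    fix y assume "fibre_norm \<phi> f y \<noteq> 0"
    then have "{x. f x \<noteq> 0 \<and> \<phi> x = y} \<noteq> {}" unfolding fibre_norm_def by force
    then show "y \<in> \<phi> ` ?S" by auto
  qed (use S in auto)
  also have "\<dots> = (\<Sum>y\<in>\<phi> ` ?S. \<Sum>x | x \<in> ?S \<and> \<phi> x = y. f x * f x)"
    by (intro sum.cong) (auto simp: fibre_norm_def sum_nonneg power2_eq_square)
  also have "\<dots> = ip f f" unfolding ip_def using S by (rule sum.image_gen[symmetric])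
  finally show ?thesis .
qed

text \<open>Multiplication by g maps the fibre over y injectively into the fibre over \<phi> g y. So
  Cauchy-Schwarz on the fibre over y bounds its contribution by the product of two fibre
  norms.\<close>

lemma ip_shift_le_fibre_norm:
  assumes G: "group G" and H: "group H" and \<phi>: "\<phi> \<in> hom G H"
    and f: "f \<in> fsupp (carrier G)" and g: "g \<in> carrier G"
  shows "ip (group.shift G g f) f \<le> ip (group.shift H (\<phi> g) (fibre_norm \<phi> f)) (fibre_norm \<phi> f)"
proof -
  interpret G: group G by (rule G)
  interpret H: group H by (rule H)
  let ?S = "{x. f x \<noteq> 0}" and ?F = "fibre_norm \<phi> f"
  let ?fib = "\<lambda>y. {x. x \<in> ?S \<and> \<phi> x = y}"
  have S: "finite ?S" "?S \<subseteq> carrier G" using f by (auto simp: fsupp_def)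
  have \<phi>c: "\<phi> ` carrier G \<subseteq> carrier H" using \<phi> by (auto simp: hom_def)
  have F: "?F \<in> fsupp (carrier H)" by (rule fibre_norm_fsupp[OF f \<phi>c])
  have "ip (G.shift g f) f = (\<Sum>x\<in>?S. G.shift g f x * f x)"
    using S by (intro ip_eq[OF G.shift_fsupp[OF g f]]) auto
  also have "\<dots> = (\<Sum>y\<in>\<phi> ` ?S. \<Sum>x\<in>?fib y. G.shift g f x * f x)"
    using S(1) by (rule sum.image_gen)
  also have "\<dots> \<le> (\<Sum>y\<in>\<phi> ` ?S. H.shift (\<phi> g) ?F y * ?F y)"
  proof (rule sum_mono)
    fix y assume "y \<in> \<phi> ` ?S"
    then have y: "y \<in> carrier H" using S \<phi>c by auto
    have fin: "finite (?fib z)" for z using S by auto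
    have "(\<Sum>x\<in>?fib y. G.shift g f x * f x)\<^sup>2
        \<le> (\<Sum>x\<in>?fib y. (G.shift g f x)\<^sup>2) * (\<Sum>x\<in>?fib y. (f x)\<^sup>2)"
      by (rule Cauchy_Schwarz_ineq_sum)
    then have "(\<Sum>x\<in>?fib y. G.shift g f x * f x)
        \<le> sqrt ((\<Sum>x\<in>?fib y. (G.shift g f x)\<^sup>2) * (\<Sum>x\<in>?fib y. (f x)\<^sup>2))"
      by (rule real_le_rsqrt)
    also have "\<dots> = sqrt (\<Sum>x\<in>?fib y. (G.shift g f x)\<^sup>2) * ?F y"
      by (simp add: real_sqrt_mult fibre_norm_def)
    also have "\<dots> \<le> ?F (\<phi> g \<otimes>\<^bsub>H\<^esub> y) * ?F y"
    proof (intro mult_right_mono fibre_norm_nonneg)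
      have inj: "inj_on (\<lambda>x. g \<otimes>\<^bsub>G\<^esub> x) (?fib y)"
      proof (rule inj_onI)
        fix x z assume "x \<in> ?fib y" "z \<in> ?fib y" "g \<otimes>\<^bsub>G\<^esub> x = g \<otimes>\<^bsub>G\<^esub> z"
        moreover from this have "x \<in> carrier G" "z \<in> carrier G" using S by auto
        ultimately show "x = z" using g by simp
      qed
      have "(\<Sum>x\<in>?fib y. (G.shift g f x)\<^sup>2) = (\<Sum>x\<in>?fib y. (f (g \<otimes>\<^bsub>G\<^esub> x))\<^sup>2)"
        using S by (intro sum.cong) (auto simp: G.shift_def)
      also have "\<dots> = (\<Sum>z\<in>(\<lambda>x. g \<otimes>\<^bsub>G\<^esub> x) ` ?fib y. (f z)\<^sup>2)"
        by (rule sum.reindex[OF inj, unfolded o_def, symmetric])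
      also have "\<dots> = (\<Sum>z\<in>(\<lambda>x. g \<otimes>\<^bsub>G\<^esub> x) ` ?fib y \<inter> ?S. (f z)\<^sup>2)"
        using fin by (intro sum.mono_neutral_right) auto
      also have "\<dots> \<le> (\<Sum>z\<in>?fib (\<phi> g \<otimes>\<^bsub>H\<^esub> y). (f z)\<^sup>2)"
      proof (rule sum_mono2[OF fin])
        show "(\<lambda>x. g \<otimes>\<^bsub>G\<^esub> x) ` ?fib y \<inter> ?S \<subseteq> ?fib (\<phi> g \<otimes>\<^bsub>H\<^esub> y)"
          using S g hom_mult[OF \<phi> g] by auto
      qed auto
      finally show "sqrt (\<Sum>x\<in>?fib y. (G.shift g f x)\<^sup>2) \<le> ?F (\<phi> g \<otimes>\<^bsub>H\<^esub> y)"
        unfolding fibre_norm_def by (simp add: real_sqrt_le_mono)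
    qed
    also have "?F (\<phi> g \<otimes>\<^bsub>H\<^esub> y) = H.shift (\<phi> g) ?F y" using y by (simp add: H.shift_def)
    finally show "(\<Sum>x\<in>?fib y. G.shift g f x * f x) \<le> H.shift (\<phi> g) ?F y * ?F y" .
  qed
  also have "\<dots> = ip (H.shift (\<phi> g) ?F) ?F"
  proof (rule ip_eq[symmetric])
    show "H.shift (\<phi> g) ?F \<in> fsupp (carrier H)" using F g \<phi>c by (intro H.shift_fsupp) auto
    fix y assume "?F y \<noteq> 0"
    then have "{x. f x \<noteq> 0 \<and> \<phi> x = y} \<noteq> {}" unfolding fibre_norm_def by force
    then show "y \<in> \<phi> ` ?S" by auto
  qed (use S in auto)
  finally show ?thesis .
qed

section \<open>Kesten's theorem\<close>

lemma word_val_append: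
  assumes "group G" "\<sigma> ` {..<k} \<subseteq> carrier G" "u \<in> lists {..<k}" "v \<in> lists {..<k}"
  shows "word_val G \<sigma> (u @ v) = word_val G \<sigma> u \<otimes>\<^bsub>G\<^esub> word_val G \<sigma> v"
proof -
  interpret group G by (rule assms(1))
  have cl: "w \<in> lists {..<k} \<Longrightarrow> word_val G \<sigma> w \<in> carrier G" for w
    using assms(2) by (induction w) auto
  show ?thesis using assms(3)
  proof (induction u)
    case (Cons i u)
    then have "\<sigma> i \<in> carrier G" using assms(2) by auto
    with Cons show ?case using cl assms(4) by (simp add: m_assoc)
  qed (simp add: cl assms(4))
qed

context symmetric_walk
begin

section \<open>Return probabilities and the spectral radius\<close>

lemma return_prob_le_1: "return_prob G k \<sigma> n \<le> 1"
proof -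
  have "{w \<in> lists {..<k}. length w = n \<and> word_val G \<sigma> w = \<one>} \<subseteq> words k n" by (auto simp: words_def)
  then have "card {w \<in> lists {..<k}. length w = n \<and> word_val G \<sigma> w = \<one>} \<le> k ^ n"
    using card_mono[OF finite_words] by (metis card_words)
  then show ?thesis
    using k_pos by (simp add: return_prob_def divide_le_eq_1 flip: of_nat_power)
qed

text \<open>Two returning words concatenate to a returning word, and the fixed lengths determine
  where to split it.\<close>

lemma return_prob_mult: "return_prob G k \<sigma> m * return_prob G k \<sigma> n \<le> return_prob G k \<sigma> (m + n)"
proof -
  define A where "A n = {w \<in> lists {..<k}. length w = n \<and> word_val G \<sigma> w = \<one>}" for n
  have fin: "finite (A n)" for n
    by (rule finite_subset[OF _ finite_words[of k n]]) (auto simp: A_def words_def)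
  have "inj_on (\<lambda>(u, v). u @ v) (A m \<times> A n)" by (auto simp: inj_on_def A_def)
  moreover have "(\<lambda>(u, v). u @ v) ` (A m \<times> A n) \<subseteq> A (m + n)"
  proof clarify
    fix u v assume "u \<in> A m" "v \<in> A n"
    moreover from this have "word_val G \<sigma> (u @ v) = word_val G \<sigma> u \<otimes> word_val G \<sigma> v"
      using \<sigma>_closed by (intro word_val_append[of _ _ k]) (auto simp: A_def is_group)
    ultimately show "u @ v \<in> A (m + n)" by (auto simp: A_def)
  qed
  ultimately have "card (A m) * card (A n) \<le> card (A (m + n))"
    using card_inj_on_le[of _ "A m \<times> A n" "A (m + n)"] fin by (simp add: card_cartesian_product)
  then have "real (card (A m)) * real (card (A n)) \<le> real (card (A (m + n)))"
    by (metis of_nat_le_iff of_nat_mult)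
  then show ?thesis
    unfolding return_prob_def A_def[symmetric] using k_pos by (simp add: power_add divide_right_mono)
qed

lemma return_prob_power: "return_prob G k \<sigma> n ^ j \<le> return_prob G k \<sigma> (n * j)"
proof (induction j)
  case 0
  have "{w \<in> lists {..<k}. length w = 0 \<and> word_val G \<sigma> w = \<one>} = {[]}" by auto
  then show ?case by (simp add: return_prob_def)
next
  case (Suc j)
  have "return_prob G k \<sigma> n ^ Suc j \<le> return_prob G k \<sigma> n * return_prob G k \<sigma> (n * j)"
    using Suc return_prob_nonneg by (simp add: mult_left_mono)
  also have "\<dots> \<le> return_prob G k \<sigma> (n * Suc j)" using return_prob_mult[of n "n * j"] by simp
  finally show ?case .
qed

lemma limsup_return_prob:
  "limsup (\<lambda>n. ereal (root n (return_prob G k \<sigma> n))) = ereal (spectral_radius G k \<sigma>)"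
  and spectral_radius_nonneg: "0 \<le> spectral_radius G k \<sigma>"
  and spectral_radius_le_1: "spectral_radius G k \<sigma> \<le> 1"
proof -
  let ?L = "limsup (\<lambda>n. ereal (root n (return_prob G k \<sigma> n)))"
  have r: "0 \<le> root n (return_prob G k \<sigma> n) \<and> root n (return_prob G k \<sigma> n) \<le> 1" for n
    using return_prob_nonneg return_prob_le_1 by (cases "n = 0") (simp_all add: real_root_ge_zero)
  have "?L \<le> ereal 1" using r by (intro Limsup_bounded always_eventually) auto
  moreover have "ereal 0 \<le> ?L" using r by (intro le_Limsup always_eventually) auto
  ultimately show "?L = ereal (spectral_radius G k \<sigma>)" "0 \<le> spectral_radius G k \<sigma>"
    "spectral_radius G k \<sigma> \<le> 1"
    unfolding spectral_radius_def by (cases ?L; simp)+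
qed

text \<open>By supermultiplicativity the roots at the multiples of n are at least the root at n, and
  the limsup over all lengths is at least the limsup over these multiples.\<close>

lemma return_prob_le_spectral_radius:
  "return_prob G k \<sigma> n \<le> spectral_radius G k \<sigma> ^ n"
proof (cases "n = 0")
  case True
  then show ?thesis using return_prob_le_1[of 0] by simp
next
  case False
  let ?p = "return_prob G k \<sigma>" and ?X = "\<lambda>n. ereal (root n (return_prob G k \<sigma> n))"
  let ?r = "\<lambda>j. n * Suc j"
  have "root n (?p n) \<le> root (?r j) (?p (?r j))" for j
  proof -
    have "root n (?p n) = root (?r j) (?p n ^ Suc j)"
      using False return_prob_nonneg[of n]
      by (simp only: real_root_mult_exp real_root_power_cancel real_root_power zero_less_Suc) 
    also have "\<dots> \<le> root (?r j) (?p (?r j))"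
      using False return_prob_power[of n "Suc j"] by (intro real_root_le_mono) auto
    finally show ?thesis .
  qed
  then have "ereal (root n (?p n)) \<le> limsup (?X \<circ> ?r)"
    by (intro le_Limsup always_eventually) auto
  also have "\<dots> \<le> limsup ?X"
    using False by (intro limsup_subseq_mono) (auto simp: strict_mono_def)
  finally have "root n (?p n) \<le> spectral_radius G k \<sigma>"
    unfolding limsup_return_prob by simp
  then have "root n (?p n) ^ n \<le> spectral_radius G k \<sigma> ^ n"
    using False return_prob_nonneg by (intro power_mono) (auto simp: real_root_ge_zero)
  then show ?thesis using False return_prob_nonneg by simp
qed

lemma spectral_radius_sharp:
  assumes "0 \<le> \<beta>" "\<beta> < spectral_radius G k \<sigma>"
  shows "\<exists>n. \<beta> ^ n < return_prob G k \<sigma> n"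
proof (rule ccontr)
  assume "\<not> ?thesis"
  then have le: "return_prob G k \<sigma> n \<le> \<beta> ^ n" for n by (meson not_le)
  have "root n (return_prob G k \<sigma> n) \<le> \<beta>" for n
  proof (cases "n = 0")
    case False
    then have "root n (return_prob G k \<sigma> n) \<le> root n (\<beta> ^ n)" using le by (intro real_root_le_mono) auto
    also have "\<dots> = \<beta>" using False assms(1) by (simp add: real_root_power_cancel)
    finally show ?thesis .
  qed (use assms in simp)
  then have "limsup (\<lambda>n. ereal (root n (return_prob G k \<sigma> n))) \<le> ereal \<beta>"
    by (intro Limsup_bounded always_eventually) auto
  then show False using assms(2) unfolding limsup_return_prob by simp
qed

text \<open>A letter followed by its inverse returns, so the return probability at length 2 is
  positive.\<close>

lemma spectral_radius_pos: "0 < spectral_radius G k \<sigma>"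
proof -
  let ?A = "{w \<in> lists {..<k}. length w = 2 \<and> word_val G \<sigma> w = \<one>}"
  have "\<iota> 0 < k" using \<iota>_bij k_pos by (auto simp: bij_betw_def)
  then have "[0, \<iota> 0] \<in> ?A" using k_pos \<sigma>_\<iota>[of 0] \<sigma>_closed[of 0] by simp
  moreover have "finite ?A"
    by (rule finite_subset[OF _ finite_words[of k 2]]) (auto simp: words_def)
  ultimately have "card ?A > 0" unfolding card_gt_0_iff by blast
  then have "return_prob G k \<sigma> 2 > 0" using k_pos by (simp add: return_prob_def)
  then have "spectral_radius G k \<sigma> ^ 2 > 0" using return_prob_le_spectral_radius[of 2] by linarith
  then show ?thesis using spectral_radius_nonneg by (simp add: order_less_le)
qed

end

lemma word_val_hom:
  assumes "\<phi> \<in> hom G H" "group G" "group H" "\<sigma> ` {..<k} \<subseteq> carrier G" "\<And>i. i < k \<Longrightarrow> \<tau> i = \<phi> (\<sigma> i)"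
    and "w \<in> lists {..<k}"
  shows "word_val H \<tau> w = \<phi> (word_val G \<sigma> w)"
proof -
  interpret group_hom G H \<phi> using assms by (simp add: group_hom_def group_hom_axioms_def)
  have cl: "w \<in> lists {..<k} \<Longrightarrow> word_val G \<sigma> w \<in> carrier G" for w
    using assms(4) by (induction w) auto
  show ?thesis using assms(6)
  proof (induction w)
    case (Cons i w)
    then have "\<sigma> i \<in> carrier G" using assms(4) by auto
    with Cons cl show ?case by (simp add: assms(5))
  qed simp
qed

text \<open>An element of the kernel moves no fibre, so for a near-optimal vector \<open>f\<close> the comparison with the
  vector of its fibre norms loses exactly \<open>\<langle>f, f\<rangle> - \<langle>n f, f\<rangle>\<close> at \<open>n\<close>, which is therefore small.\<close>
lemma almost_invariant_vectors:
  assumes A: "symmetric_walk G k \<sigma> \<iota>" and B: "symmetric_walk H k \<tau> \<iota>"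
    and \<phi>: "\<phi> \<in> hom G H" "\<And>i. i < k \<Longrightarrow> \<tau> i = \<phi> (\<sigma> i)"
    and H: "\<And>n. return_prob H k \<tau> n \<le> spectral_radius G k \<sigma> ^ n"
    and E: "finite E" "\<And>g. g \<in> E \<Longrightarrow> \<exists>w\<in>lists {..<k}. word_val G \<sigma> w = g \<and> \<phi> g = \<one>\<^bsub>H\<^esub>"
    and \<eta>: "0 < \<eta>"
  shows "\<exists>f\<in>fsupp (carrier G). 0 < ip f f \<and> (\<forall>g\<in>E. (1 - \<eta>) * ip f f \<le> ip (group.shift G g f) f)"
proof -
  interpret A: symmetric_walk G k \<sigma> \<iota> by (rule A)
  interpret B: symmetric_walk H k \<tau> \<iota> by (rule B)
  define \<rho> where "\<rho> = spectral_radius G k \<sigma>"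
  have \<rho>: "0 < \<rho>" "\<rho> \<le> 1"
    using A.spectral_radius_pos A.spectral_radius_le_1 by (auto simp: \<rho>_def)
  obtain w where w: "\<And>g. g \<in> E \<Longrightarrow> w g \<in> lists {..<k} \<and> word_val G \<sigma> (w g) = g \<and> \<phi> g = \<one>\<^bsub>H\<^esub>"
    using E(2) by metis
  \<comment> \<open>Isolating one word of length n in an average costs the factor k^n, and n
    applications of \<open>avg\<close> cost n errors of size \<delta>. M bounds this product for all
    elements of E at once.\<close>
  define M where "M = (\<Sum>g\<in>E. real k ^ length (w g) * real (length (w g)))"
  have M: "0 \<le> M" "\<And>g. g \<in> E \<Longrightarrow> real k ^ length (w g) * real (length (w g)) \<le> M"
    unfolding M_def using E(1) by (auto intro!: sum_nonneg member_le_sum)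
  define \<delta> where "\<delta> = \<eta> / (1 + M)"
  have \<delta>: "0 < \<delta>" "M * \<delta> \<le> \<eta>"
    using M(1) \<eta> by (auto simp: \<delta>_def field_simps add_pos_nonneg)
  \<comment> \<open>The first bound keeps \<rho> - \<epsilon> nonnegative, as
    \<open>spectral_radius_sharp\<close> requires. The second makes sqrt (2 \<rho> \<epsilon>) at
    most \<delta>, because \<rho> \<le> 1.\<close>
  define \<epsilon> where "\<epsilon> = min \<rho> (\<delta>\<^sup>2 / 2)"
  have \<epsilon>: "0 < \<epsilon>" "\<epsilon> \<le> \<rho>" "\<epsilon> \<le> \<delta>\<^sup>2 / 2" using \<rho> \<delta> by (auto simp: \<epsilon>_def)
  have sq: "sqrt (2 * \<rho> * \<epsilon>) \<le> \<delta>"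
  proof (rule real_le_lsqrt)
    have "2 * \<rho> * \<epsilon> \<le> 2 * 1 * (\<delta>\<^sup>2 / 2)" using \<rho> \<epsilon> by (intro mult_mono) auto
    then show "2 * \<rho> * \<epsilon> \<le> \<delta>\<^sup>2" by simp
  qed (use \<rho> \<epsilon> \<delta> in auto)
  obtain n\<^sub>0 where "(\<rho> - \<epsilon>) ^ n\<^sub>0 < return_prob G k \<sigma> n\<^sub>0"
    using A.spectral_radius_sharp[of "\<rho> - \<epsilon>"] \<epsilon> by (auto simp: \<rho>_def)
  then obtain f where f: "f \<in> fsupp (carrier G)" and big: "(\<rho> - \<epsilon>) * ip f f < ip (A.avg f) f"
    using A.return_prob_le_of_numerical_radius[of "\<rho> - \<epsilon>" n\<^sub>0] \<epsilon> by (force simp: not_le)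
  have a: "0 < ip f f"
  proof (rule ccontr)
    assume "\<not> 0 < ip f f"
    then have "ip f f = 0" and "ip (A.avg f) f = 0"
      using ip_self_pos[OF f] ip_self_nonneg[of f] by (auto simp: order_less_le)
    then show False using big by simp
  qed
  have normA: "ip (A.avg f) (A.avg f) \<le> \<rho>\<^sup>2 * ip f f" if "f \<in> fsupp (carrier G)" for f
    using A.avg_norm_bound[OF _ _ that, of \<rho>] \<rho> A.return_prob_le_spectral_radius by (simp add: \<rho>_def)
  have normB: "ip (B.avg f) (B.avg f) \<le> \<rho>\<^sup>2 * ip f f" if "f \<in> fsupp (carrier H)" for f
    using B.avg_norm_bound[OF _ _ that, of \<rho>] \<rho> H by (simp add: \<rho>_def)
  let ?F = "fibre_norm \<phi> f"
  have F: "?F \<in> fsupp (carrier H)"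
    using f \<phi>(1) by (intro fibre_norm_fsupp) (auto simp: hom_def)
  have FF: "ip ?F ?F = ip f f" by (rule ip_fibre_norm[OF f])
  have "(1 - \<eta>) * ip f f \<le> ip (A.shift g f) f" if g: "g \<in> E" for g
  proof -
    let ?n = "length (w g)"
    have wg: "w g \<in> words k ?n" "word_val G \<sigma> (w g) = g" "\<phi> g = \<one>\<^bsub>H\<^esub>"
      using w[OF g] by (auto simp: words_def)
    have low: "(\<rho> ^ ?n - real ?n * sqrt (2 * \<rho> * \<epsilon>)) * ip f f \<le> ip ((A.avg ^^ ?n) f) f"
      using \<rho> \<epsilon> normA f big by (intro A.almost_eigenvector_powers) auto
    have "real ?n * sqrt (2 * \<rho> * \<epsilon>) \<le> real ?n * \<delta>" using sq by (intro mult_left_mono) auto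
    then have "(\<rho> ^ ?n - real ?n * \<delta>) * ip f f \<le> (\<rho> ^ ?n - real ?n * sqrt (2 * \<rho> * \<epsilon>)) * ip f f"
      using a by (intro mult_right_mono) auto
    with low have low: "(\<rho> ^ ?n - real ?n * \<delta>) * ip f f \<le> ip ((A.avg ^^ ?n) f) f" by linarith
    have "ip ((B.avg ^^ ?n) ?F) ?F \<le> sqrt (ip ((B.avg ^^ ?n) ?F) ((B.avg ^^ ?n) ?F)) * sqrt (ip ?F ?F)"
      using ip_cauchy_schwarz_sqrt[OF B.avg_pow_fsupp[OF F] F, of ?n] by linarith
    also have "\<dots> \<le> (\<rho> ^ ?n * sqrt (ip ?F ?F)) * sqrt (ip ?F ?F)"
      using \<rho> normB F by (intro mult_right_mono B.avg_pow_norm_bound) (auto simp: ip_self_nonneg)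
    also have "\<dots> = \<rho> ^ ?n * ip f f" using a by (simp add: FF)
    finally have up: "ip ((B.avg ^^ ?n) ?F) ?F \<le> \<rho> ^ ?n * ip f f" .
    let ?d = "\<lambda>u. ip (B.shift (word_val H \<tau> u) ?F) ?F - ip (A.shift (word_val G \<sigma> u) f) f"
    have "?d u \<ge> 0" if "u \<in> words k ?n" for u
    proof -
      have u: "u \<in> lists {..<k}" using that by (simp add: words_def)
      have "word_val H \<tau> u = \<phi> (word_val G \<sigma> u)"
        using \<phi> A.is_group B.is_group A.\<sigma>_closed u by (intro word_val_hom) auto
      then show ?thesis
        using ip_shift_le_fibre_norm[OF A.is_group B.is_group \<phi>(1) f A.word_val_closed[OF u]] by simp
    qed
    \<comment> \<open>The increases at the other words are nonnegative and may be added; the sum is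
      then a difference of two averages.\<close>
    then have "?d (w g) \<le> (\<Sum>u\<in>words k ?n. ?d u)"
      using wg(1) finite_words by (intro member_le_sum) auto
    also have "\<dots> = real k ^ ?n * (ip ((B.avg ^^ ?n) ?F) ?F - ip ((A.avg ^^ ?n) f) f)"
      using A.k_pos by (simp add: A.ip_avg_pow[OF f] B.ip_avg_pow[OF F] sum_subtractf right_diff_distrib)
    also have "\<dots> \<le> real k ^ ?n * (real ?n * \<delta> * ip f f)"
      using low up by (intro mult_left_mono) (auto simp: algebra_simps)
    also have "\<dots> = (real k ^ ?n * real ?n) * (\<delta> * ip f f)" by simp
    also have "\<dots> \<le> M * (\<delta> * ip f f)" using M(2)[OF g] \<delta> a by (intro mult_right_mono) auto
    also have "\<dots> \<le> \<eta> * ip f f" using \<delta>(2) a by (simp add: mult.assoc[symmetric])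
    finally have "?d (w g) \<le> \<eta> * ip f f" .
    moreover have "word_val H \<tau> (w g) = \<one>\<^bsub>H\<^esub>"
      using word_val_hom[OF \<phi>(1) A.is_group B.is_group, of \<sigma> k \<tau> "w g"] \<phi>(2) A.\<sigma>_closed w[OF g] by auto
    ultimately show ?thesis
      using F by (simp add: B.shift_one FF wg(2) algebra_simps)
  qed
  then show ?thesis using f a by blast
qed

section \<open>The word problem\<close>

text \<open>Injectivity of \<sigma> makes the choice of inverse letters an involution, hence a
  permutation.\<close>

lemma generators_involution:
  assumes "marked_group G k \<sigma>"
  obtains \<iota> where "bij_betw \<iota> {..<k} {..<k}" "\<And>i. i < k \<Longrightarrow> \<sigma> (\<iota> i) = inv\<^bsub>G\<^esub> (\<sigma> i)"
proof -
  have G: "group G" and inj: "inj_on \<sigma> {..<k}" and cl: "\<And>i. i < k \<Longrightarrow> \<sigma> i \<in> carrier G"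
    and sym: "\<And>i. i < k \<Longrightarrow> inv\<^bsub>G\<^esub> (\<sigma> i) \<in> \<sigma> ` {..<k}"
    using assms by (auto simp: marked_group_def)
  interpret group G by (rule G)
  have "\<forall>i\<in>{..<k}. \<exists>j. j < k \<and> \<sigma> j = inv\<^bsub>G\<^esub> (\<sigma> i)" using sym by (metis imageE lessThan_iff)
  then obtain \<iota> where \<iota>: "\<And>i. i < k \<Longrightarrow> \<iota> i < k" "\<And>i. i < k \<Longrightarrow> \<sigma> (\<iota> i) = inv\<^bsub>G\<^esub> (\<sigma> i)"
    by (metis lessThan_iff)
  have "\<iota> (\<iota> i) = i" if "i < k" for i
    using inj_onD[OF inj, of "\<iota> (\<iota> i)" i] \<iota> that cl by simp
  then have "bij_betw \<iota> {..<k} {..<k}"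
    using \<iota>(1) by (intro bij_betw_byWitness[of _ \<iota>]) auto
  then show ?thesis using \<iota>(2) that by blast
qed

section \<open>Words, relators and normal closures\<close>

context symmetric_walk
begin

lemma \<iota>_less: "i < k \<Longrightarrow> \<iota> i < k"
  using \<iota>_bij by (auto simp: bij_betw_def)

lemma word_val_mult:
  "u \<in> lists {..<k} \<Longrightarrow> v \<in> lists {..<k} \<Longrightarrow> word_val G \<sigma> (u @ v) = word_val G \<sigma> u \<otimes> word_val G \<sigma> v"
  using \<sigma>_closed by (intro word_val_append[of _ _ k]) (auto simp: is_group)

definition word_inv :: "nat list \<Rightarrow> nat list" where
  "word_inv u = rev (map \<iota> u)"

lemma word_inv_lists: "u \<in> lists {..<k} \<Longrightarrow> word_inv u \<in> lists {..<k}"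
  unfolding word_inv_def using \<iota>_less by auto

lemma word_val_inv: "u \<in> lists {..<k} \<Longrightarrow> word_val G \<sigma> (word_inv u) = inv (word_val G \<sigma> u)"
proof (induction u)
  case (Cons i u)
  then have i: "i < k" and u: "u \<in> lists {..<k}" by auto
  have "word_inv (i # u) = word_inv u @ [\<iota> i]" by (simp add: word_inv_def)
  moreover have "word_val G \<sigma> [\<iota> i] = inv (\<sigma> i)" using i by (simp add: \<sigma>_\<iota> \<sigma>_closed)
  ultimately show ?case
    using Cons.IH[OF u] i u \<iota>_less[OF i] word_inv_lists[OF u] word_val_mult[of "word_inv u" "[\<iota> i]"]
    by (simp add: inv_mult_group \<sigma>_closed word_val_closed del: word_val.simps) 
       (simp add: inv_mult_group \<sigma>_closed word_val_closed)
qed (simp add: word_inv_def)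

lemma generated_by_words:
  "x \<in> generate G (\<sigma> ` {..<k}) \<Longrightarrow> \<exists>u\<in>lists {..<k}. word_val G \<sigma> u = x"
proof (induction rule: generate.induct)
  case one
  show ?case by (rule bexI[of _ "[]"]) auto
next
  case (incl h)
  then obtain i where "i < k" "h = \<sigma> i" by auto
  then show ?case using \<sigma>_closed by (intro bexI[of _ "[i]"]) auto
next
  case (inv h)
  then obtain i where "i < k" "h = \<sigma> i" by auto
  then show ?case using \<sigma>_closed \<iota>_less \<sigma>_\<iota> by (intro bexI[of _ "[\<iota> i]"]) auto
next
  case (eng h1 h2)
  then obtain u v where "u \<in> lists {..<k}" "word_val G \<sigma> u = h1" "v \<in> lists {..<k}" "word_val G \<sigma> v = h2"
    by blast
  then show ?case by (intro bexI[of _ "u @ v"]) (auto simp: word_val_mult)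
qed

end

lemma (in group) normal_closure_normal:
  assumes "x \<in> carrier G" shows "normal_closure G x \<lhd> G"
  unfolding normal_closure_def
proof (rule normal_generateI)
  let ?C = "{g \<otimes> x \<otimes> inv g |g. g \<in> carrier G}"
  show "?C \<subseteq> carrier G" using assms by auto
  fix h g assume "h \<in> ?C" and g: "g \<in> carrier G"
  then obtain a where a: "a \<in> carrier G" "h = a \<otimes> x \<otimes> inv a" by auto
  then have "g \<otimes> h \<otimes> inv g = (g \<otimes> a) \<otimes> x \<otimes> inv (g \<otimes> a)"
    using g assms by (simp add: inv_mult_group m_assoc)
  then show "g \<otimes> h \<otimes> inv g \<in> ?C" using a g by blast
qed

lemma (in group) mem_normal_closure:
  assumes "x \<in> carrier G" shows "x \<in> normal_closure G x"
  unfolding normal_closure_def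
  by (rule generate.incl) (use assms in \<open>auto intro!: exI[of _ \<one>]\<close>)

lemma (in group) normal_closure_one: "normal_closure G \<one> = {\<one>}"
proof -
  have "{g \<otimes> \<one> \<otimes> inv g |g. g \<in> carrier G} = {\<one>}" by (auto intro!: exI[of _ \<one>])
  then show ?thesis unfolding normal_closure_def by (simp add: generate_one)
qed

lemma pres_rel_mono: "pres_rel G k \<sigma> R u v \<Longrightarrow> R \<subseteq> R' \<Longrightarrow> pres_rel G k \<sigma> R' u v"
  by (induction rule: pres_rel.induct) (blast intro: pres_rel.intros)+

lemma pres_rel_context: "pres_rel G k \<sigma> R u v \<Longrightarrow> pres_rel G k \<sigma> R (x @ u @ y) (x @ v @ y)"
proof (induction rule: pres_rel.induct)
  case (free i j u v)
  then show ?case using pres_rel.free[of i k j \<sigma> G R "x @ u" "v @ y"] by simp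
next
  case (rel r u v)
  then show ?case using pres_rel.rel[of r R G k \<sigma> "x @ u" "v @ y"] by simp
qed (blast intro: pres_rel.intros)+

text \<open>Contexts in \<open>pres_rel\<close> are arbitrary lists. Membership in
  \<open>lists {..<k}\<close> is carried along so that the middle term of a transitivity step is
  known to be a word over the letters.\<close>

lemma pres_rel_word_val:
  assumes H: "group H" "\<tau> ` {..<k} \<subseteq> carrier H"
    and inv: "\<And>i j. i < k \<Longrightarrow> j < k \<Longrightarrow> \<sigma> j = inv\<^bsub>G\<^esub> (\<sigma> i) \<Longrightarrow> \<tau> i \<otimes>\<^bsub>H\<^esub> \<tau> j = \<one>\<^bsub>H\<^esub>"
    and R: "\<And>r. r \<in> R \<Longrightarrow> r \<in> lists {..<k} \<and> word_val H \<tau> r = \<one>\<^bsub>H\<^esub>"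
    and "pres_rel G k \<sigma> R u v"
  shows "(u \<in> lists {..<k} \<longleftrightarrow> v \<in> lists {..<k}) \<and>
    (u \<in> lists {..<k} \<longrightarrow> word_val H \<tau> u = word_val H \<tau> v)"
proof -
  interpret group H by (rule H(1))
  have cl: "w \<in> lists {..<k} \<Longrightarrow> word_val H \<tau> w \<in> carrier H" for w
    using H(2) by (induction w) auto
  have app: "u \<in> lists {..<k} \<Longrightarrow> v \<in> lists {..<k} \<Longrightarrow> word_val H \<tau> (u @ v) = word_val H \<tau> u \<otimes>\<^bsub>H\<^esub> word_val H \<tau> v"
    for u v using H by (rule word_val_append)
  have del: "(u @ r @ v \<in> lists {..<k} \<longleftrightarrow> u @ v \<in> lists {..<k}) \<and>
      (u @ r @ v \<in> lists {..<k} \<longrightarrow> word_val H \<tau> (u @ r @ v) = word_val H \<tau> (u @ v))"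
    if "r \<in> lists {..<k}" "word_val H \<tau> r = \<one>\<^bsub>H\<^esub>" for u r v
    using that by (auto simp: app cl simp del: append_assoc)
  show ?thesis using assms(5)
  proof (induction rule: pres_rel.induct)
    case (free i j u v)
    then have "[i, j] \<in> lists {..<k}" "word_val H \<tau> [i, j] = \<one>\<^bsub>H\<^esub>"
      using inv[of i j] H(2) by auto
    then show ?case by (rule del)
  next
    case (rel r u v)
    then show ?case using R del by blast
  qed simp_all
qed

text \<open>Adding w as a relator presents the quotient by the normal closure. One direction
  interprets the relators in the factor group; the other follows the generation of the normal
  closure by conjugates of w.\<close>

lemma (in symmetric_walk) mem_normal_closure_iff_pres_rel:
  assumes gen: "generate G (\<sigma> ` {..<k}) = carrier G"
    and R: "R \<subseteq> lists {..<k}" "\<And>u. u \<in> lists {..<k} \<Longrightarrow> word_val G \<sigma> u = \<one> \<longleftrightarrow> pres_rel G k \<sigma> R u []"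
    and w: "w \<in> lists {..<k}" and u: "u \<in> lists {..<k}"
  shows "word_val G \<sigma> u \<in> normal_closure G (word_val G \<sigma> w) \<longleftrightarrow> pres_rel G k \<sigma> (insert w R) u []"
proof
  let ?N = "normal_closure G (word_val G \<sigma> w)"
  assume rel: "pres_rel G k \<sigma> (insert w R) u []"
  interpret N: normal ?N G by (rule normal_closure_normal[OF word_val_closed[OF w]])
  let ?H = "G Mod ?N" and ?\<tau> = "\<lambda>i. ?N #> \<sigma> i"
  have H: "group ?H" by (rule N.factorgroup_is_group)
  have wv: "word_val ?H ?\<tau> v = ?N #> word_val G \<sigma> v" if "v \<in> lists {..<k}" for v
    using word_val_hom[OF N.r_coset_hom_Mod is_group H _ _ that, of \<sigma> ?\<tau>] \<sigma>_closed by auto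
  have one: "?N #> x = \<one>\<^bsub>?H\<^esub> \<longleftrightarrow> x \<in> ?N" if "x \<in> carrier G" for x
    using coset_join1[OF _ that N.subgroup_axioms] coset_join2[OF that N.subgroup_axioms]
    by (auto simp: FactGroup_def)
  have "word_val ?H ?\<tau> u = word_val ?H ?\<tau> []"
  proof -
    have "(u \<in> lists {..<k} \<longleftrightarrow> [] \<in> lists {..<k}) \<and>
        (u \<in> lists {..<k} \<longrightarrow> word_val ?H ?\<tau> u = word_val ?H ?\<tau> [])"
    proof (rule pres_rel_word_val[OF H _ _ _ rel])
      show "?\<tau> ` {..<k} \<subseteq> carrier ?H" using \<sigma>_closed by (auto simp: FactGroup_def RCOSETS_def)
      show "?\<tau> i \<otimes>\<^bsub>?H\<^esub> ?\<tau> j = \<one>\<^bsub>?H\<^esub>" if "i < k" "j < k" "\<sigma> j = inv (\<sigma> i)" for i j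
        using that \<sigma>_closed[of i] one[of \<one>] N.one_closed by (simp add: FactGroup_def N.rcos_sum)
      fix r assume r: "r \<in> insert w R"
      then have rl: "r \<in> lists {..<k}" using w R by auto
      have "word_val G \<sigma> r \<in> ?N"
      proof (cases "r = w")
        case True
        then show ?thesis using mem_normal_closure[OF word_val_closed[OF w]] by simp
      next
        case False
        then have "r \<in> R" using r by simp
        then have "pres_rel G k \<sigma> R r []" using pres_rel.rel[of r R G k \<sigma> "[]" "[]"] by simp
        then have "word_val G \<sigma> r = \<one>" using R(2)[OF rl] by simp
        then show ?thesis using N.one_closed by simp
      qed
      then show "r \<in> lists {..<k} \<and> word_val ?H ?\<tau> r = \<one>\<^bsub>?H\<^esub>"
        using rl wv[OF rl] one[OF word_val_closed[OF rl]] by simp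
    qed
    then show ?thesis using u by blast
  qed
  then show "word_val G \<sigma> u \<in> ?N"
    using wv[OF u] one[OF word_val_closed[OF u]] by simp
next
  let ?R = "insert w R"
  let ?rel = "pres_rel G k \<sigma> ?R"
  note tr = pres_rel.trans
  have triv: "?rel v []" if "v \<in> lists {..<k}" "word_val G \<sigma> v = \<one>" for v
    using R(2)[OF that(1)] that(2) pres_rel_mono by blast
  \<comment> \<open>The word \<open>v @ word_inv v' @ v'\<close> reduces to either side, by
    cancelling its last two or its first two blocks.\<close>
  have same: "?rel v v'" if v: "v \<in> lists {..<k}" "v' \<in> lists {..<k}"
    and eq: "word_val G \<sigma> v = word_val G \<sigma> v'" for v v'
  proof -
    have "?rel (word_inv v' @ v') []"
      using v word_inv_lists by (intro triv) (auto simp: word_val_mult word_val_inv word_val_closed)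
    then have 1: "?rel (v @ word_inv v' @ v') v"
      using pres_rel_context[of G k \<sigma> ?R _ _ v "[]"] by fastforce
    have "?rel (v @ word_inv v') []"
      using v eq word_inv_lists by (intro triv) (auto simp: word_val_mult word_val_inv word_val_closed)
    then have "?rel (v @ word_inv v' @ v') v'"
      using pres_rel_context[of G k \<sigma> ?R _ _ "[]" v'] by fastforce
    then show ?thesis using 1 pres_rel.sym tr by metis
  qed
  have words: "\<exists>v\<in>lists {..<k}. word_val G \<sigma> v = x" if "x \<in> carrier G" for x
    using generated_by_words that gen by auto
  \<comment> \<open>With a word a for g, v is congruent to \<open>a @ w @ word_inv a\<close>; there
    w is deleted as a relator, and the rest cancels.\<close>
  have conj: "?rel v []" if v: "v \<in> lists {..<k}" and vg: "word_val G \<sigma> v = g \<otimes> word_val G \<sigma> w \<otimes> inv g"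
    and g: "g \<in> carrier G" for v g
  proof -
    obtain a where a: "a \<in> lists {..<k}" "word_val G \<sigma> a = g" using words g by blast
    then have ai: "word_inv a \<in> lists {..<k}" "word_val G \<sigma> (word_inv a) = inv g"
      by (auto simp: word_inv_lists word_val_inv)
    have l: "a @ w @ word_inv a \<in> lists {..<k}" using a ai w by auto
    have "word_val G \<sigma> (a @ w @ word_inv a) = g \<otimes> (word_val G \<sigma> w \<otimes> inv g)"
      using a ai w word_val_mult[of a "w @ word_inv a"] word_val_mult[of w "word_inv a"] by simp
    then have "?rel v (a @ w @ word_inv a)"
      using vg g w by (intro same v l) (simp add: m_assoc word_val_closed)
    also have "?rel (a @ w @ word_inv a) (a @ word_inv a)" by (rule pres_rel.rel) simp
    finally (tr) have "?rel v (a @ word_inv a)" .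
    moreover have "?rel (a @ word_inv a) []"
      using a ai g by (intro triv) (auto simp: word_val_mult)
    ultimately show ?thesis by (rule tr)
  qed
  \<comment> \<open>The induction runs over group elements, so the claim has to cover all words that
    represent the element.\<close>
  have "x \<in> normal_closure G (word_val G \<sigma> w) \<Longrightarrow> \<forall>u\<in>lists {..<k}. word_val G \<sigma> u = x \<longrightarrow> ?rel u []" for x
    unfolding normal_closure_def
  proof (induction rule: generate.induct)
    case one
    then show ?case using triv by blast
  next
    case (incl h)
    then show ?case using conj by blast
  next
    case (inv h)
    then obtain g where g: "g \<in> carrier G" "h = g \<otimes> word_val G \<sigma> w \<otimes> inv g" by auto
    show ?case
    proof (intro ballI impI)
      fix v assume v: "v \<in> lists {..<k}" "word_val G \<sigma> v = inv h"
      have "h \<in> carrier G" using g w word_val_closed by auto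
      then have "word_val G \<sigma> (word_inv v) = h" using v by (simp add: word_val_inv)
      then have "?rel (word_inv v) []" using conj g word_inv_lists v by blast
      then have "?rel (v @ word_inv v) v" using pres_rel_context[of G k \<sigma> ?R _ _ v "[]"] by fastforce
      moreover have "?rel (v @ word_inv v) []"
        using v word_inv_lists \<open>h \<in> carrier G\<close>
        by (intro triv) (auto simp: word_val_mult word_val_inv)
      ultimately show "?rel v []" using pres_rel.sym tr by metis
    qed
  next
    case (eng h1 h2)
    have "generate G {g \<otimes> word_val G \<sigma> w \<otimes> inv g |g. g \<in> carrier G} \<subseteq> carrier G"
      using w word_val_closed by (intro generate_incl) auto
    then have "h1 \<in> carrier G" "h2 \<in> carrier G" using eng.hyps by auto
    then obtain a b where ab: "a \<in> lists {..<k}" "word_val G \<sigma> a = h1" "b \<in> lists {..<k}" "word_val G \<sigma> b = h2"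
      using words by metis
    show ?case
    proof (intro ballI impI)
      fix v assume v: "v \<in> lists {..<k}" "word_val G \<sigma> v = h1 \<otimes> h2"
      have "?rel v (a @ b)" using v ab by (intro same) (auto simp: word_val_mult)
      moreover have "?rel (a @ b) b" using pres_rel_context[of G k \<sigma> ?R a "[]" "[]" b] eng.IH ab by simp
      moreover have "?rel b []" using eng.IH ab by blast
      ultimately show "?rel v []" using tr by metis
    qed
  qed
  then show "word_val G \<sigma> u \<in> normal_closure G (word_val G \<sigma> w) \<Longrightarrow> ?rel u []" using u by blast
qed

text \<open>The relation is symmetric, so its reflexive transitive closure is already the
  congruence. The word w is separate from R because it is an input of the semidecision procedure,
  whereas R is fixed.\<close>

definition deletion_step :: "nat list set \<Rightarrow> nat list \<Rightarrow> nat list \<Rightarrow> nat list \<Rightarrow> bool" where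
  "deletion_step R w a b \<longleftrightarrow> (\<exists>u v r. (r \<in> R \<or> r = w) \<and>
     (a = u @ r @ v \<and> b = u @ v \<or> b = u @ r @ v \<and> a = u @ v))"

lemma pres_rel_iff_rtranclp:
  "pres_rel G k \<sigma> (insert w R) a b \<longleftrightarrow>
    (deletion_step (R \<union> {[i, j] |i j. i < k \<and> j < k \<and> \<sigma> j = inv\<^bsub>G\<^esub> (\<sigma> i)}) w)\<^sup>*\<^sup>* a b"
    (is "?rel a b \<longleftrightarrow> ?step\<^sup>*\<^sup>* a b")
proof
  have "symp ?step" by (rule sympI) (unfold deletion_step_def, blast)
  then have symp: "symp (?step\<^sup>*\<^sup>*)" by (rule symp_rtranclp)
  assume "?rel a b"
  then show "?step\<^sup>*\<^sup>* a b"
  proof (induction rule: pres_rel.induct)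
    case (sym u v)
    from symp sym.IH show ?case by (rule sympD)
  next
    case (trans u v w)
    then show ?case by simp
  next
    case (free i j u v)
    then have "?step (u @ [i, j] @ v) (u @ v)" unfolding deletion_step_def by blast
    then show ?case by blast
  next
    case (rel r u v)
    then have "?step (u @ r @ v) (u @ v)" unfolding deletion_step_def by blast
    then show ?case by blast
  qed simp
next
  have step: "?rel u v" if "?step u v" for u v
  proof -
    from that obtain x y r where r: "r \<in> R \<union> {[i, j] |i j. i < k \<and> j < k \<and> \<sigma> j = inv\<^bsub>G\<^esub> (\<sigma> i)} \<or> r = w"
      and uv: "u = x @ r @ y \<and> v = x @ y \<or> v = x @ r @ y \<and> u = x @ y"
      unfolding deletion_step_def by blast
    have "?rel (x @ r @ y) (x @ y)"
      using r by (auto intro: pres_rel.rel pres_rel.free simp del: append_Cons append_Nil)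
    then show ?thesis using uv pres_rel.sym by auto
  qed
  show "?step\<^sup>*\<^sup>* a b \<Longrightarrow> ?rel a b"
    by (induction rule: rtranclp_induct) (blast intro: pres_rel.refl pres_rel.trans step)+
qed

text \<open>The pairs of mutually inverse letters form a finite set, hence are recognized by a
  finite table and can be counted among the fixed relators.\<close>

lemma semidecidable_pres_rel:
  assumes R: "semidecidable (\<lambda>r. r \<in> R)" and "computable f" "computable g" "computable h"
  shows "semidecidable (\<lambda>x. pres_rel G k \<sigma> (insert (f x) R) (g x) (h x))"
proof -
  define P where "P = {[i, j] |i j. i < k \<and> j < k \<and> \<sigma> j = inv\<^bsub>G\<^esub> (\<sigma> i)}"
  have "P \<subseteq> (\<lambda>(i, j). [i, j]) ` ({..<k} \<times> {..<k})" by (auto simp: P_def)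
  then have "finite P" by (rule finite_subset) simp
  then obtain ps where ps: "set ps = P" using finite_list by blast
  have "decidable (\<lambda>r. \<not> (\<forall>a\<in>set ps. a \<noteq> r))" by (intro computable_intros)
  moreover have "(\<not> (\<forall>a\<in>set ps. a \<noteq> r)) \<longleftrightarrow> r \<in> P" for r using ps by auto
  ultimately have "decidable (\<lambda>r. r \<in> P)" by simp
  then have RP: "semidecidable (\<lambda>r. r \<in> R \<union> P)"
    unfolding Un_iff by (intro semidecidable_disj R semidecidable_decidable)
  have "semidecidable (\<lambda>z. deletion_step (R \<union> P) (fst z) (fst (snd z)) (snd (snd z)))"
    unfolding deletion_step_def
    by (intro semidecidable_ex semidecidable_conj semidecidable_disj semidecidable_comp[OF RP]
        semidecidable_decidable computable_intros)
  then show ?thesis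
    unfolding pres_rel_iff_rtranclp P_def[symmetric] using assms(2-4) by (rule semidecidable_rtranclp)
qed

text \<open>The fraction is the return probability of the walk that the letters induce on G / N. If
  it never exceeded \<rho>^n, \<open>almost_invariant_vectors\<close> would apply to the projection
  onto G / N, and N would be amenable.\<close>

lemma (in symmetric_walk) kesten_normal_subgroup:
  assumes gen: "generate G (\<sigma> ` {..<k}) = carrier G" and N: "N \<lhd> G"
    and non: "\<not> amenable (G\<lparr>carrier := N\<rparr>)"
  shows "\<exists>n. spectral_radius G k \<sigma> ^ n < real (card {w \<in> words k n. word_val G \<sigma> w \<in> N}) / real k ^ n"
proof (rule ccontr)
  assume "\<not> ?thesis"
  then have le: "real (card {w \<in> words k n. word_val G \<sigma> w \<in> N}) / real k ^ n \<le> spectral_radius G k \<sigma> ^ n" for n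
    by (meson not_le)
  interpret N: normal N G by (rule N)
  let ?H = "G Mod N" and ?\<tau> = "\<lambda>i. N #> \<sigma> i" and ?\<phi> = "\<lambda>x. N #> x"
  have H: "group ?H" by (rule N.factorgroup_is_group)
  interpret H: group ?H by (rule H)
  interpret h: group_hom G ?H ?\<phi>
    using N.r_coset_hom_Mod H is_group by (simp add: group_hom_def group_hom_axioms_def)
  have walk: "symmetric_walk ?H k ?\<tau> \<iota>"
    using k_pos \<iota>_bij \<sigma>_\<iota> \<sigma>_closed H
    by (auto simp: symmetric_walk_def symmetric_walk_axioms_def)
  have one: "?\<phi> x = \<one>\<^bsub>?H\<^esub> \<longleftrightarrow> x \<in> N" if "x \<in> carrier G" for x
    using coset_join1[OF _ that N.subgroup_axioms] coset_join2[OF that N.subgroup_axioms]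
    by (auto simp: FactGroup_def)
  have "word_val ?H ?\<tau> w = \<one>\<^bsub>?H\<^esub> \<longleftrightarrow> word_val G \<sigma> w \<in> N" if "w \<in> lists {..<k}" for w
    using word_val_hom[OF N.r_coset_hom_Mod is_group H _ _ that, of \<sigma> ?\<tau>] \<sigma>_closed
      one[OF word_val_closed[OF that]] by auto
  then have "{w \<in> lists {..<k}. length w = n \<and> word_val ?H ?\<tau> w = \<one>\<^bsub>?H\<^esub>}
      = {w \<in> words k n. word_val G \<sigma> w \<in> N}" for n
    by (auto simp: words_def)
  then have ret: "return_prob ?H k ?\<tau> n \<le> spectral_radius G k \<sigma> ^ n" for n
    using le[of n] by (simp add: return_prob_def)
  have "amenable (G\<lparr>carrier := N\<rparr>)"
  proof (rule amenable_of_almost_invariant_vectors[OF N.subgroup_axioms])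
    fix E \<eta> assume E: "finite E" "E \<subseteq> N" and \<eta>: "0 < (\<eta>::real)"
    have "\<exists>w\<in>lists {..<k}. word_val G \<sigma> w = g \<and> ?\<phi> g = \<one>\<^bsub>?H\<^esub>" if "g \<in> E" for g
    proof -
      have g: "g \<in> carrier G" "g \<in> N" using that E N.mem_carrier by auto
      then show ?thesis using generated_by_words[of g] gen one[of g] by auto
    qed
    then show "\<exists>f\<in>fsupp (carrier G). 0 < ip f f \<and> (\<forall>n\<in>E. (1 - \<eta>) * ip f f \<le> ip (shift n f) f)"
      using almost_invariant_vectors[OF symmetric_walk_axioms walk N.r_coset_hom_Mod _ ret E(1) _ \<eta>]
      by blast
  qed
  with non show False by blast
qed

theorem theorem2p1:
  fixes G :: "('g, 'b) monoid_scheme" and k :: nat and \<sigma> :: "nat \<Rightarrow> 'g"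
    and W :: "nat list set"
  assumes "marked_group G k \<sigma>"
    and "recursively_presented G k \<sigma>"
    and "upper_semicomputable (spectral_radius G k \<sigma>)"
    and "W \<subseteq> lists {..<k}"
    and "\<forall>w \<in> W. word_val G \<sigma> w = \<one>\<^bsub>G\<^esub> \<or>
                  \<not> amenable (G\<lparr>carrier := normal_closure G (word_val G \<sigma> w)\<rparr>)"
  shows "\<exists>p. \<forall>w \<in> W. eval p [word_code w] (if word_val G \<sigma> w = \<one>\<^bsub>G\<^esub> then 1 else 0)"
proof (cases "k = 0")
  case True
  \<comment> \<open>Without letters W contains at most the empty word, for which the answer 1 is
    correct.\<close>
  have "eval (Comp Succ [Zero]) [x] 1" for x
    using eval.comp[of "[0]" "[Zero]" "[x]" Succ "Suc 0"] by (simp add: eval.zero eval.succ)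
  moreover have "w = []" if "w \<in> W" for w using that assms(4) True by auto
  ultimately show ?thesis by (intro exI[of _ "Comp Succ [Zero]"]) force
next
  case False
  obtain \<iota> where \<iota>: "bij_betw \<iota> {..<k} {..<k}" "\<And>i. i < k \<Longrightarrow> \<sigma> (\<iota> i) = inv\<^bsub>G\<^esub> (\<sigma> i)"
    using generators_involution[OF assms(1)] by blast
  interpret symmetric_walk G k \<sigma> \<iota>
    using assms(1) False \<iota>
    by (auto simp: symmetric_walk_def symmetric_walk_axioms_def marked_group_def)
  have gen: "generate G (\<sigma> ` {..<k}) = carrier G" using assms(1) by (simp add: marked_group_def)
  let ?\<rho> = "spectral_radius G k \<sigma>"
  let ?N = "\<lambda>w. normal_closure G (word_val G \<sigma> w)"
  obtain R where R: "R \<subseteq> lists {..<k}" "rec_enum (word_code ` R)"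
    "\<And>u. u \<in> lists {..<k} \<Longrightarrow> word_val G \<sigma> u = \<one>\<^bsub>G\<^esub> \<longleftrightarrow> pres_rel G k \<sigma> R u []"
    using assms(2) unfolding recursively_presented_def by blast
  obtain p \<alpha> where p: "\<And>n. eval p [n] (\<alpha> n)" and \<alpha>: "\<And>n. alg_valid (\<alpha> n)"
    "decseq (\<lambda>n. alg_val (\<alpha> n))" "(\<lambda>n. alg_val (\<alpha> n)) \<longlonglongrightarrow> ?\<rho>"
    using assms(3) unfolding upper_semicomputable_def by blast
  \<comment> \<open>For words over the letters, \<open>D w u\<close> means that u is trivial in the
    quotient by the normal closure of w. With the empty relator it is the word problem of G
    itself.\<close>
  define D where "D w u = pres_rel G k \<sigma> (insert w R) u []" for w u
  have D: "D w u \<longleftrightarrow> word_val G \<sigma> u \<in> ?N w" if "w \<in> lists {..<k}" "u \<in> lists {..<k}" for w u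
    unfolding D_def using mem_normal_closure_iff_pres_rel[OF gen R(1,3) that] by simp
  have triv: "D [] u \<longleftrightarrow> word_val G \<sigma> u = \<one>\<^bsub>G\<^esub>" if "u \<in> lists {..<k}" for u
    using D[of "[]" u] that by (simp add: normal_closure_one)
  \<comment> \<open>L lists some words of length n that lie in the normal closure, so
    \<open>length L\<close> / k^n bounds the return probability of the quotient from below. The
    inequality is (a / b)^n \<le> \<open>length L\<close> / k^n without fractions, and a / b is a
    certified bound above \<open>alg_val (\<alpha> j)\<close>, hence above \<rho>.\<close>
  define Q where "Q w \<longleftrightarrow> (\<exists>n a b j L. 0 < n \<and> distinct L \<and>
      (\<forall>u\<in>set L. length u = n \<and> (\<forall>x\<in>set u. x < k) \<and> D w u) \<and>
      a ^ n * k ^ n \<le> length L * b ^ n \<and> root_below (alg_coeffs (\<alpha> j)) (alg_index (\<alpha> j)) a b)" for w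
  have sR: "semidecidable (\<lambda>r. r \<in> R)" by (rule rec_enum_semidecidable[OF R(2)])
  have comp_\<alpha>: "computable \<alpha>" unfolding computable_iff using p by auto
  have sD: "semidecidable (\<lambda>x. D (f x) (g x))" if "computable f" "computable g"
    for f g :: "'c::coded \<Rightarrow> nat list"
    unfolding D_def by (intro semidecidable_pres_rel sR that computable_intros)
  have P: "semidecidable (\<lambda>w. D [] w)" by (intro sD computable_intros)
  have Qs: "semidecidable Q"
    unfolding Q_def alg_coeffs_def alg_index_def
    by (intro semidecidable_ex semidecidable_conj semidecidable_ball_set sD semidecidable_root_below
        computable_comp[OF comp_\<alpha>] semidecidable_decidable computable_intros)
  have "Q w \<longleftrightarrow> \<not> D [] w" if w: "w \<in> W" for w
  proof
    have wl: "w \<in> lists {..<k}" using w assms(4) by blast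
    assume "Q w"
    then obtain n a b j L where n: "0 < n" and L: "distinct L"
      "\<And>u. u \<in> set L \<Longrightarrow> length u = n \<and> (\<forall>x\<in>set u. x < k) \<and> D w u"
      and ab: "a ^ n * k ^ n \<le> length L * b ^ n"
      and rb: "root_below (alg_coeffs (\<alpha> j)) (alg_index (\<alpha> j)) a b"
      unfolding Q_def by blast
    have b: "b > 0" using rb by (auto simp: root_below_def root_certificate_def)
    \<comment> \<open>For trivial w the list consists of returning words of G, which forces a / b
      \<le> \<rho>. But a / b exceeds a term of a sequence decreasing to \<rho>.\<close>
    show "\<not> D [] w"
    proof
      assume "D [] w"
      then have "word_val G \<sigma> w = \<one>\<^bsub>G\<^esub>" using triv[OF wl] by simp
      then have "set L \<subseteq> {u \<in> lists {..<k}. length u = n \<and> word_val G \<sigma> u = \<one>\<^bsub>G\<^esub>}" (is "_ \<subseteq> ?A")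
      proof (intro subsetI CollectI)
        fix u assume u: "u \<in> set L"
        then have "u \<in> lists {..<k}" using L(2) by (auto simp: lists_eq_set)
        then show "u \<in> lists {..<k} \<and> length u = n \<and> word_val G \<sigma> u = \<one>\<^bsub>G\<^esub>"
          using L(2)[OF u] D[OF wl, of u] \<open>word_val G \<sigma> w = \<one>\<^bsub>G\<^esub>\<close> by (simp add: normal_closure_one)
      qed
      moreover have "finite ?A"
        by (rule finite_subset[OF _ finite_words[of k n]]) (auto simp: words_def)
      ultimately have "length L \<le> card ?A" using L(1) by (metis card_mono distinct_card)
      then have 1: "real (length L) / real k ^ n \<le> return_prob G k \<sigma> n"
        by (simp add: return_prob_def divide_right_mono)
      have "real (a ^ n * k ^ n) \<le> real (length L * b ^ n)" using ab by (simp only: of_nat_le_iff)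
      then have "(real a / real b) ^ n \<le> real (length L) / real k ^ n"
        using b False by (simp add: power_divide field_simps)
      also note 1
      also note return_prob_le_spectral_radius
      finally have "(real a / real b) ^ n \<le> ?\<rho> ^ n" .
      then have "real a / real b \<le> ?\<rho>"
        using n spectral_radius_nonneg by (simp add: power_mono_iff)
      moreover have "?\<rho> \<le> alg_val (\<alpha> j)" using decseq_ge[OF \<alpha>(2,3)] .
      moreover have "alg_val (\<alpha> j) < real a / real b" using root_below_sound[OF \<alpha>(1) rb] .
      ultimately show False by simp
    qed
  next
    have wl: "w \<in> lists {..<k}" using w assms(4) by blast
    assume "\<not> D [] w"
    then have "\<not> amenable (G\<lparr>carrier := ?N w\<rparr>)" using w assms(5) triv[OF wl] by blast
    then obtain n where n: "?\<rho> ^ n < real (card {u \<in> words k n. word_val G \<sigma> u \<in> ?N w}) / real k ^ n"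
      using kesten_normal_subgroup[OF gen normal_closure_normal[OF word_val_closed[OF wl]]] by blast
    let ?A = "{u \<in> words k n. word_val G \<sigma> u \<in> ?N w}"
    define q where "q = real (card ?A) / real k ^ n"
    have fin: "finite ?A" using finite_words by simp
    have "card ?A \<le> k ^ n" using card_mono[OF finite_words, of ?A k n] by (simp add: card_words)
    \<comment> \<open>At n = 0 the strict inequality would put the number of at most one word above
      1.\<close>
    then have "n \<noteq> 0" using n by (cases "n = 0") auto
    have q: "?\<rho> ^ n < q" "0 < q" using n spectral_radius_pos unfolding q_def by (auto intro: less_trans[of _ "?\<rho> ^ n"])
    \<comment> \<open>Since \<rho> < y, some \<open>alg_val (\<alpha> j)\<close> is already below y,
      and \<open>root_below_complete\<close> yields a certified rational bound that is at most
      y.\<close>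
    define y where "y = root n q"
    have yn: "y ^ n = q" and y0: "0 < y" using q \<open>n \<noteq> 0\<close> by (auto simp: y_def)
    have "?\<rho> < y" using q(1) yn y0 power_less_imp_less_base[of ?\<rho> n y] by simp
    then have "\<forall>\<^sub>F j in sequentially. alg_val (\<alpha> j) < y" by (rule order_tendstoD(2)[OF \<alpha>(3)])
    then obtain j where "alg_val (\<alpha> j) < y" by (auto simp: eventually_sequentially)
    then obtain a b where b: "0 < b" and ab: "real a / real b \<le> y"
      and rb: "root_below (alg_coeffs (\<alpha> j)) (alg_index (\<alpha> j)) a b"
      using root_below_complete[OF \<alpha>(1) _ y0] by blast
    obtain L where L: "set L = ?A" "distinct L" using finite_distinct_list[OF fin] by blast
    have "(real a / real b) ^ n \<le> q" using power_mono[OF ab, of n] yn by simp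
    then have "real (a ^ n * k ^ n) \<le> real (card ?A * b ^ n)"
      using b False by (simp add: q_def power_divide field_simps)
    then have "a ^ n * k ^ n \<le> length L * b ^ n"
      using L by (metis distinct_card of_nat_le_iff)
    moreover have "length u = n \<and> (\<forall>x\<in>set u. x < k) \<and> D w u" if "u \<in> set L" for u
      using that D[OF wl, of u] unfolding L(1) by (auto simp: words_def)
    ultimately show "Q w" unfolding Q_def using \<open>n \<noteq> 0\<close> L(2) rb by blast
  qed
  then obtain p where "\<forall>w\<in>W. eval p [enc w] (if D [] w then 1 else 0)"
    using semidecidable_complementary_decider[OF P Qs, of W] by blast
  moreover have "D [] w \<longleftrightarrow> word_val G \<sigma> w = \<one>\<^bsub>G\<^esub>" if "w \<in> W" for w
    using triv that assms(4) by blast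
  ultimately show ?thesis unfolding enc_nat_list by (intro exI[of _ p]) auto
qed

end
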